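(* Let $N \ge 2$, let $\Omega \subset \mathbb{R}^N$ be a bounded domain with $0 \in \Omega$, and let $R = \sup_{x \in \Omega} |x|$. Then $$C_N(\Omega) = C_N(B_R) = \left( \frac{N-1}{N} \right)^N,$$ and the infimum $C_N(\Omega)$ is not attained by any $u \in W^{1,N}_0(\Omega)$, $u \not\equiv 0$.
   Context: A domain is a nonempty connected open set. $B_R$ denotes the open ball in $\mathbb{R}^N$ with center $0$ and radius $R$. For a bounded domain $\Omega \subset \mathbb{R}^N$, put $R = \sup_{x \in \Omega}|x|$ (so $R$ depends on $\Omega$, and for the domain $B_R$ itself this quantity is $R$), and define $$C_N(\Omega) = \inf_{u \in W^{1,N}_0(\Omega),\ u \not\equiv 0} \frac{\int_\Omega |\nabla u|^N\,dx}{\int_\Omega \frac{|u(x)|^N}{|x|^N \left( \log \frac{R}{|x|} \right)^N}\,dx}.$$ The infimum is said to be attained if some $u \in W^{1,N}_0(\Omega)$, $u \not\equiv 0$, realizes equality in the quotient. *)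

theory Defs
  imports "HOL-Analysis.Analysis"
begin

definition grad :: "(real^'n \<Rightarrow> real) \<Rightarrow> real^'n \<Rightarrow> real^'n" where
  "grad f x = (\<chi> i. frechet_derivative f (at x) (axis i 1))"

primrec C_k :: "nat \<Rightarrow> (real^'n \<Rightarrow> real) \<Rightarrow> bool" where
  "C_k 0 f \<longleftrightarrow> continuous_on UNIV f"
| "C_k (Suc k) f \<longleftrightarrow> f differentiable_on UNIV \<and> (\<forall>i. C_k k (\<lambda>x. grad f x $ i))"

text \<open>The space of smooth functions with compact support in \<open>\<Omega>\<close>, extended by zero to the
  whole space.\<close>

definition test_functions :: "(real^'n) set \<Rightarrow> (real^'n \<Rightarrow> real) set" where
  "test_functions \<Omega> = {\<phi>. (\<forall>k. C_k k \<phi>) \<and>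
     compact (closure {x. \<phi> x \<noteq> 0}) \<and> closure {x. \<phi> x \<noteq> 0} \<subseteq> \<Omega>}"

text \<open>Elements of the following spaces are functions on the whole space of which only the
  restriction to \<open>\<Omega>\<close> matters; functions that agree almost everywhere on \<open>\<Omega>\<close> are not identified.\<close>

definition L_space :: "nat \<Rightarrow> (real^'n) set \<Rightarrow> (real^'n \<Rightarrow> 'b::euclidean_space) set" where
  "L_space p \<Omega> = {f. f \<in> borel_measurable (lebesgue_on \<Omega>) \<and>
     integrable (lebesgue_on \<Omega>) (\<lambda>x. norm (f x) ^ p)}"

definition locally_integrable_on ::
    "(real^'n) set \<Rightarrow> (real^'n \<Rightarrow> 'b::euclidean_space) \<Rightarrow> bool" where
  "locally_integrable_on \<Omega> f \<longleftrightarrow>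
     (\<forall>K. compact K \<longrightarrow> K \<subseteq> \<Omega> \<longrightarrow> set_integrable lebesgue K f)"

definition has_weak_gradient ::
    "(real^'n) set \<Rightarrow> (real^'n \<Rightarrow> real) \<Rightarrow> (real^'n \<Rightarrow> real^'n) \<Rightarrow> bool" where
  "has_weak_gradient \<Omega> u g \<longleftrightarrow> locally_integrable_on \<Omega> u \<and> locally_integrable_on \<Omega> g \<and>
     (\<forall>\<phi>\<in>test_functions \<Omega>.
        integral\<^sup>L (lebesgue_on \<Omega>) (\<lambda>x. u x *\<^sub>R grad \<phi> x) =
          - integral\<^sup>L (lebesgue_on \<Omega>) (\<lambda>x. \<phi> x *\<^sub>R g x))"

text \<open>On an open set the weak gradient, if it exists, is unique up to null sets; below it only
  occurs under integrals over \<open>\<Omega>\<close>.\<close>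

definition weak_grad :: "(real^'n) set \<Rightarrow> (real^'n \<Rightarrow> real) \<Rightarrow> real^'n \<Rightarrow> real^'n" where
  "weak_grad \<Omega> u = (SOME g. has_weak_gradient \<Omega> u g)"

definition sobolev :: "nat \<Rightarrow> (real^'n) set \<Rightarrow> (real^'n \<Rightarrow> real) set" where
  "sobolev p \<Omega> = {u \<in> L_space p \<Omega>.
     (\<exists>g. has_weak_gradient \<Omega> u g) \<and> weak_grad \<Omega> u \<in> L_space p \<Omega>}"

text \<open>The closure of the test functions in the Sobolev norm.\<close>

definition sobolev_0 :: "nat \<Rightarrow> (real^'n) set \<Rightarrow> (real^'n \<Rightarrow> real) set" where
  "sobolev_0 p \<Omega> = {u \<in> sobolev p \<Omega>. \<exists>\<phi> :: nat \<Rightarrow> real^'n \<Rightarrow> real.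
     (\<forall>k. \<phi> k \<in> test_functions \<Omega>) \<and>
     (\<lambda>k. \<integral>\<^sup>+x. ennreal (\<bar>\<phi> k x - u x\<bar> ^ p) \<partial>lebesgue_on \<Omega>) \<longlonglongrightarrow> 0 \<and>
     (\<lambda>k. \<integral>\<^sup>+x. ennreal (norm (grad (\<phi> k) x - weak_grad \<Omega> u x) ^ p) \<partial>lebesgue_on \<Omega>)
       \<longlonglongrightarrow> 0}"

definition outer_radius :: "(real^'n) set \<Rightarrow> real" where
  "outer_radius \<Omega> = (SUP x\<in>\<Omega>. norm x)"

text \<open>Both integrals of the quotient are taken in \<open>[0,\<infinity>]\<close>, since finiteness of the
  denominator is not known a priori. It is positive unless \<open>u = 0\<close> almost everywhere: for
  open \<open>\<Omega>\<close> and \<open>0 \<noteq> x \<in> \<Omega>\<close> one has \<open>0 < norm x < outer_radius \<Omega>\<close>. At the null set \<open>{0}\<close> the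
  integrand takes the value \<open>0\<close>, as division by zero yields zero.\<close>

definition hardy_quotient :: "(real^'n) set \<Rightarrow> (real^'n \<Rightarrow> real) \<Rightarrow> ennreal" where
  "hardy_quotient \<Omega> u =
     (\<integral>\<^sup>+x. ennreal (norm (weak_grad \<Omega> u x) ^ CARD('n)) \<partial>lebesgue_on \<Omega>) /
     (\<integral>\<^sup>+x. ennreal (\<bar>u x\<bar> ^ CARD('n) /
        (norm x ^ CARD('n) * ln (outer_radius \<Omega> / norm x) ^ CARD('n))) \<partial>lebesgue_on \<Omega>)"

definition hardy_admissible :: "(real^'n) set \<Rightarrow> (real^'n \<Rightarrow> real) set" where
  "hardy_admissible \<Omega> =
     {u \<in> sobolev_0 CARD('n) \<Omega>. \<not> (AE x in lebesgue_on \<Omega>. u x = 0)}"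

definition hardy_const :: "(real^'n) set \<Rightarrow> ennreal" where
  "hardy_const \<Omega> = (INF u\<in>hardy_admissible \<Omega>. hardy_quotient \<Omega> u)"

definition hardy_attained :: "(real^'n) set \<Rightarrow> bool" where
  "hardy_attained \<Omega> \<longleftrightarrow> (\<exists>u\<in>hardy_admissible \<Omega>. hardy_quotient \<Omega> u = hardy_const \<Omega>)"

end

theory Submission
  imports Defs
begin

text \<open>
  Write \<open>N\<close> for the dimension, \<open>c = (N - 1) / N\<close>, \<open>t = ln (R / norm x)\<close> and \<open>w = 1 / (norm x * t) ^ N\<close>,
  where \<open>R\<close> is the outer radius, so that the denominator of the quotient is the integral of \<open>\<bar>u\<bar> ^ N * w\<close>.
  For a radial function the substitution \<open>t\<close> turns the quotient into the quotient of the
  one-dimensional Hardy inequality on the half-line with exponent \<open>N\<close>, whose constant is \<open>c ^ N\<close> and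
  whose only candidate for a minimiser, \<open>t\<close> to the power \<open>c\<close>, has infinite energy.

  \<^emph>\<open>Lower bound and non-attainment.\<close>  For a test function \<open>\<phi>\<close> and a vector field \<open>G\<close>, integration by
  parts and Young's inequality bound the integral of \<open>norm (grad \<phi>) ^ N\<close> from below by that of
  \<open>\<bar>\<phi>\<bar> ^ N\<close> times \<open>div G - (N - 1) * \<bar>G\<bar> powr (N / (N - 1))\<close>.  The field used here is
  \<open>G = ((c + s * (norm x)\<^sup>2) / (norm x * t)) ^ (N - 1)\<close> times the unit vector in direction \<open>x\<close>.  For
  \<open>s = 0\<close> the resulting potential is exactly \<open>c ^ N * w\<close>, which is Hardy's inequality.  For \<open>s > 0\<close> it
  gains a term of first order, \<open>\<alpha> * s * (norm x)\<^sup>2 * t * w\<close>, and loses only \<open>\<beta> * s\<^sup>2 * w\<close>, because \<open>c\<close>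
  maximises \<open>b ^ (N - 1) * (1 - b)\<close> (\<open>potential_lower\<close>).  By density the inequality holds on the whole
  Sobolev space (\<open>sobolev_0_inequality\<close>, \<open>hardy_with_remainder\<close>).  If the quotient of \<open>u\<close> were at most
  \<open>c ^ N\<close>, comparing the two orders in \<open>s\<close> as \<open>s\<close> tends to \<open>0\<close> would force the integral of
  \<open>\<bar>u\<bar> ^ N * (norm x)\<^sup>2 * t * w\<close> to vanish, that is, \<open>u = 0\<close> almost everywhere.  Hence the quotient of
  every admissible function is strictly above \<open>c ^ N\<close> (\<open>hardy_quotient_bound\<close>).

  \<^emph>\<open>Upper bound.\<close>  The near-extremals multiply \<open>t\<close> to the power \<open>c\<close> by a cut-off \<open>\<eta> (\<delta> * ln t)\<close> with
  \<open>\<eta>\<close> a fixed bump on \<open>{1..2}\<close>.  For small \<open>\<delta>\<close> they live in an annulus so close to the origin that it lies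
  in \<open>\<Omega>\<close>.  Numerator and denominator are both integrals of some \<open>q (\<delta> * ln t)\<close> against the density
  \<open>1 / (norm x ^ N * t)\<close>, and such integrals depend on \<open>q\<close> only through its integral over the line
  (\<open>shell_integral_proportional\<close>).  So the quotient equals that of the integrals of
  \<open>\<bar>c * \<eta> + \<delta> * \<eta>'\<bar> ^ N\<close> and \<open>\<bar>\<eta>\<bar> ^ N\<close> (\<open>hardy_const_le_profile\<close>), which tends to \<open>c ^ N\<close>.  Evaluating
  the quotient of a test function requires that its weak gradient is the classical one, which
  is the uniqueness of weak gradients (\<open>weak_gradient_unique\<close>).
\<close>

section \<open>Integration by parts on Euclidean space\<close>

lemma has_derivative_zero_outside:
  fixes f :: "'a::euclidean_space \<Rightarrow> real"
  assumes der: "(f has_derivative D) (at x)"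
    and K: "compact K" "\<And>x. x \<notin> K \<Longrightarrow> f x = 0" "x \<notin> K"
  shows "D = (\<lambda>h. 0)"
proof -
  have "((\<lambda>x. 0) has_derivative D) (at x)"
    by (rule has_derivative_transform_within_open[OF der, of "- K"])
      (use K in \<open>auto simp: compact_imp_closed open_Compl\<close>)
  then show ?thesis
    using has_derivative_unique has_derivative_const by blast
qed

lemma gradient_zero_outside:
  fixes f :: "'a::euclidean_space \<Rightarrow> real"
  assumes der: "(f has_derivative (\<lambda>h. F \<bullet> h)) (at x)"
    and K: "compact K" "\<And>x. x \<notin> K \<Longrightarrow> f x = 0" "x \<notin> K"
  shows "F = 0"
proof -
  have "F \<bullet> F = 0" using has_derivative_zero_outside[OF der K] by metis
  then show ?thesis by simp
qed

text \<open>The difference quotients of \<open>f\<close> in direction \<open>e\<close> integrate to zero because Lebesgue measure is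
  translation invariant, and dominated convergence passes to the derivative.\<close>

lemma integral_directional_derivative_zero:
  fixes f :: "'a::euclidean_space \<Rightarrow> real"
  assumes der: "\<And>x. (f has_derivative f' x) (at x)"
    and cont: "continuous_on UNIV (\<lambda>x. f' x e)"
    and K: "compact K" "\<And>x. x \<notin> K \<Longrightarrow> f x = 0"
  shows "has_bochner_integral lborel (\<lambda>x. f' x e) 0"
proof -
  have contf: "continuous_on UNIV f"
    using der by (meson continuous_at_imp_continuous_on has_derivative_continuous)
  have f'0: "f' x e = 0" if "x \<notin> K" for x
    using has_derivative_zero_outside[OF der[of x] K that] by simp
  obtain B where B: "\<And>x. \<bar>f' x e\<bar> \<le> B"
  proof -
    have "compact ((\<lambda>x. f' x e) ` K)"
      using cont K(1) by (intro compact_continuous_image) (auto intro: continuous_on_subset)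
    then obtain B where "\<And>x. x \<in> K \<Longrightarrow> \<bar>f' x e\<bar> \<le> B"
      unfolding compact_eq_bounded_closed bounded_iff by auto
    then have "\<bar>f' x e\<bar> \<le> max B 0" for x using f'0[of x] by (cases "x \<in> K") force+
    then show ?thesis using that by blast
  qed
  \<comment> \<open>A compact set that contains the supports of all difference quotients with step at most \<open>1\<close>.\<close>
  define K' where "K' = (\<lambda>p. fst p - snd p *\<^sub>R e) ` (K \<times> {0..1})"
  have K': "compact K'" unfolding K'_def
    by (intro compact_continuous_image compact_Times K compact_Icc) (auto intro!: continuous_intros)
  define h where "h n = 1 / real (Suc n)" for n
  have h0: "h n > 0" "h n \<le> 1" for n by (auto simp: h_def)
  define g where "g n x = (f (x + h n *\<^sub>R e) - f x) / h n" for n x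
  have intf: "integrable lborel f"
  proof -
    have "integrable lborel (\<lambda>x. indicator K x *\<^sub>R f x)"
      using K contf by (intro borel_integrable_compact) (auto intro: continuous_on_subset)
    also have "(\<lambda>x. indicator K x *\<^sub>R f x) = f" using K(2) by (auto simp: indicator_def fun_eq_iff)
    finally show ?thesis .
  qed
  have shift: "has_bochner_integral lborel (\<lambda>x. f (x + v)) (integral\<^sup>L lborel f)" for v
  proof -
    have "integrable (distr lborel borel ((+) v)) f" using intf by (simp add: lborel_distr_plus)
    then have "integrable lborel (\<lambda>x. f (v + x))"
      by (subst (asm) integrable_distr_eq) (use contf in \<open>auto intro: borel_measurable_continuous_onI\<close>)
    moreover have "integral\<^sup>L (distr lborel borel ((+) v)) f = integral\<^sup>L lborel (\<lambda>x. f (v + x))"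
      by (subst integral_distr) (use contf in \<open>auto intro: borel_measurable_continuous_onI\<close>)
    ultimately show ?thesis by (simp add: has_bochner_integral_iff lborel_distr_plus add.commute)
  qed
  have intg: "integral\<^sup>L lborel (g n) = 0" "integrable lborel (g n)" for n
    using shift[of "h n *\<^sub>R e"] intf by (auto simp: g_def[abs_def] has_bochner_integral_iff)
  have lim: "(\<lambda>n. g n x) \<longlonglongrightarrow> f' x e" for x
  proof -
    have "((\<lambda>s. f (x + s *\<^sub>R e)) has_derivative (\<lambda>s. f' x (s *\<^sub>R e))) (at 0)"
      using der[of x] by (auto intro!: derivative_eq_intros has_derivative_compose[of "\<lambda>s. x + s *\<^sub>R e" _ 0 UNIV f "f' x"])
    moreover have "f' x (s *\<^sub>R e) = f' x e * s" for s
      using der[of x] by (simp add: has_derivative_def bounded_linear.linear linear_cmul)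
    ultimately have "((\<lambda>s. f (x + s *\<^sub>R e)) has_real_derivative f' x e) (at 0)"
      by (simp add: has_field_derivative_def)
    then have "((\<lambda>s. (f (x + s *\<^sub>R e) - f x) / s) \<longlongrightarrow> f' x e) (at 0)"
      by (simp add: DERIV_def)
    moreover have "filterlim h (at 0) sequentially"
      unfolding filterlim_at h_def
      using LIMSEQ_inverse_real_of_nat by (simp add: inverse_eq_divide)
    ultimately show ?thesis unfolding g_def by (rule filterlim_compose)
  qed
  have bound: "\<bar>g n x\<bar> \<le> indicator K' x *\<^sub>R B" for n x
  proof -
    obtain z where z: "z > 0" "z < h n" "f (x + h n *\<^sub>R e) - f (x + 0 *\<^sub>R e) = (h n - 0) * f' (x + z *\<^sub>R e) e"
    proof -
      have "DERIV (\<lambda>s. f (x + s *\<^sub>R e)) s :> f' (x + s *\<^sub>R e) e" for s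
      proof -
        have "((\<lambda>s. f (x + s *\<^sub>R e)) has_derivative (\<lambda>t. f' (x + s *\<^sub>R e) (t *\<^sub>R e))) (at s)"
          by (auto intro!: derivative_eq_intros has_derivative_compose[of "\<lambda>s. x + s *\<^sub>R e" _ s UNIV f "f' (x + s *\<^sub>R e)"] der)
        moreover have "f' (x + s *\<^sub>R e) (t *\<^sub>R e) = f' (x + s *\<^sub>R e) e * t" for t
          using der[of "x + s *\<^sub>R e"] by (simp add: has_derivative_def bounded_linear.linear linear_cmul)
        ultimately show ?thesis by (simp add: has_field_derivative_def)
      qed
      from MVT2[OF h0(1) this] that show ?thesis by auto
    qed
    have gz: "g n x = f' (x + z *\<^sub>R e) e" using z h0[of n] by (simp add: g_def field_simps)
    have "x \<in> K'" if "x + z *\<^sub>R e \<in> K"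
      unfolding K'_def using that z h0[of n] by (intro image_eqI[of _ _ "(x + z *\<^sub>R e, z)"]) auto
    then show ?thesis using gz f'0 B by (cases "x + z *\<^sub>R e \<in> K") (auto simp: indicator_def order_trans[OF abs_ge_zero B])
  qed
  have m: "(\<lambda>x. f' x e) \<in> borel_measurable lborel" "g n \<in> borel_measurable lborel" for n
    using intg(2) cont by (auto intro: borel_measurable_continuous_onI)
  have w: "integrable lborel (\<lambda>x. indicator K' x *\<^sub>R B)"
    using K' by (intro borel_integrable_compact) auto
  have "integrable lborel (\<lambda>x. f' x e)"
    by (rule integrable_dominated_convergence[where s = g, OF m(1) m(2) w]) (use lim bound in auto)
  moreover have "(\<lambda>n. integral\<^sup>L lborel (g n)) \<longlonglongrightarrow> integral\<^sup>L lborel (\<lambda>x. f' x e)"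
    by (rule integral_dominated_convergence[where s = g, OF m(1) m(2) w]) (use lim bound in auto)
  ultimately show ?thesis using intg(1) by (simp add: has_bochner_integral_iff LIMSEQ_const_iff)
qed

text \<open>The divergence theorem for the field \<open>\<theta> (x \<bullet> x) *\<^sub>R x\<close> tested against \<open>f\<close>.  The profile \<open>\<theta>\<close> has to be
  differentiable only at the squared radii that occur in the support of \<open>f\<close>, so fields that are
  singular at the origin or on the outer sphere are admitted.\<close>

lemma integral_radial_divergence:
  fixes f :: "'a::euclidean_space \<Rightarrow> real" and F :: "'a \<Rightarrow> 'a" and \<theta> \<theta>' :: "real \<Rightarrow> real"
  assumes der: "\<And>x. (f has_derivative (\<lambda>h. F x \<bullet> h)) (at x)"
    and cont: "continuous_on UNIV F"
    and K: "compact K" "\<And>x. x \<notin> K \<Longrightarrow> f x = 0"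
    and I: "open I" "\<And>x. x \<in> K \<Longrightarrow> x \<bullet> x \<in> I"
    and \<theta>: "\<And>\<rho>. \<rho> \<in> I \<Longrightarrow> (\<theta> has_real_derivative \<theta>' \<rho>) (at \<rho>)"
    and \<theta>': "continuous_on I \<theta>'"
  shows "has_bochner_integral lborel (\<lambda>x. f x * (real DIM('a) * \<theta> (x \<bullet> x) + 2 * (x \<bullet> x) * \<theta>' (x \<bullet> x))
            + \<theta> (x \<bullet> x) * (F x \<bullet> x)) 0"
proof -
  have contf: "continuous_on UNIV f"
    using der by (meson continuous_at_imp_continuous_on has_derivative_continuous)
  have opK: "open (- K)" using K(1) by (simp add: compact_imp_closed open_Compl)
  have F0: "F x = 0" if "x \<notin> K" for x
    using gradient_zero_outside[OF der[of x] K that] .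
  define U where "U = (\<lambda>x::'a. x \<bullet> x) -` I"
  have U: "open U" "K \<subseteq> U"
    unfolding U_def using I by (auto intro!: open_vimage continuous_intros)
  have cont\<theta>: "continuous_on I \<theta>"
    using \<theta> by (meson DERIV_isCont continuous_at_imp_continuous_on)
  have each: "has_bochner_integral lborel
      (\<lambda>x. (F x \<bullet> b) * ((x \<bullet> b) * \<theta> (x \<bullet> x)) + f x * ((b \<bullet> b) * \<theta> (x \<bullet> x) + (x \<bullet> b) * (\<theta>' (x \<bullet> x) * (2 * (x \<bullet> b))))) 0" for b
  proof -
    let ?D = "\<lambda>x h. (F x \<bullet> h) * ((x \<bullet> b) * \<theta> (x \<bullet> x)) + f x * ((h \<bullet> b) * \<theta> (x \<bullet> x) + (x \<bullet> b) * (\<theta>' (x \<bullet> x) * (2 * (x \<bullet> h))))"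
    have d: "((\<lambda>x. f x * ((x \<bullet> b) * \<theta> (x \<bullet> x))) has_derivative ?D x) (at x)" for x
    proof (cases "x \<in> K")
      case True
      then have "x \<bullet> x \<in> I" using I by auto
      have t: "((\<lambda>x. \<theta> (x \<bullet> x)) has_derivative (\<lambda>h. (2 * (x \<bullet> h)) * \<theta>' (x \<bullet> x))) (at x)"
      proof (rule DERIV_compose_FDERIV[where f = \<theta> and g = "\<lambda>x. x \<bullet> x", OF \<theta>[OF \<open>x \<bullet> x \<in> I\<close>]])
        show "((\<lambda>x. x \<bullet> x) has_derivative (\<lambda>h. 2 * (x \<bullet> h))) (at x)"
          by (auto intro!: derivative_eq_intros simp: inner_commute)
      qed
      show ?thesis
        by (rule derivative_eq_intros der t refl | simp add: algebra_simps)+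
    next
      case False
      have "((\<lambda>x. 0) has_derivative ?D x) (at x)"
        using F0[OF False] K(2)[OF False] by simp
      then show ?thesis
        by (rule has_derivative_transform_within_open[where s = "- K"]) (use opK False K(2) in auto)
    qed
    have c: "continuous_on UNIV (\<lambda>x. ?D x b)"
    proof -
      have "continuous_on U (\<lambda>x. ?D x b)"
        by (intro continuous_intros continuous_on_compose2[OF cont\<theta>] continuous_on_compose2[OF \<theta>']
            continuous_on_subset[OF contf] continuous_on_subset[OF cont]) (auto simp: U_def)
      moreover have "continuous_on (- K) (\<lambda>x. ?D x b) \<longleftrightarrow> continuous_on (- K) (\<lambda>x. 0::real)"
        by (rule continuous_on_cong) (auto simp: F0 K(2))
      ultimately have "continuous_on (U \<union> - K) (\<lambda>x. ?D x b)"
        using U opK by (intro continuous_on_open_Un) auto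
      moreover have "U \<union> - K = UNIV" using U by auto
      ultimately show ?thesis by simp
    qed
    show ?thesis
      by (rule integral_directional_derivative_zero[OF d c K(1)]) (use K(2) in auto)
  qed
  have "has_bochner_integral lborel
      (\<lambda>x. \<Sum>b\<in>Basis. (F x \<bullet> b) * ((x \<bullet> b) * \<theta> (x \<bullet> x)) + f x * ((b \<bullet> b) * \<theta> (x \<bullet> x) + (x \<bullet> b) * (\<theta>' (x \<bullet> x) * (2 * (x \<bullet> b))))) (\<Sum>b\<in>(Basis::'a set). 0)"
    by (intro has_bochner_integral_sum each)
  moreover have "(\<Sum>b\<in>Basis. (F x \<bullet> b) * ((x \<bullet> b) * \<theta> (x \<bullet> x)) + f x * ((b \<bullet> b) * \<theta> (x \<bullet> x) + (x \<bullet> b) * (\<theta>' (x \<bullet> x) * (2 * (x \<bullet> b))))) =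
     f x * (real DIM('a) * \<theta> (x \<bullet> x) + 2 * (x \<bullet> x) * \<theta>' (x \<bullet> x)) + \<theta> (x \<bullet> x) * (F x \<bullet> x)" for x
  proof -
    have 1: "x \<bullet> x = (\<Sum>b\<in>Basis. (x \<bullet> b) * (x \<bullet> b))" "F x \<bullet> x = (\<Sum>b\<in>Basis. (F x \<bullet> b) * (x \<bullet> b))"
      by (rule euclidean_inner)+
    have "(\<Sum>b\<in>Basis. (F x \<bullet> b) * ((x \<bullet> b) * \<theta> (x \<bullet> x)) + f x * ((b \<bullet> b) * \<theta> (x \<bullet> x) + (x \<bullet> b) * (\<theta>' (x \<bullet> x) * (2 * (x \<bullet> b)))))
       = (\<Sum>b\<in>Basis. \<theta> (x \<bullet> x) * ((F x \<bullet> b) * (x \<bullet> b)) + (f x * \<theta> (x \<bullet> x) + (2 * f x * \<theta>' (x \<bullet> x)) * ((x \<bullet> b) * (x \<bullet> b))))"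
      by (intro sum.cong) (auto simp: algebra_simps)
    also have "\<dots> = \<theta> (x \<bullet> x) * (F x \<bullet> x) + (real DIM('a) * (f x * \<theta> (x \<bullet> x)) + (2 * f x * \<theta>' (x \<bullet> x)) * (x \<bullet> x))"
      by (simp add: sum.distrib 1(2) sum_distrib_left[symmetric] 1(1)[symmetric])
    finally show ?thesis by (simp add: algebra_simps)
  qed
  ultimately show ?thesis by simp
qed

section \<open>Hardy's inequality for test functions\<close>

text \<open>Young's inequality with exponents \<open>n + 1\<close> and \<open>(n + 1) / n\<close>, in a form without real powers.\<close>

lemma young_power:
  fixes a b :: real
  assumes "a \<ge> 0" "b \<ge> 0"
  shows "real (Suc n) * a * b ^ n \<le> a ^ Suc n + real n * b ^ Suc n"
proof (induction n)
  case (Suc n)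
  have "a * (real (Suc n) * a * b ^ n) \<le> a * (a ^ Suc n + real n * b ^ Suc n)"
    using Suc assms by (intro mult_left_mono)
  moreover have "real (Suc n) * b ^ n * (a - b)\<^sup>2 \<ge> 0" using assms by simp
  ultimately show ?case by (simp add: algebra_simps power2_eq_square)
qed simp

text \<open>The hypothesis on \<open>n\<close> makes the power differentiable at \<open>0\<close> as well, with a continuous derivative.\<close>

lemma DERIV_abs_power:
  fixes y :: real
  assumes "n \<ge> 1"
  shows "((\<lambda>y. \<bar>y\<bar> ^ Suc n) has_real_derivative real (Suc n) * \<bar>y\<bar> ^ (n - 1) * y) (at y)"
proof (cases "y = 0")
  case True
  have "((\<lambda>h. \<bar>h\<bar> ^ (n - 1) * h) \<longlongrightarrow> \<bar>0\<bar> ^ (n - 1) * (0::real)) (at 0)"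
    by (intro tendsto_intros)
  moreover have "\<bar>h\<bar> ^ (n - 1) * h = (\<bar>0 + h\<bar> ^ Suc n - \<bar>0\<bar> ^ Suc n) / h" if "h \<noteq> 0" for h :: real
  proof -
    have "\<bar>h\<bar> ^ Suc n = \<bar>h\<bar> ^ (n - 1) * (\<bar>h\<bar> * \<bar>h\<bar>)" using assms by (cases n) auto
    also have "\<dots> = \<bar>h\<bar> ^ (n - 1) * (h * h)" by simp
    finally show ?thesis using that by simp
  qed
  ultimately have "((\<lambda>h. (\<bar>0 + h\<bar> ^ Suc n - \<bar>0\<bar> ^ Suc n) / h) \<longlongrightarrow> (0::real)) (at 0)"
    by (subst Lim_cong_within[where g = "\<lambda>h. \<bar>h\<bar> ^ (n - 1) * h"]) auto
  then show ?thesis unfolding True DERIV_def by simp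
next
  case False
  have "(abs has_real_derivative sgn y) (at y)"
  proof (cases "y > 0")
    case True
    have "((\<lambda>y. y) has_real_derivative sgn y) (at y)" using True by simp
    then show ?thesis
      by (rule has_field_derivative_transform_within_open[of _ _ _ "{0<..}"]) (use True in auto)
  next
    case False
    have "((\<lambda>y. - y) has_real_derivative sgn y) (at y)"
      using False \<open>y \<noteq> 0\<close> by (auto intro!: derivative_eq_intros)
    then show ?thesis
      by (rule has_field_derivative_transform_within_open[of _ _ _ "{..<0}"]) (use False \<open>y \<noteq> 0\<close> in auto)
  qed
  then have "((\<lambda>y. \<bar>y\<bar> ^ Suc n) has_real_derivative real (Suc n) * (sgn y * \<bar>y\<bar> ^ n)) (at y)"
    using False by (auto intro!: derivative_eq_intros simp del: power_Suc)
  moreover have "sgn y * \<bar>y\<bar> ^ n = \<bar>y\<bar> ^ (n - 1) * y"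
    using assms by (cases n) (auto simp: abs_sgn sgn_mult_self_eq mult_ac)
  ultimately show ?thesis by (simp add: mult.assoc)
qed

lemma DERIV_sqrt_self:
  assumes "0 < \<rho>"
  shows "(sqrt has_real_derivative sqrt \<rho> / (2 * \<rho>)) (at \<rho>)"
proof -
  have "sqrt \<rho> / (2 * \<rho>) = sqrt \<rho> / \<rho> / 2" by simp
  also have "\<dots> = inverse (sqrt \<rho>) / 2" using assms by (subst sqrt_divide_self_eq) auto
  finally show ?thesis using DERIV_real_sqrt[OF assms] by metis
qed

text \<open>The radial variable as a function of the squared radius \<open>\<rho>\<close>: \<open>ln (R / r)\<close> for \<open>\<rho> = r\<^sup>2\<close>.\<close>

definition log_radius :: "real \<Rightarrow> real \<Rightarrow> real" where
  "log_radius R \<rho> = ln (R\<^sup>2 / \<rho>) / 2"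

lemma log_radius_pos:
  assumes "0 < \<rho>" "\<rho> < R\<^sup>2"
  shows "0 < log_radius R \<rho>"
proof -
  have "1 < R\<^sup>2 / \<rho>" using assms by (simp add: less_divide_eq)
  then have "0 < ln (R\<^sup>2 / \<rho>)" by (rule ln_gt_zero)
  then show ?thesis by (simp add: log_radius_def)
qed

lemma log_radius_norm:
  assumes "0 < R" "x \<noteq> 0"
  shows "log_radius R (x \<bullet> x) = ln (R / norm x)"
proof -
  have "R\<^sup>2 / (x \<bullet> x) = (R / norm x)\<^sup>2" by (simp add: power_divide power2_norm_eq_inner)
  then show ?thesis using assms by (simp add: log_radius_def ln_realpow)
qed

lemma DERIV_log_radius:
  assumes "0 < R" "0 < \<rho>"
  shows "(log_radius R has_real_derivative - (1 / (2 * \<rho>))) (at \<rho>)"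
  unfolding log_radius_def[abs_def] using assms
  by (auto intro!: derivative_eq_intros simp: field_simps power2_eq_square)

lemma continuous_log_radius:
  assumes "0 < R"
  shows "continuous_on {0<..<R\<^sup>2} (log_radius R)"
proof (intro continuous_at_imp_continuous_on ballI)
  fix \<rho> assume "\<rho> \<in> {0<..<R\<^sup>2}"
  then show "isCont (log_radius R) \<rho>" using DERIV_isCont[OF DERIV_log_radius[OF assms]] by simp
qed

text \<open>The vector field is \<open>field (x \<bullet> x + \<epsilon>) *\<^sub>R x\<close> in dimension \<open>n + 1\<close>.  The shift by \<open>\<epsilon>\<close> makes it smooth at the
  origin; with \<open>\<rho> = x \<bullet> x + \<epsilon>\<close> its norm is at most \<open>slope \<rho> ^ n\<close>, with equality for \<open>\<epsilon> = 0\<close>.  Accordingly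
  \<open>potential (x \<bullet> x) \<rho>\<close> is the divergence of the field minus \<open>n * slope \<rho> ^ (n + 1)\<close>, and
  \<open>log_deriv_field\<close> is the logarithmic derivative of \<open>field\<close>.  The last assumption keeps the factor \<open>amp\<close>
  strictly between \<open>0\<close> and \<open>1\<close> on the ball of radius \<open>R\<close>.\<close>

locale hardy_radial =
  fixes n :: nat and R s :: real
  assumes n1: "n \<ge> 1" and R0: "R > 0" and s0: "s \<ge> 0" and small: "real n / real (Suc n) + s * R\<^sup>2 < 1"
begin

definition "crit = real n / real (Suc n)"
definition "amp \<rho> = crit + s * \<rho>" for \<rho> :: real
definition "slope \<rho> = amp \<rho> / (sqrt \<rho> * log_radius R \<rho>)" for \<rho> :: real
definition "field \<rho> = slope \<rho> ^ n / sqrt \<rho>" for \<rho> :: real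
definition "log_deriv_field \<rho> = real n * (s / amp \<rho> - 1 / (2 * \<rho>) + 1 / (2 * \<rho> * log_radius R \<rho>)) - 1 / (2 * \<rho>)" for \<rho> :: real
definition "potential y \<rho> = field \<rho> * (real (Suc n) + 2 * y * log_deriv_field \<rho> - real n * amp \<rho> / log_radius R \<rho>)" for y \<rho> :: real

lemma crit: "crit > 0" "crit < 1" "crit * real (Suc n) = real n"
  using n1 by (auto simp: crit_def field_simps)

lemma amp_pos: "0 \<le> \<rho> \<Longrightarrow> amp \<rho> > 0"
  using crit(1) s0 by (simp add: amp_def add_pos_nonneg)

lemma amp_le: "\<rho> \<le> R\<^sup>2 \<Longrightarrow> amp \<rho> \<le> amp (R\<^sup>2)"
  using s0 by (simp add: amp_def mult_left_mono)

lemma amp_less_1: "amp (R\<^sup>2) < 1"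
  using small by (simp add: amp_def crit_def)

lemma slope_pos: "0 < \<rho> \<Longrightarrow> \<rho> < R\<^sup>2 \<Longrightarrow> slope \<rho> > 0"
  using log_radius_pos amp_pos by (simp add: slope_def)

lemma DERIV_slope:
  assumes "0 < \<rho>" "\<rho> < R\<^sup>2"
  shows "(slope has_real_derivative slope \<rho> * (s / amp \<rho> - 1 / (2 * \<rho>) + 1 / (2 * \<rho> * log_radius R \<rho>))) (at \<rho>)"
proof -
  note l = DERIV_log_radius[OF R0 assms(1)]
  have a: "(amp has_real_derivative s) (at \<rho>)"
    unfolding amp_def[abs_def] by (auto intro!: derivative_eq_intros)
  have q: "(sqrt has_real_derivative sqrt \<rho> / (2 * \<rho>)) (at \<rho>)"
    by (rule DERIV_sqrt_self[OF assms(1)])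
  have p: "sqrt \<rho> > 0" "log_radius R \<rho> > 0" "amp \<rho> > 0" using assms log_radius_pos amp_pos by auto
  show ?thesis
    unfolding slope_def[abs_def]
  proof (rule DERIV_cong[OF DERIV_divide[OF a DERIV_mult[OF q l]]])
    show "sqrt \<rho> * log_radius R \<rho> \<noteq> 0" using p by simp
    show "(s * (sqrt \<rho> * log_radius R \<rho>) - amp \<rho> * (sqrt \<rho> / (2 * \<rho>) * log_radius R \<rho> + - (1 / (2 * \<rho>)) * sqrt \<rho>))
        / (sqrt \<rho> * log_radius R \<rho> * (sqrt \<rho> * log_radius R \<rho>))
      = amp \<rho> / (sqrt \<rho> * log_radius R \<rho>) * (s / amp \<rho> - 1 / (2 * \<rho>) + 1 / (2 * \<rho> * log_radius R \<rho>))"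
      using p assms(1) by (simp add: divide_simps) (simp add: algebra_simps)
  qed
qed

lemma DERIV_field:
  assumes "0 < \<rho>" "\<rho> < R\<^sup>2"
  shows "(field has_real_derivative field \<rho> * log_deriv_field \<rho>) (at \<rho>)"
proof -
  have q: "(sqrt has_real_derivative sqrt \<rho> / (2 * \<rho>)) (at \<rho>)"
    by (rule DERIV_sqrt_self[OF assms(1)])
  have p: "sqrt \<rho> > 0" "slope \<rho> > 0" using assms slope_pos by auto
  define X where "X = s / amp \<rho> - 1 / (2 * \<rho>) + 1 / (2 * \<rho> * log_radius R \<rho>)"
  have d: "(slope has_real_derivative slope \<rho> * X) (at \<rho>)"
    unfolding X_def by (rule DERIV_slope[OF assms])
  show ?thesis
    unfolding field_def[abs_def] log_deriv_field_def X_def[symmetric]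
  proof (rule DERIV_cong[OF DERIV_divide[OF DERIV_power[OF d, of n] q]])
    show "sqrt \<rho> \<noteq> 0" using p by simp
    have e: "real n * (slope \<rho> * X * slope \<rho> ^ (n - Suc 0)) = real n * X * slope \<rho> ^ n"
      using n1 by (cases n) auto
    define q where "q = sqrt \<rho>"
    have q: "\<rho> = q * q" "q > 0" using assms(1) by (auto simp: q_def)
    show "(of_nat n * (slope \<rho> * X * slope \<rho> ^ (n - Suc 0)) * sqrt \<rho> - slope \<rho> ^ n * (sqrt \<rho> / (2 * \<rho>)))
        / (sqrt \<rho> * sqrt \<rho>) = slope \<rho> ^ n / sqrt \<rho> * (real n * X - 1 / (2 * \<rho>))"
      unfolding e q_def[symmetric] using q(2) by (simp add: q(1) field_simps)
  qed
qed

lemma continuous_parts: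
  "continuous_on {0<..<R\<^sup>2} (log_radius R)" "continuous_on {0<..<R\<^sup>2} amp"
  "continuous_on {0<..<R\<^sup>2} field" "continuous_on {0<..<R\<^sup>2} log_deriv_field"
proof -
  show l: "continuous_on {0<..<R\<^sup>2} (log_radius R)"
    by (rule continuous_log_radius[OF R0])
  show a: "continuous_on {0<..<R\<^sup>2} amp"
    unfolding amp_def[abs_def] by (auto intro!: continuous_intros)
  have p: "\<forall>\<rho>\<in>{0<..<R\<^sup>2}. amp \<rho> \<noteq> 0" "\<forall>\<rho>\<in>{0<..<R\<^sup>2}. log_radius R \<rho> \<noteq> 0"
    using amp_pos log_radius_pos less_imp_le by (metis greaterThanLessThan_iff less_irrefl)+
  show "continuous_on {0<..<R\<^sup>2} field"
    unfolding field_def[abs_def] slope_def[abs_def]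
    by (intro continuous_intros l a) (use p in auto)
  show "continuous_on {0<..<R\<^sup>2} log_deriv_field"
    unfolding log_deriv_field_def[abs_def]
    by (intro continuous_intros l a) (use p in auto)
qed

lemma potential_eq:
  assumes "0 < \<rho>" "\<rho> < R\<^sup>2"
  shows "potential y \<rho> = field \<rho> / log_radius R \<rho> * (real (Suc n) * log_radius R \<rho> * (1 - y / \<rho>) + real n * (y / \<rho>)
           + 2 * real n * y * s * log_radius R \<rho> / amp \<rho> - real n * amp \<rho>)"
proof -
  have p: "log_radius R \<rho> > 0" "amp \<rho> > 0" using assms log_radius_pos amp_pos by auto
  have "real (Suc n) + 2 * y * log_deriv_field \<rho> - real n * amp \<rho> / log_radius R \<rho> =
     (real (Suc n) * log_radius R \<rho> * (1 - y / \<rho>) + real n * (y / \<rho>)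
           + 2 * real n * y * s * log_radius R \<rho> / amp \<rho> - real n * amp \<rho>) / log_radius R \<rho>"
    using p assms unfolding log_deriv_field_def by (simp add: field_simps)
  then show ?thesis by (simp add: potential_def)
qed

text \<open>A nonnegative potential is what allows Fatou's lemma as \<open>\<epsilon>\<close> tends to \<open>0\<close>.  With \<open>q = y / \<rho>\<close> and \<open>t\<close> the
  logarithmic radius, the claim reduces to \<open>(n + 1) * t * (1 - q) + n * q \<ge> n * amp \<rho>\<close>.  For
  \<open>t \<ge> 1\<close> the left side is at least \<open>n\<close>; for \<open>t < 1\<close> the point stays away from the origin, so \<open>q\<close> is
  close to \<open>1\<close> when \<open>\<epsilon>\<close> is small.\<close>

lemma potential_nonneg:
  assumes y: "0 \<le> y" and e: "0 \<le> \<epsilon>" "\<epsilon> * exp 2 \<le> (1 - amp (R\<^sup>2)) * R\<^sup>2" and \<rho>: "0 < y + \<epsilon>" "y + \<epsilon> < R\<^sup>2"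
  shows "0 \<le> potential y (y + \<epsilon>)"
proof -
  define \<rho> where "\<rho> = y + \<epsilon>"
  have r: "0 < \<rho>" "\<rho> < R\<^sup>2" "y \<le> \<rho>" using \<rho> e by (auto simp: \<rho>_def)
  have p: "log_radius R \<rho> > 0" "amp \<rho> > 0" "field \<rho> > 0"
    using r log_radius_pos amp_pos slope_pos by (auto simp: field_def)
  define q where "q = y / \<rho>"
  have q: "0 \<le> q" "q \<le> 1" using r y by (auto simp: q_def)
  have b1: "amp \<rho> \<le> amp (R\<^sup>2)" using amp_le r by auto
  have t0: "2 * real n * y * s * log_radius R \<rho> / amp \<rho> \<ge> 0" using p y s0 by simp
  have "real (Suc n) * log_radius R \<rho> * (1 - q) + real n * q \<ge> real n * amp \<rho>"
  proof (cases "log_radius R \<rho> \<ge> 1")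
    case True
    have "real n * amp \<rho> \<le> real n * ((1 - q) + q)" using b1 amp_less_1 n1 by simp
    also have "real n * 1 \<le> real (Suc n) * log_radius R \<rho>"
      using True by (intro mult_mono) auto
    then have "real n * (1 - q) \<le> (real (Suc n) * log_radius R \<rho>) * (1 - q)"
      using q by (intro mult_right_mono) auto
    then have "real n * ((1 - q) + q) \<le> real (Suc n) * log_radius R \<rho> * (1 - q) + real n * q"
      by (simp add: algebra_simps)
    finally show ?thesis .
  next
    case False
    then have "ln (R\<^sup>2 / \<rho>) < 2" by (simp add: log_radius_def)
    then have "R\<^sup>2 / \<rho> < exp 2" using r R0 by (metis exp_less_mono exp_ln zero_less_divide_iff zero_less_power)
    then have "R\<^sup>2 < exp 2 * \<rho>" using r by (simp add: field_simps)
    then have "\<epsilon> * exp 2 \<le> (1 - amp (R\<^sup>2)) * (exp 2 * \<rho>)"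
      using e(2) amp_less_1 by (smt (verit) mult_left_mono)
    then have "\<epsilon> * exp 2 \<le> ((1 - amp (R\<^sup>2)) * \<rho>) * exp 2" by (simp add: mult_ac)
    then have "\<epsilon> \<le> (1 - amp (R\<^sup>2)) * \<rho>" by (rule mult_right_le_imp_le) simp
    moreover have "q = 1 - \<epsilon> / \<rho>" using r by (simp add: q_def \<rho>_def field_simps)
    moreover have "\<epsilon> / \<rho> \<le> 1 - amp (R\<^sup>2)" if "\<epsilon> \<le> (1 - amp (R\<^sup>2)) * \<rho>"
      using r that by (simp add: pos_divide_le_eq)
    ultimately have "amp (R\<^sup>2) \<le> q" by linarith
    then have "real n * amp \<rho> \<le> real n * q" using b1 by (intro mult_left_mono) auto
    moreover have "real (Suc n) * log_radius R \<rho> * (1 - q) \<ge> 0" using p q by simp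
    ultimately show ?thesis by linarith
  qed
  then show ?thesis
    using potential_eq[OF r(1,2), of y] p t0 by (auto simp: \<rho>_def[symmetric] q_def[symmetric] intro!: mult_nonneg_nonneg)
qed

text \<open>At \<open>\<epsilon> = 0\<close> the potential times \<open>(r * t) ^ (n + 1)\<close> is \<open>n * b ^ n * (1 - b)\<close> plus a term linear in \<open>s\<close>, where
  \<open>b = crit + s * r\<^sup>2\<close>.  Since \<open>crit\<close> is the critical point of \<open>b ^ n * (1 - b)\<close>, the first term
  departs from its value \<open>crit ^ (n + 1)\<close> only quadratically in \<open>s\<close>.\<close>

lemma potential_lower:
  assumes r: "0 < r" "r < R"
  defines "t \<equiv> ln (R / r)"
  shows "crit ^ Suc n + 2 * real n * crit ^ (n - 1) * s * r\<^sup>2 * t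
      \<le> (r * t) ^ Suc n * potential (r\<^sup>2) (r\<^sup>2) + real n * real (Suc n) * R ^ 4 * s\<^sup>2"
proof -
  have r2: "0 < r\<^sup>2" "r\<^sup>2 < R\<^sup>2" using r by (auto simp: power_strict_mono)
  have lt: "log_radius R (r\<^sup>2) = t"
    using r by (simp add: log_radius_def t_def ln_realpow flip: power_divide)
  have t: "t > 0" using r by (simp add: t_def)
  define b where "b = amp (r\<^sup>2)"
  have b: "crit \<le> b" "b < 1" using amp_le[of "r\<^sup>2"] amp_less_1 r2 s0 by (auto simp: b_def amp_def)
  have b0: "b > 0" using b crit by linarith
  have f: "field (r\<^sup>2) / t = b ^ n / (r * t) ^ Suc n"
    using r t by (simp add: field_def slope_def lt b_def field_simps)
  have bn: "b ^ n = b ^ (n - 1) * b" using n1 by (cases n) auto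
  have "(r * t) ^ Suc n * potential (r\<^sup>2) (r\<^sup>2) = b ^ n * (real n + 2 * real n * r\<^sup>2 * s * t / b - real n * b)"
    using potential_eq[OF r2, of "r\<^sup>2"] r t r2 unfolding lt f b_def[symmetric] by simp
  also have "\<dots> = real n * (b ^ n * (1 - b)) + 2 * real n * s * r\<^sup>2 * t * b ^ (n - 1)"
    unfolding bn using b0 by (simp add: field_simps)
  finally have P: "(r * t) ^ Suc n * potential (r\<^sup>2) (r\<^sup>2) = real n * (b ^ n * (1 - b)) + 2 * real n * s * r\<^sup>2 * t * b ^ (n - 1)" .
  have 1: "2 * real n * s * r\<^sup>2 * t * b ^ (n - 1) \<ge> 2 * real n * s * r\<^sup>2 * t * crit ^ (n - 1)"
    using b crit s0 t by (intro mult_left_mono power_mono) auto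
  have 2: "b ^ n * (1 - b) \<ge> crit ^ n * (1 - crit) - real (Suc n) * (s * r\<^sup>2)\<^sup>2"
  proof (cases "b = crit")
    case False
    then have "crit < b" using b by simp
    have "((\<lambda>x. x ^ n * (1 - x)) has_real_derivative real (Suc n) * x ^ (n - 1) * (crit - x)) (at x)" for x
    proof -
      have "real (Suc n) * crit = real n" using crit(3) by (simp add: mult.commute)
      then have "real (Suc n) * x ^ (n - 1) * (crit - x) = real n * x ^ (n - 1) - real (Suc n) * (x ^ (n - 1) * x)"
        by (metis (no_types, opaque_lifting) mult.assoc mult.commute right_diff_distrib)
      moreover have "x ^ (n - 1) * x = x ^ n" using n1 by (cases n) auto
      ultimately show ?thesis
        using n1 by (auto intro!: derivative_eq_intros simp: algebra_simps)
    qed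
    from MVT2[OF \<open>crit < b\<close> this]
    obtain z where z: "crit < z" "z < b" "b ^ n * (1 - b) - crit ^ n * (1 - crit) = (b - crit) * (real (Suc n) * z ^ (n - 1) * (crit - z))"
      by auto
    have "z > 0" using z(1) crit(1) by linarith
    then have "z ^ (n - 1) \<le> 1" "z ^ (n - 1) \<ge> 0" using z b by (auto intro!: power_le_one)
    then have "(real (Suc n) * z ^ (n - 1)) * (z - crit) \<le> (real (Suc n) * 1) * (b - crit)"
      using z by (intro mult_mono) auto
    then have "(b - crit) * (real (Suc n) * z ^ (n - 1) * (z - crit)) \<le> (b - crit) * ((real (Suc n) * 1) * (b - crit))"
      using z by (intro mult_left_mono) auto
    moreover have "b - crit = s * r\<^sup>2" by (simp add: b_def amp_def)
    ultimately show ?thesis using z(3) by (simp add: algebra_simps power2_eq_square)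
  qed (simp add: )
  have 3: "real n * (crit ^ n * (1 - crit)) = crit ^ Suc n"
  proof -
    have "1 - crit = 1 / real (Suc n)" by (simp add: crit_def field_simps)
    then show ?thesis by (simp add: crit_def)
  qed
  have 4: "real n * real (Suc n) * (s * r\<^sup>2)\<^sup>2 \<le> real n * real (Suc n) * R ^ 4 * s\<^sup>2"
  proof -
    have "r ^ 4 \<le> R ^ 4" using r by (intro power_mono) auto
    then have "real n * real (Suc n) * s\<^sup>2 * r ^ 4 \<le> real n * real (Suc n) * s\<^sup>2 * R ^ 4" by (intro mult_left_mono) auto
    then show ?thesis by (simp add: power_mult_distrib mult_ac flip: power_mult)
  qed
  have "real n * (b ^ n * (1 - b)) \<ge> real n * (crit ^ n * (1 - crit) - real (Suc n) * (s * r\<^sup>2)\<^sup>2)"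
    using 2 by (intro mult_left_mono) auto
  then show ?thesis using P 1 3 4 by (simp add: algebra_simps)
qed

text \<open>Young's inequality with \<open>a = norm (F x)\<close> and \<open>b = \<bar>\<phi> x\<bar> * slope \<rho>\<close> absorbs the term of the divergence
  identity that contains the gradient of \<open>\<phi>\<close>.\<close>

lemma hardy_regularised:
  fixes \<phi> :: "'a::euclidean_space \<Rightarrow> real" and F :: "'a \<Rightarrow> 'a"
  assumes dim: "DIM('a) = Suc n"
    and der: "\<And>x. (\<phi> has_derivative (\<lambda>h. F x \<bullet> h)) (at x)" and cont: "continuous_on UNIV F"
    and K: "compact K" "\<And>x. x \<notin> K \<Longrightarrow> \<phi> x = 0"
    and e: "0 < \<epsilon>" "\<epsilon> * exp 2 \<le> (1 - amp (R\<^sup>2)) * R\<^sup>2" and Ke: "\<And>x. x \<in> K \<Longrightarrow> x \<bullet> x + \<epsilon> < R\<^sup>2"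
  shows "(\<integral>\<^sup>+x. ennreal (\<bar>\<phi> x\<bar> ^ Suc n * potential (x \<bullet> x) (x \<bullet> x + \<epsilon>)) \<partial>lborel) \<le> (\<integral>\<^sup>+x. ennreal (norm (F x) ^ Suc n) \<partial>lborel)"
proof -
  have cont\<phi>: "continuous_on UNIV \<phi>"
    using der by (meson continuous_at_imp_continuous_on has_derivative_continuous)
  have F0: "F x = 0" if "x \<notin> K" for x
    using gradient_zero_outside[OF der[of x] K that] .
  define f where "f x = \<bar>\<phi> x\<bar> ^ Suc n" for x
  define G where "G x = (real (Suc n) * \<bar>\<phi> x\<bar> ^ (n - 1) * \<phi> x) *\<^sub>R F x" for x
  define \<theta> where "\<theta> y = field (y + \<epsilon>)" for y
  define \<theta>' where "\<theta>' y = field (y + \<epsilon>) * log_deriv_field (y + \<epsilon>)" for y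
  define Z where "Z x = f x * (real DIM('a) * \<theta> (x \<bullet> x) + 2 * (x \<bullet> x) * \<theta>' (x \<bullet> x)) + \<theta> (x \<bullet> x) * (G x \<bullet> x)" for x
  have Z: "has_bochner_integral lborel Z 0"
    unfolding Z_def
  proof (rule integral_radial_divergence[OF _ _ K(1)])
    show "(f has_derivative (\<bullet>) (G x)) (at x)" for x
    proof -
      have "(\<bullet>) (G x) = (\<lambda>h. F x \<bullet> h * (real (Suc n) * \<bar>\<phi> x\<bar> ^ (n - 1) * \<phi> x))"
        by (auto simp: G_def fun_eq_iff)
      then show ?thesis
        using DERIV_compose_FDERIV[where f = "\<lambda>y. \<bar>y\<bar> ^ Suc n" and g = \<phi>, OF DERIV_abs_power[OF n1] der[of x]]
        unfolding f_def[abs_def] by (simp only:)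
    qed
    show "continuous_on UNIV G" unfolding G_def[abs_def]
      by (intro continuous_intros cont cont\<phi>)
    show "f x = 0" if "x \<notin> K" for x using K(2) that by (simp add: f_def)
    show "open {- \<epsilon> <..< R\<^sup>2 - \<epsilon>}" by simp
    show "x \<bullet> x \<in> {- \<epsilon> <..< R\<^sup>2 - \<epsilon>}" if "x \<in> K" for x
      using Ke[OF that] e(1) by (simp add: add_nonneg_pos less_diff_eq minus_less_iff) (smt (verit) inner_ge_zero)
    show "(\<theta> has_real_derivative \<theta>' \<rho>) (at \<rho>)" if "\<rho> \<in> {- \<epsilon> <..< R\<^sup>2 - \<epsilon>}" for \<rho>
      using DERIV_field[of "\<rho> + \<epsilon>"] that unfolding \<theta>_def[abs_def] \<theta>'_def DERIV_shift by auto
    show "continuous_on {- \<epsilon> <..< R\<^sup>2 - \<epsilon>} \<theta>'"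
      unfolding \<theta>'_def[abs_def]
      by (intro continuous_intros continuous_on_compose2[OF continuous_parts(3)] continuous_on_compose2[OF continuous_parts(4)]) auto
  qed
  have intN: "integrable lborel (\<lambda>x. norm (F x) ^ Suc n)"
  proof -
    have "integrable lborel (\<lambda>x. indicator K x *\<^sub>R (norm (F x) ^ Suc n))"
      by (intro borel_integrable_compact K continuous_intros continuous_on_subset[OF cont]) auto
    also have "(\<lambda>x. indicator K x *\<^sub>R (norm (F x) ^ Suc n)) = (\<lambda>x. norm (F x) ^ Suc n)"
      using F0 by (auto simp: fun_eq_iff indicator_def)
    finally show ?thesis .
  qed
  have key: "f x * potential (x \<bullet> x) (x \<bullet> x + \<epsilon>) \<le> norm (F x) ^ Suc n + Z x \<and> 0 \<le> norm (F x) ^ Suc n + Z x" for x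
  proof (cases "x \<in> K")
    case False
    then show ?thesis using K(2) F0 by (simp add: Z_def f_def G_def)
  next
    case True
    define \<rho> where "\<rho> = x \<bullet> x + \<epsilon>"
    have r: "0 < \<rho>" "\<rho> < R\<^sup>2" using Ke[OF True] e(1) by (auto simp: \<rho>_def add_nonneg_pos)
    have p: "log_radius R \<rho> > 0" "amp \<rho> > 0" "slope \<rho> > 0" "field \<rho> > 0"
      using r log_radius_pos amp_pos slope_pos by (auto simp: field_def)
    have fl: "field \<rho> * (amp \<rho> / log_radius R \<rho>) = slope \<rho> ^ Suc n"
      using r p by (simp add: field_def slope_def)
    have nx: "field \<rho> * norm x \<le> slope \<rho> ^ n"
    proof -
      have "norm x \<le> sqrt \<rho>" unfolding norm_eq_sqrt_inner \<rho>_def using e by simp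
      then have "slope \<rho> ^ n * (norm x / sqrt \<rho>) \<le> slope \<rho> ^ n * 1"
        using r p by (intro mult_left_mono) auto
      then show ?thesis by (simp add: field_def)
    qed
    have "\<bar>\<theta> (x \<bullet> x) * (G x \<bullet> x)\<bar> = field \<rho> * (real (Suc n) * \<bar>\<phi> x\<bar> ^ n * \<bar>F x \<bullet> x\<bar>)"
      using p n1 by (cases n) (auto simp: \<theta>_def G_def abs_mult \<rho>_def mult_ac)
    also have "\<dots> \<le> field \<rho> * (real (Suc n) * \<bar>\<phi> x\<bar> ^ n * (norm (F x) * norm x))"
      using p by (intro mult_left_mono Cauchy_Schwarz_ineq2) auto
    also have "\<dots> = (real (Suc n) * norm (F x) * \<bar>\<phi> x\<bar> ^ n) * (field \<rho> * norm x)" by simp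
    also have "\<dots> \<le> (real (Suc n) * norm (F x) * \<bar>\<phi> x\<bar> ^ n) * slope \<rho> ^ n"
      using nx by (intro mult_left_mono) auto
    also have "\<dots> = real (Suc n) * norm (F x) * (\<bar>\<phi> x\<bar> * slope \<rho>) ^ n" by (simp add: power_mult_distrib)
    also have "\<dots> \<le> norm (F x) ^ Suc n + real n * (\<bar>\<phi> x\<bar> * slope \<rho>) ^ Suc n"
      using p by (intro young_power) auto
    finally have y: "0 \<le> norm (F x) ^ Suc n + real n * (\<bar>\<phi> x\<bar> * slope \<rho>) ^ Suc n + \<theta> (x \<bullet> x) * (G x \<bullet> x)"
      by linarith
    have "f x * potential (x \<bullet> x) \<rho> = f x * (real DIM('a) * \<theta> (x \<bullet> x) + 2 * (x \<bullet> x) * \<theta>' (x \<bullet> x)) - f x * real n * (field \<rho> * (amp \<rho> / log_radius R \<rho>))"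
      unfolding potential_def dim \<theta>_def \<theta>'_def \<rho>_def[symmetric] by (simp add: algebra_simps)
    also have "\<dots> = f x * (real DIM('a) * \<theta> (x \<bullet> x) + 2 * (x \<bullet> x) * \<theta>' (x \<bullet> x)) - real n * (\<bar>\<phi> x\<bar> * slope \<rho>) ^ Suc n"
      unfolding fl f_def power_mult_distrib by simp
    finally have "f x * potential (x \<bullet> x) \<rho> \<le> norm (F x) ^ Suc n + Z x"
      using y unfolding Z_def by linarith
    moreover have "0 \<le> f x * potential (x \<bullet> x) \<rho>"
      using potential_nonneg[of "x \<bullet> x" \<epsilon>] e r by (auto simp: f_def \<rho>_def)
    ultimately show ?thesis unfolding \<rho>_def by linarith
  qed
  have "(\<integral>\<^sup>+x. ennreal (f x * potential (x \<bullet> x) (x \<bullet> x + \<epsilon>)) \<partial>lborel) \<le> (\<integral>\<^sup>+x. ennreal (norm (F x) ^ Suc n + Z x) \<partial>lborel)"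
    using key by (intro nn_integral_mono ennreal_leI) auto
  also have "\<dots> = ennreal (\<integral>x. norm (F x) ^ Suc n + Z x \<partial>lborel)"
    using key intN Z by (intro nn_integral_eq_integral) (auto simp: has_bochner_integral_iff)
  also have "(\<integral>x. norm (F x) ^ Suc n + Z x \<partial>lborel) = (\<integral>x. norm (F x) ^ Suc n \<partial>lborel)"
    using intN Z by (subst Bochner_Integration.integral_add) (auto simp: has_bochner_integral_iff)
  also have "ennreal \<dots> = (\<integral>\<^sup>+x. ennreal (norm (F x) ^ Suc n) \<partial>lborel)"
    using intN by (intro nn_integral_eq_integral[symmetric]) auto
  finally show ?thesis by (simp add: f_def)
qed

text \<open>Fatou's lemma as the regularisation parameter tends to \<open>0\<close>; the origin, where the unregularised
  field is singular, is a null set.\<close>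

lemma hardy_test_function:
  fixes \<phi> :: "'a::euclidean_space \<Rightarrow> real" and F :: "'a \<Rightarrow> 'a"
  assumes dim: "DIM('a) = Suc n"
    and der: "\<And>x. (\<phi> has_derivative (\<lambda>h. F x \<bullet> h)) (at x)" and cont: "continuous_on UNIV F"
    and K: "compact K" "\<And>x. x \<notin> K \<Longrightarrow> \<phi> x = 0" and KR: "K \<subseteq> ball 0 R"
  shows "(\<integral>\<^sup>+x. ennreal (\<bar>\<phi> x\<bar> ^ Suc n * potential (x \<bullet> x) (x \<bullet> x)) \<partial>lborel) \<le> (\<integral>\<^sup>+x. ennreal (norm (F x) ^ Suc n) \<partial>lborel)"
proof -
  have cont\<phi>: "continuous_on UNIV \<phi>"
    using der by (meson continuous_at_imp_continuous_on has_derivative_continuous)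
  have inner_less: "x \<bullet> x < R\<^sup>2" if "x \<in> K" for x
    using that KR R0 by (auto simp: subset_iff power2_norm_eq_inner[symmetric] intro!: power_strict_mono)
  obtain d where d: "d > 0" "\<And>x. x \<in> K \<Longrightarrow> x \<bullet> x + d < R\<^sup>2"
  proof (cases "K = {}")
    case False
    have "continuous_on K (\<lambda>x. x \<bullet> x)" by (intro continuous_intros)
    then obtain y where y: "y \<in> K" "\<And>x. x \<in> K \<Longrightarrow> x \<bullet> x \<le> y \<bullet> y"
      using continuous_attains_sup[OF K(1) False] by blast
    then show ?thesis using inner_less[OF y(1)] that[of "(R\<^sup>2 - y \<bullet> y) / 2"]
      by (force simp: field_simps)
  qed (use that[of 1] in auto)
  \<comment> \<open>The first bound keeps the shifted squared radius below \<open>R\<^sup>2\<close> on \<open>K\<close>, the second makes the potential nonnegative.\<close>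
  define d' where "d' = min d ((1 - amp (R\<^sup>2)) * R\<^sup>2 / exp 2)"
  have d': "d' > 0" using d amp_less_1 R0 by (auto simp: d'_def)
  define \<epsilon> where "\<epsilon> k = d' / real (Suc k)" for k
  have \<epsilon>0: "\<epsilon> k > 0" "\<epsilon> k \<le> d'" for k using d' by (auto simp: \<epsilon>_def field_simps)
  have \<epsilon>lim: "\<epsilon> \<longlonglongrightarrow> 0"
    using tendsto_mult[OF tendsto_const[of d'] LIMSEQ_inverse_real_of_nat] by (simp add: \<epsilon>_def[abs_def] divide_inverse)
  have ineq: "(\<integral>\<^sup>+x. ennreal (\<bar>\<phi> x\<bar> ^ Suc n * potential (x \<bullet> x) (x \<bullet> x + \<epsilon> k)) \<partial>lborel) \<le> (\<integral>\<^sup>+x. ennreal (norm (F x) ^ Suc n) \<partial>lborel)" for k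
  proof (rule hardy_regularised[OF dim der cont K \<epsilon>0(1)])
    have "\<epsilon> k * exp 2 \<le> ((1 - amp (R\<^sup>2)) * R\<^sup>2 / exp 2) * exp 2"
      using \<epsilon>0[of k] by (intro mult_right_mono) (auto simp: d'_def)
    then show "\<epsilon> k * exp 2 \<le> (1 - amp (R\<^sup>2)) * R\<^sup>2" by simp
    show "x \<bullet> x + \<epsilon> k < R\<^sup>2" if "x \<in> K" for x
      using d(2)[OF that] \<epsilon>0[of k] by (auto simp: d'_def)
  qed auto
  have lim: "(\<lambda>k. ennreal (\<bar>\<phi> x\<bar> ^ Suc n * potential (x \<bullet> x) (x \<bullet> x + \<epsilon> k))) \<longlonglongrightarrow> ennreal (\<bar>\<phi> x\<bar> ^ Suc n * potential (x \<bullet> x) (x \<bullet> x))" if "x \<noteq> 0" for x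
  proof (cases "x \<in> K")
    case True
    have r: "0 < x \<bullet> x" "x \<bullet> x < R\<^sup>2" using inner_less[OF True] that by auto
    have p: "continuous_on {0<..<R\<^sup>2} (potential (x \<bullet> x))"
    proof -
      have "\<forall>\<rho>\<in>{0<..<R\<^sup>2}. log_radius R \<rho> \<noteq> 0" using log_radius_pos by (metis greaterThanLessThan_iff less_irrefl)
      then show ?thesis
        unfolding potential_def[abs_def] by (intro continuous_intros continuous_parts) auto
    qed
    have "isCont (potential (x \<bullet> x)) (x \<bullet> x)"
      using p r by (simp add: continuous_on_eq_continuous_at)
    moreover have "(\<lambda>k. x \<bullet> x + \<epsilon> k) \<longlonglongrightarrow> x \<bullet> x" using tendsto_add[OF tendsto_const \<epsilon>lim] by simp
    ultimately have "(\<lambda>k. potential (x \<bullet> x) (x \<bullet> x + \<epsilon> k)) \<longlonglongrightarrow> potential (x \<bullet> x) (x \<bullet> x)"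
      by (rule isCont_tendsto_compose)
    then show ?thesis by (intro tendsto_ennrealI tendsto_mult tendsto_const)
  qed (use K(2) in auto)
  have m[measurable]: "\<phi> \<in> borel_measurable borel"
    using cont\<phi> by (rule borel_measurable_continuous_onI)
  have "(\<integral>\<^sup>+x. ennreal (\<bar>\<phi> x\<bar> ^ Suc n * potential (x \<bullet> x) (x \<bullet> x)) \<partial>lborel)
     \<le> (\<integral>\<^sup>+x. liminf (\<lambda>k. ennreal (\<bar>\<phi> x\<bar> ^ Suc n * potential (x \<bullet> x) (x \<bullet> x + \<epsilon> k))) \<partial>lborel)"
  proof (rule nn_integral_mono_AE)
    have "AE x in lborel. x \<noteq> (0::'a)" by (rule AE_lborel_singleton)
    then show "AE x in lborel. ennreal (\<bar>\<phi> x\<bar> ^ Suc n * potential (x \<bullet> x) (x \<bullet> x)) \<le> liminf (\<lambda>k. ennreal (\<bar>\<phi> x\<bar> ^ Suc n * potential (x \<bullet> x) (x \<bullet> x + \<epsilon> k)))"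
    proof eventually_elim
      case (elim x)
      from lim_imp_Liminf[OF _ lim[OF elim]] show ?case by simp
    qed
  qed
  also have "\<dots> \<le> liminf (\<lambda>k. \<integral>\<^sup>+x. ennreal (\<bar>\<phi> x\<bar> ^ Suc n * potential (x \<bullet> x) (x \<bullet> x + \<epsilon> k)) \<partial>lborel)"
  proof (rule nn_integral_liminf)
    show "(\<lambda>x. ennreal (\<bar>\<phi> x\<bar> ^ Suc n * potential (x \<bullet> x) (x \<bullet> x + \<epsilon> k))) \<in> borel_measurable lborel" for k
      unfolding potential_def field_def log_deriv_field_def slope_def amp_def log_radius_def by measurable
  qed
  also have "\<dots> \<le> liminf (\<lambda>k. \<integral>\<^sup>+x. ennreal (norm (F x) ^ Suc n) \<partial>lborel)"
    using ineq by (intro Liminf_mono always_eventually) auto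
  finally show ?thesis by (simp add: Liminf_const)
qed

end

section \<open>From test functions to the Sobolev space\<close>

lemma grad_has_derivative:
  assumes "f differentiable (at x)"
  shows "(f has_derivative (\<lambda>h. grad f x \<bullet> h)) (at x)"
proof -
  let ?D = "frechet_derivative f (at x)"
  have D: "(f has_derivative ?D) (at x)" using assms by (simp add: frechet_derivative_works)
  then have lin: "linear ?D" by (simp add: has_derivative_linear)
  have "?D h = grad f x \<bullet> h" for h
  proof -
    have "?D h = ?D (\<Sum>i\<in>UNIV. h $ i *\<^sub>R axis i 1)"
      using basis_expansion[of h] by (simp add: scalar_mult_eq_scaleR)
    also have "\<dots> = (\<Sum>i\<in>UNIV. h $ i * ?D (axis i 1))"
      using lin by (simp add: linear_sum linear_scale)
    also have "\<dots> = grad f x \<bullet> h" by (simp add: grad_def inner_vec_def mult.commute)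
    finally show ?thesis .
  qed
  then have "?D = (\<lambda>h. grad f x \<bullet> h)" by auto
  with D show ?thesis by simp
qed

lemma grad_eqI:
  assumes "(f has_derivative (\<lambda>h. g \<bullet> h)) (at x)"
  shows "grad f x = g"
proof -
  have "frechet_derivative f (at x) = (\<lambda>h. g \<bullet> h)"
    using assms by (metis frechet_derivative_at)
  then show ?thesis by (simp add: grad_def inner_axis vec_eq_iff)
qed

lemma test_functionD:
  assumes "\<phi> \<in> test_functions \<Omega>"
  shows "\<And>x. (\<phi> has_derivative (\<lambda>h. grad \<phi> x \<bullet> h)) (at x)"
    and "continuous_on UNIV \<phi>" "continuous_on UNIV (grad \<phi>)"
    and "compact (closure {x. \<phi> x \<noteq> 0})" "closure {x. \<phi> x \<noteq> 0} \<subseteq> \<Omega>"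
    and "\<And>x. x \<notin> closure {x. \<phi> x \<noteq> 0} \<Longrightarrow> \<phi> x = 0"
    and "\<And>x. x \<notin> closure {x. \<phi> x \<noteq> 0} \<Longrightarrow> grad \<phi> x = 0"
proof -
  have C: "\<And>k. C_k k \<phi>" and c: "compact (closure {x. \<phi> x \<noteq> 0})" "closure {x. \<phi> x \<noteq> 0} \<subseteq> \<Omega>"
    using assms by (auto simp: test_functions_def)
  show "compact (closure {x. \<phi> x \<noteq> 0})" "closure {x. \<phi> x \<noteq> 0} \<subseteq> \<Omega>" by (rule c)+
  have "C_k (Suc 0) \<phi>" by (rule C)
  then have d: "\<phi> differentiable (at x)" and g: "continuous_on UNIV (\<lambda>x. grad \<phi> x $ i)" for x i
    by (auto simp: differentiable_on_def)
  show der: "(\<phi> has_derivative (\<lambda>h. grad \<phi> x \<bullet> h)) (at x)" for x using d by (rule grad_has_derivative)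
  then show "continuous_on UNIV \<phi>"
    by (meson continuous_at_imp_continuous_on has_derivative_continuous)
  have "continuous_on UNIV (\<lambda>x. \<chi> i. grad \<phi> x $ i)" by (intro continuous_on_vec_lambda g)
  then show "continuous_on UNIV (grad \<phi>)" by simp
  show 0: "\<phi> x = 0" if "x \<notin> closure {x. \<phi> x \<noteq> 0}" for x
    using that subsetD[OF closure_subset, of x "{x. \<phi> x \<noteq> 0}"] by blast
  show "grad \<phi> x = 0" if "x \<notin> closure {x. \<phi> x \<noteq> 0}" for x
    by (rule gradient_zero_outside[OF der[of x] c(1) 0 that])
qed

lemma borel_measurable_lebesgue_on:
  "f \<in> borel_measurable borel \<Longrightarrow> f \<in> borel_measurable (lebesgue_on S)"
  by (rule measurable_restrict_space1, rule measurable_completion) simp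

lemma nn_integral_lebesgue_on_support:
  fixes f :: "'a::euclidean_space \<Rightarrow> ennreal"
  assumes "S \<in> sets lebesgue" "\<And>x. x \<notin> S \<Longrightarrow> f x = 0"
  shows "(\<integral>\<^sup>+x. f x \<partial>lebesgue_on S) = (\<integral>\<^sup>+x. f x \<partial>lborel)"
proof -
  have "(\<integral>\<^sup>+x. f x \<partial>lebesgue_on S) = (\<integral>\<^sup>+x. f x * indicator S x \<partial>lebesgue)"
    using assms(1) by (intro nn_integral_restrict_space) auto
  also have "(\<lambda>x. f x * indicator S x) = f" using assms(2) by (auto simp: indicator_def fun_eq_iff)
  finally show ?thesis by (simp add: nn_integral_completion)
qed

text \<open>Convexity of the power, applied to \<open>a + b = l * (a / l) + (1 - l) * (b / (1 - l))\<close>.  It plays the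
  part of Minkowski's inequality: the factor of \<open>a ^ (n + 1)\<close> can be made as close to \<open>1\<close> as desired.\<close>

lemma power_add_le_weighted:
  fixes a b l :: real
  assumes "a \<ge> 0" "b \<ge> 0" "0 < l" "l < 1"
  shows "(a + b) ^ Suc n \<le> l * (1 / l) ^ Suc n * a ^ Suc n + (1 - l) * (1 / (1 - l)) ^ Suc n * b ^ Suc n"
proof -
  have "l * (real (Suc n) * (a / l) * (a + b) ^ n) \<le> l * ((a / l) ^ Suc n + real n * (a + b) ^ Suc n)"
    using assms by (intro mult_left_mono young_power) auto
  moreover have "(1 - l) * (real (Suc n) * (b / (1 - l)) * (a + b) ^ n) \<le> (1 - l) * ((b / (1 - l)) ^ Suc n + real n * (a + b) ^ Suc n)"
    using assms by (intro mult_left_mono young_power) auto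
  moreover have "l * (real (Suc n) * (a / l) * (a + b) ^ n) + (1 - l) * (real (Suc n) * (b / (1 - l)) * (a + b) ^ n) = real (Suc n) * (a + b) ^ Suc n"
    using assms by (simp add: field_simps)
  ultimately have "real (Suc n) * (a + b) ^ Suc n \<le> l * (a / l) ^ Suc n + (1 - l) * (b / (1 - l)) ^ Suc n + real n * (a + b) ^ Suc n"
    by (simp add: algebra_simps del: power_Suc)
  moreover have "real (Suc n) * (a + b) ^ Suc n = real n * (a + b) ^ Suc n + (a + b) ^ Suc n"
    by (simp add: algebra_simps del: power_Suc)
  ultimately have "(a + b) ^ Suc n \<le> l * (a / l) ^ Suc n + (1 - l) * (b / (1 - l)) ^ Suc n" by linarith
  moreover have "l * (a / l) ^ Suc n = l * (1 / l) ^ Suc n * a ^ Suc n"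
    "(1 - l) * (b / (1 - l)) ^ Suc n = (1 - l) * (1 / (1 - l)) ^ Suc n * b ^ Suc n"
    by (simp_all add: power_divide del: power_Suc)
  ultimately show ?thesis by simp
qed

text \<open>Density of the test functions.  Against a weight truncated at height \<open>m\<close> the error \<open>\<phi> k - u\<close> is
  negligible in the limit, since \<open>power_add_le_weighted\<close> compares the \<open>N\<close>-th powers of \<open>u\<close> and \<open>\<phi> k\<close>, and
  those of their gradients, up to a factor that tends to \<open>1\<close> as \<open>l\<close> does.  Monotone convergence
  removes the truncation.\<close>

lemma sobolev_0_inequality:
  fixes u :: "real^'n \<Rightarrow> real" and W :: "real^'n \<Rightarrow> ennreal"
  assumes u: "u \<in> sobolev_0 (Suc n) \<Omega>" and \<Omega>: "open \<Omega>"
    and W: "W \<in> borel_measurable borel"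
    and ineq: "\<And>\<phi>. \<phi> \<in> test_functions \<Omega> \<Longrightarrow>
      (\<integral>\<^sup>+x. ennreal (\<bar>\<phi> x\<bar> ^ Suc n) * W x \<partial>lebesgue_on \<Omega>) \<le> (\<integral>\<^sup>+x. ennreal (norm (grad \<phi> x) ^ Suc n) \<partial>lebesgue_on \<Omega>)"
  shows "(\<integral>\<^sup>+x. ennreal (\<bar>u x\<bar> ^ Suc n) * W x \<partial>lebesgue_on \<Omega>) \<le> (\<integral>\<^sup>+x. ennreal (norm (weak_grad \<Omega> u x) ^ Suc n) \<partial>lebesgue_on \<Omega>)"
proof -
  let ?g = "weak_grad \<Omega> u" and ?M = "lebesgue_on \<Omega>"
  define N where "N = Suc n"
  from u[unfolded sobolev_0_def mem_Collect_eq, THEN conjunct2]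
  obtain \<phi> where \<phi>: "(\<forall>k. \<phi> k \<in> test_functions \<Omega>) \<and>
      (\<lambda>k. \<integral>\<^sup>+x. ennreal (\<bar>\<phi> k x - u x\<bar> ^ Suc n) \<partial>?M) \<longlonglongrightarrow> 0 \<and>
      (\<lambda>k. \<integral>\<^sup>+x. ennreal (norm (grad (\<phi> k) x - ?g x) ^ Suc n) \<partial>?M) \<longlonglongrightarrow> 0"
    by (rule exE)
  from \<phi> have test: "\<And>k. \<phi> k \<in> test_functions \<Omega>" by (rule conjunct1[THEN spec])
  from \<phi> have lim1: "(\<lambda>k. \<integral>\<^sup>+x. ennreal (\<bar>\<phi> k x - u x\<bar> ^ N) \<partial>?M) \<longlonglongrightarrow> 0"
    and lim2: "(\<lambda>k. \<integral>\<^sup>+x. ennreal (norm (grad (\<phi> k) x - ?g x) ^ N) \<partial>?M) \<longlonglongrightarrow> 0"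
    unfolding N_def by (rule conjunct2[THEN conjunct1], rule conjunct2[THEN conjunct2])
  have um[measurable]: "u \<in> borel_measurable ?M" and gm[measurable]: "?g \<in> borel_measurable ?M"
    and gint: "integrable ?M (\<lambda>x. norm (?g x) ^ N)"
    using u by (simp_all add: sobolev_0_def sobolev_def L_space_def N_def del: power_Suc)
  have Wm[measurable]: "W \<in> borel_measurable ?M" using W by (rule borel_measurable_lebesgue_on)
  have pm[measurable]: "\<phi> k \<in> borel_measurable ?M" "grad (\<phi> k) \<in> borel_measurable ?M" for k
    by (rule borel_measurable_lebesgue_on borel_measurable_continuous_onI test_functionD(2,3)[OF test])+
  define g where "g = (\<integral>x. norm (?g x) ^ N \<partial>?M)"
  have G: "(\<integral>\<^sup>+x. ennreal (norm (?g x) ^ N) \<partial>?M) = ennreal g"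
    unfolding g_def using gint by (intro nn_integral_eq_integral) auto
  have g0: "g \<ge> 0" unfolding g_def by simp
  have step: "(\<integral>\<^sup>+x. ennreal (\<bar>u x\<bar> ^ N) * min (W x) (of_nat m) \<partial>?M) \<le> ennreal ((l * (1 / l) ^ N)\<^sup>2 * g)"
    if l: "0 < l" "l < 1" for l :: real and m :: nat
  proof -
    define a where "a = l * (1 / l) ^ N"
    define b where "b = (1 - l) * (1 / (1 - l)) ^ N"
    have ab: "a \<ge> 0" "b \<ge> 0" using l by (auto simp: a_def b_def)
    have conv: "ennreal ((p + q) ^ N) \<le> ennreal a * ennreal (p ^ N) + ennreal b * ennreal (q ^ N)" if "p \<ge> 0" "q \<ge> 0" for p q
    proof -
      have "(p + q) ^ N \<le> a * p ^ N + b * q ^ N"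
        using power_add_le_weighted[OF that l, of n] by (simp only: a_def b_def N_def)
      then have "ennreal ((p + q) ^ N) \<le> ennreal (a * p ^ N + b * q ^ N)" by (rule ennreal_leI)
      also have "\<dots> = ennreal a * ennreal (p ^ N) + ennreal b * ennreal (q ^ N)"
        using ab that by (simp add: ennreal_mult)
      finally show ?thesis .
    qed
    define E where "E k = (\<integral>\<^sup>+x. ennreal (\<bar>\<phi> k x - u x\<bar> ^ N) \<partial>?M)" for k
    define E' where "E' k = (\<integral>\<^sup>+x. ennreal (norm (grad (\<phi> k) x - ?g x) ^ N) \<partial>?M)" for k
    have "(\<integral>\<^sup>+x. ennreal (\<bar>u x\<bar> ^ N) * min (W x) (of_nat m) \<partial>?M) \<le> ennreal a * (ennreal a * ennreal g + ennreal b * E' k) + (ennreal b * of_nat m) * E k" for k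
    proof -
      have "(\<integral>\<^sup>+x. ennreal (\<bar>u x\<bar> ^ N) * min (W x) (of_nat m) \<partial>?M)
        \<le> (\<integral>\<^sup>+x. ennreal a * (ennreal (\<bar>\<phi> k x\<bar> ^ N) * W x) + (ennreal b * of_nat m) * ennreal (\<bar>\<phi> k x - u x\<bar> ^ N) \<partial>?M)"
      proof (rule nn_integral_mono)
        fix x
        have "ennreal (\<bar>u x\<bar> ^ N) \<le> ennreal ((\<bar>\<phi> k x\<bar> + \<bar>\<phi> k x - u x\<bar>) ^ N)"
          by (intro ennreal_leI power_mono) auto
        also have "\<dots> \<le> ennreal a * ennreal (\<bar>\<phi> k x\<bar> ^ N) + ennreal b * ennreal (\<bar>\<phi> k x - u x\<bar> ^ N)"
          by (rule conv) auto
        finally have "ennreal (\<bar>u x\<bar> ^ N) * min (W x) (of_nat m) \<le> (ennreal a * ennreal (\<bar>\<phi> k x\<bar> ^ N) + ennreal b * ennreal (\<bar>\<phi> k x - u x\<bar> ^ N)) * min (W x) (of_nat m)"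
          by (rule mult_right_mono) simp
        also have "\<dots> = (ennreal a * ennreal (\<bar>\<phi> k x\<bar> ^ N)) * min (W x) (of_nat m) + (ennreal b * ennreal (\<bar>\<phi> k x - u x\<bar> ^ N)) * min (W x) (of_nat m)"
          by (simp add: distrib_right)
        also have "\<dots> \<le> (ennreal a * ennreal (\<bar>\<phi> k x\<bar> ^ N)) * W x + (ennreal b * ennreal (\<bar>\<phi> k x - u x\<bar> ^ N)) * of_nat m"
          by (intro add_mono mult_left_mono) auto
        finally show "ennreal (\<bar>u x\<bar> ^ N) * min (W x) (of_nat m) \<le> ennreal a * (ennreal (\<bar>\<phi> k x\<bar> ^ N) * W x) + (ennreal b * of_nat m) * ennreal (\<bar>\<phi> k x - u x\<bar> ^ N)"
          by (simp add: mult_ac)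
      qed
      also have "\<dots> = ennreal a * (\<integral>\<^sup>+x. ennreal (\<bar>\<phi> k x\<bar> ^ N) * W x \<partial>?M) + (ennreal b * of_nat m) * E k"
        unfolding E_def by (simp add: nn_integral_add nn_integral_cmult)
      also have "(\<integral>\<^sup>+x. ennreal (\<bar>\<phi> k x\<bar> ^ N) * W x \<partial>?M) \<le> (\<integral>\<^sup>+x. ennreal (norm (grad (\<phi> k) x) ^ N) \<partial>?M)"
        using ineq[OF test] by (simp add: N_def)
      also have "(\<integral>\<^sup>+x. ennreal (norm (grad (\<phi> k) x) ^ N) \<partial>?M) \<le> (\<integral>\<^sup>+x. ennreal a * ennreal (norm (?g x) ^ N) + ennreal b * ennreal (norm (grad (\<phi> k) x - ?g x) ^ N) \<partial>?M)"
      proof (rule nn_integral_mono)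
        fix x
        have "norm (grad (\<phi> k) x) \<le> norm (?g x) + norm (grad (\<phi> k) x - ?g x)"
          using norm_triangle_ineq[of "?g x" "grad (\<phi> k) x - ?g x"] by simp
        then have "ennreal (norm (grad (\<phi> k) x) ^ N) \<le> ennreal ((norm (?g x) + norm (grad (\<phi> k) x - ?g x)) ^ N)"
          by (intro ennreal_leI power_mono) auto
        also have "\<dots> \<le> ennreal a * ennreal (norm (?g x) ^ N) + ennreal b * ennreal (norm (grad (\<phi> k) x - ?g x) ^ N)"
          by (rule conv) auto
        finally show "ennreal (norm (grad (\<phi> k) x) ^ N) \<le> ennreal a * ennreal (norm (?g x) ^ N) + ennreal b * ennreal (norm (grad (\<phi> k) x - ?g x) ^ N)" .
      qed
      also have "\<dots> = ennreal a * ennreal g + ennreal b * E' k"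
        unfolding E'_def G[symmetric] by (simp add: nn_integral_add nn_integral_cmult)
      finally show ?thesis by (simp add: add_right_mono mult_left_mono)
    qed
    moreover have "(\<lambda>k. ennreal a * (ennreal a * ennreal g + ennreal b * E' k) + (ennreal b * of_nat m) * E k)
        \<longlonglongrightarrow> ennreal a * (ennreal a * ennreal g + ennreal b * 0) + (ennreal b * of_nat m) * 0"
      using lim1 lim2 unfolding E_def E'_def
      by (intro tendsto_add ennreal_tendsto_cmult tendsto_const) (auto simp: ennreal_mult_less_top of_nat_less_top)
    ultimately have "(\<integral>\<^sup>+x. ennreal (\<bar>u x\<bar> ^ N) * min (W x) (of_nat m) \<partial>?M) \<le> ennreal a * (ennreal a * ennreal g + ennreal b * 0) + (ennreal b * of_nat m) * 0"
      using LIMSEQ_le_const by blast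
    also have "\<dots> = ennreal (a\<^sup>2 * g)"
      using ab g0 by (simp add: ennreal_mult power2_eq_square mult.assoc)
    finally show ?thesis unfolding a_def .
  qed
  have trunc: "(\<integral>\<^sup>+x. ennreal (\<bar>u x\<bar> ^ N) * min (W x) (of_nat m) \<partial>?M) \<le> ennreal g" for m :: nat
  proof -
    have "((\<lambda>l. ennreal ((l * (1 / l) ^ N)\<^sup>2 * g)) \<longlongrightarrow> ennreal ((1 * (1 / 1) ^ N)\<^sup>2 * g)) (at_left 1)"
      by (intro tendsto_intros tendsto_ennrealI) auto
    moreover have "\<forall>\<^sub>F l in at_left 1. (\<integral>\<^sup>+x. ennreal (\<bar>u x\<bar> ^ N) * min (W x) (of_nat m) \<partial>?M) \<le> ennreal ((l * (1 / l) ^ N)\<^sup>2 * g)"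
      using eventually_at_left_real[OF zero_less_one] by (rule eventually_mono) (auto intro: step)
    ultimately show ?thesis
      using tendsto_lowerbound[of _ _ "at_left (1::real)"] by (simp add: trivial_limit_at_left_real)
  qed
  have "(\<integral>\<^sup>+x. ennreal (\<bar>u x\<bar> ^ N) * W x \<partial>?M) = (\<integral>\<^sup>+x. (SUP m. ennreal (\<bar>u x\<bar> ^ N) * min (W x) (of_nat m)) \<partial>?M)"
  proof (rule nn_integral_cong)
    fix x
    have "(SUP m::nat. min (W x) (of_nat m)) = W x"
      using inf_SUP[of "W x" "\<lambda>m::nat. of_nat m" UNIV] by (simp add: inf_min ennreal_SUP_of_nat_eq_top)
    then show "ennreal (\<bar>u x\<bar> ^ N) * W x = (SUP m. ennreal (\<bar>u x\<bar> ^ N) * min (W x) (of_nat m))"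
      by (simp add: SUP_mult_left_ennreal[symmetric])
  qed
  also have "\<dots> = (SUP m. \<integral>\<^sup>+x. ennreal (\<bar>u x\<bar> ^ N) * min (W x) (of_nat m) \<partial>?M)"
  proof (rule nn_integral_monotone_convergence_SUP)
    show "incseq (\<lambda>m x. ennreal (\<bar>u x\<bar> ^ N) * min (W x) (of_nat m))"
      by (auto simp: incseq_def le_fun_def intro!: mult_left_mono min.mono)
  qed measurable
  also have "\<dots> \<le> ennreal g" by (rule SUP_least) (rule trunc)
  finally show ?thesis using G by (simp add: N_def)
qed

section \<open>The lower bound is strict\<close>

definition hardy_weight :: "real \<Rightarrow> real^'n \<Rightarrow> real" where
  "hardy_weight R x = 1 / (norm x ^ CARD('n) * ln (R / norm x) ^ CARD('n))"

lemma ln_ratio_pos: "x \<noteq> 0 \<Longrightarrow> norm x < R \<Longrightarrow> 0 < ln (R / norm x)"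
  by (rule ln_gt_zero) (simp add: less_divide_eq)

lemma hardy_weight_pos: "x \<noteq> 0 \<Longrightarrow> norm x < R \<Longrightarrow> 0 < hardy_weight R x"
  using ln_ratio_pos[of x R] by (simp add: hardy_weight_def)

lemma borel_measurable_hardy_weight [measurable]: "hardy_weight R \<in> borel_measurable borel"
  unfolding hardy_weight_def[abs_def] by measurable

lemma AE_lebesgue_on_nonzero:
  assumes "S \<in> sets lebesgue"
  shows "AE x in lebesgue_on S. x \<in> S \<and> x \<noteq> (0::'a::euclidean_space)"
proof -
  have "AE x in lebesgue. x \<noteq> (0::'a)"
    by (rule AE_completion) (rule AE_lborel_singleton)
  then show ?thesis using assms by (subst AE_restrict_space_iff) auto
qed

text \<open>A function is null as soon as it is null against one weight that is positive off the origin; it is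
  applied to the Hardy weight and to the weight of the remainder.\<close>

lemma AE_zero_of_weighted_integral:
  fixes u w :: "real^'n \<Rightarrow> real"
  assumes S: "S \<in> sets lebesgue" and u: "u \<in> borel_measurable (lebesgue_on S)" and w: "w \<in> borel_measurable borel"
    and pos: "\<And>x. x \<in> S \<Longrightarrow> x \<noteq> 0 \<Longrightarrow> w x > 0"
    and int: "(\<integral>\<^sup>+x. ennreal (\<bar>u x\<bar> ^ Suc n * w x) \<partial>lebesgue_on S) = 0"
  shows "AE x in lebesgue_on S. u x = 0"
proof -
  have [measurable]: "u \<in> borel_measurable (lebesgue_on S)" "w \<in> borel_measurable (lebesgue_on S)"
    using u borel_measurable_lebesgue_on[OF w] by auto
  have "AE x in lebesgue_on S. ennreal (\<bar>u x\<bar> ^ Suc n * w x) = 0"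
    using int by (subst (asm) nn_integral_0_iff_AE) auto
  with AE_lebesgue_on_nonzero[OF S] show ?thesis
  proof eventually_elim
    case (elim x)
    then have "\<bar>u x\<bar> ^ Suc n * w x \<le> 0" "w x > 0" using pos[of x] by (auto simp: ennreal_eq_0_iff)
    then have "\<bar>u x\<bar> ^ Suc n \<le> 0" by (simp add: mult_le_0_iff del: power_Suc)
    then show ?case by (metis abs_ge_zero abs_eq_0 antisym power_eq_0_iff zero_le_power)
  qed
qed

text \<open>The loss \<open>\<beta> * s\<^sup>2\<close> is kept on the right so that all integrals stay in \<open>[0,\<infinity>]\<close>.\<close>

lemma (in hardy_radial) hardy_with_remainder:
  fixes u :: "real^'n \<Rightarrow> real" and \<Omega> :: "(real^'n) set"
  assumes card: "CARD('n) = Suc n" and \<Omega>: "open \<Omega>" "\<Omega> \<subseteq> ball 0 R" and u: "u \<in> sobolev_0 (Suc n) \<Omega>"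
  defines "A \<equiv> \<integral>\<^sup>+x. ennreal (\<bar>u x\<bar> ^ Suc n * hardy_weight R x) \<partial>lebesgue_on \<Omega>"
  shows "ennreal (crit ^ Suc n) * A
      + ennreal (2 * real n * crit ^ (n - 1) * s)
        * (\<integral>\<^sup>+x. ennreal (\<bar>u x\<bar> ^ Suc n * (hardy_weight R x * ((norm x)\<^sup>2 * ln (R / norm x)))) \<partial>lebesgue_on \<Omega>)
     \<le> (\<integral>\<^sup>+x. ennreal (norm (weak_grad \<Omega> u x) ^ Suc n) \<partial>lebesgue_on \<Omega>) + ennreal (real n * real (Suc n) * R ^ 4 * s\<^sup>2) * A"
    (is "ennreal ?c * A + ennreal ?\<alpha> * ?A' \<le> ?G + ennreal ?\<beta> * A")
proof -
  let ?M = "lebesgue_on \<Omega>"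
  have S: "\<Omega> \<in> sets lebesgue" using \<Omega>(1) by simp
  define P where "P x = potential (x \<bullet> x) (x \<bullet> x)" for x :: "real^'n"
  have Pb: "P \<in> borel_measurable borel"
    unfolding P_def[abs_def] potential_def field_def log_deriv_field_def slope_def amp_def log_radius_def by measurable
  have P0: "0 \<le> P x" if "x \<in> \<Omega>" "x \<noteq> 0" for x
  proof -
    have "norm x < R" using that \<Omega> by auto
    then have "x \<bullet> x < R\<^sup>2" by (auto simp: power2_norm_eq_inner[symmetric] intro!: power_strict_mono)
    then show ?thesis unfolding P_def using potential_nonneg[of "x \<bullet> x" 0] that amp_less_1 R0 by auto
  qed
  have um: "u \<in> borel_measurable ?M" using u by (auto simp: sobolev_0_def sobolev_def L_space_def)
  note [measurable] = um borel_measurable_lebesgue_on[OF Pb]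
    borel_measurable_lebesgue_on[OF borel_measurable_hardy_weight]
  define T where "T x = (norm x)\<^sup>2 * ln (R / norm x)" for x :: "real^'n"
  have Tb: "T \<in> borel_measurable borel" unfolding T_def[abs_def] by measurable
  note [measurable] = borel_measurable_lebesgue_on[OF Tb]
  have main: "(\<integral>\<^sup>+x. ennreal (\<bar>u x\<bar> ^ Suc n) * ennreal (P x) \<partial>?M) \<le> ?G"
  proof (rule sobolev_0_inequality[OF u \<Omega>(1)])
    show "(\<lambda>x. ennreal (P x)) \<in> borel_measurable borel" using Pb by measurable
    fix \<phi> :: "real^'n \<Rightarrow> real" assume t: "\<phi> \<in> test_functions \<Omega>"
    note t = test_functionD[OF t]
    have out: "\<phi> x = 0 \<and> grad \<phi> x = 0" if "x \<notin> \<Omega>" for x using t(5,6,7) that by blast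
    have "(\<integral>\<^sup>+x. ennreal (\<bar>\<phi> x\<bar> ^ Suc n) * ennreal (P x) \<partial>?M) = (\<integral>\<^sup>+x. ennreal (\<bar>\<phi> x\<bar> ^ Suc n * potential (x \<bullet> x) (x \<bullet> x)) \<partial>?M)"
      by (simp add: P_def ennreal_mult' del: power_Suc)
    also have "\<dots> = (\<integral>\<^sup>+x. ennreal (\<bar>\<phi> x\<bar> ^ Suc n * potential (x \<bullet> x) (x \<bullet> x)) \<partial>lborel)"
      by (rule nn_integral_lebesgue_on_support[OF S]) (simp add: out)
    also have "\<dots> \<le> (\<integral>\<^sup>+x. ennreal (norm (grad \<phi> x) ^ Suc n) \<partial>lborel)"
    proof (rule hardy_test_function[OF _ t(1) t(3) t(4) t(6)])
      show "DIM(real^'n) = Suc n" using card by simp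
      show "closure {x. \<phi> x \<noteq> 0} \<subseteq> ball 0 R" using t(5) \<Omega>(2) by blast
    qed
    also have "\<dots> = (\<integral>\<^sup>+x. ennreal (norm (grad \<phi> x) ^ Suc n) \<partial>?M)"
      by (rule nn_integral_lebesgue_on_support[OF S, symmetric]) (simp add: out)
    finally show "(\<integral>\<^sup>+x. ennreal (\<bar>\<phi> x\<bar> ^ Suc n) * ennreal (P x) \<partial>?M) \<le> (\<integral>\<^sup>+x. ennreal (norm (grad \<phi> x) ^ Suc n) \<partial>?M)" .
  qed
  have c: "?c \<ge> 0" "?\<alpha> \<ge> 0" "?\<beta> \<ge> 0" using crit s0 R0 by auto
  have "ennreal ?c * A + ennreal ?\<alpha> * ?A' =
      (\<integral>\<^sup>+x. ennreal ?c * ennreal (\<bar>u x\<bar> ^ Suc n * hardy_weight R x)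
        + ennreal ?\<alpha> * ennreal (\<bar>u x\<bar> ^ Suc n * (hardy_weight R x * T x)) \<partial>?M)"
    unfolding A_def T_def[symmetric] by (simp add: nn_integral_add nn_integral_cmult del: power_Suc)
  also have "\<dots> \<le> (\<integral>\<^sup>+x. ennreal (\<bar>u x\<bar> ^ Suc n) * ennreal (P x) + ennreal ?\<beta> * ennreal (\<bar>u x\<bar> ^ Suc n * hardy_weight R x) \<partial>?M)"
  proof (rule nn_integral_mono_AE)
    show "AE x in ?M. ennreal ?c * ennreal (\<bar>u x\<bar> ^ Suc n * hardy_weight R x)
        + ennreal ?\<alpha> * ennreal (\<bar>u x\<bar> ^ Suc n * (hardy_weight R x * T x))
       \<le> ennreal (\<bar>u x\<bar> ^ Suc n) * ennreal (P x) + ennreal ?\<beta> * ennreal (\<bar>u x\<bar> ^ Suc n * hardy_weight R x)"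
      using AE_lebesgue_on_nonzero[OF S]
    proof eventually_elim
      case (elim x)
      define r where "r = norm x"
      define t where "t = ln (R / r)"
      have r: "0 < r" "r < R" using elim \<Omega> by (auto simp: r_def)
      have t: "t > 0" using r by (simp add: t_def)
      define w where "w = hardy_weight R x"
      have w: "w * (r * t) ^ Suc n = 1" "w > 0"
        using r t by (auto simp: w_def hardy_weight_def card r_def[symmetric] t_def[symmetric] power_mult_distrib simp del: power_Suc)
      define U where "U = \<bar>u x\<bar> ^ Suc n"
      have U: "U \<ge> 0" by (simp add: U_def)
      have Px: "P x = potential (r\<^sup>2) (r\<^sup>2)" by (simp add: P_def r_def power2_norm_eq_inner)
      have T: "T x = r\<^sup>2 * t" "T x \<ge> 0" using t by (auto simp: T_def r_def t_def)
      have p0: "P x \<ge> 0" using P0 elim by auto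
      have "?c + 2 * real n * crit ^ (n - 1) * s * r\<^sup>2 * t \<le> (r * t) ^ Suc n * P x + ?\<beta>"
        using potential_lower[OF r] unfolding t_def Px .
      then have "(U * w) * (?c + ?\<alpha> * T x) \<le> (U * w) * ((r * t) ^ Suc n * P x + ?\<beta>)"
        using U w T by (intro mult_left_mono) (auto simp: mult.assoc)
      also have "\<dots> = U * (w * (r * t) ^ Suc n) * P x + ?\<beta> * (U * w)"
        by (simp add: algebra_simps del: power_Suc)
      finally have "?c * (U * w) + ?\<alpha> * (U * (w * T x)) \<le> U * P x + ?\<beta> * (U * w)"
        unfolding w(1) by (simp add: algebra_simps del: power_Suc)
      then have "ennreal (?c * (U * w) + ?\<alpha> * (U * (w * T x))) \<le> ennreal (U * P x + ?\<beta> * (U * w))"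
        by (rule ennreal_leI)
      moreover have "ennreal (?c * (U * w) + ?\<alpha> * (U * (w * T x))) = ennreal ?c * ennreal (U * w) + ennreal ?\<alpha> * ennreal (U * (w * T x))"
        using c U w T by (simp add: ennreal_plus ennreal_mult del: power_Suc)
      moreover have "ennreal (U * P x + ?\<beta> * (U * w)) = ennreal U * ennreal (P x) + ennreal ?\<beta> * ennreal (U * w)"
        using c U w p0 by (simp add: ennreal_plus ennreal_mult del: power_Suc)
      ultimately show ?case unfolding U_def w_def by simp
    qed
  qed
  also have "\<dots> = (\<integral>\<^sup>+x. ennreal (\<bar>u x\<bar> ^ Suc n) * ennreal (P x) \<partial>?M) + ennreal ?\<beta> * A"
    unfolding A_def by (simp add: nn_integral_add nn_integral_cmult del: power_Suc)
  also have "\<dots> \<le> ?G + ennreal ?\<beta> * A" using main by (rule add_right_mono)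
  finally show ?thesis .
qed

text \<open>The supremum of the norm is not attained on an open set: every point can be pushed outwards.\<close>

lemma outer_radius_pos:
  fixes \<Omega> :: "(real^'n) set"
  assumes "open \<Omega>" "bounded \<Omega>" "0 \<in> \<Omega>"
  shows "0 < outer_radius \<Omega>" "\<Omega> \<subseteq> ball 0 (outer_radius \<Omega>)"
proof -
  have bdd: "bdd_above (norm ` \<Omega>)" using assms(2) by (auto simp: bounded_iff bdd_above_def)
  have less: "norm x < outer_radius \<Omega>" if "x \<in> \<Omega>" for x
  proof -
    obtain d where d: "d > 0" "cball x d \<subseteq> \<Omega>"
      using assms(1) \<open>x \<in> \<Omega>\<close> unfolding open_contains_cball by blast
    obtain y where y: "dist x y \<le> d" "norm x < norm y"
    proof (cases "x = 0")
      case True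
      show ?thesis by (rule that[of "d *\<^sub>R axis undefined 1"]) (use d True in \<open>auto simp: norm_axis_1\<close>)
    next
      case False
      define h where "h = d / norm x"
      have h: "h > 0" "h * norm x = d" using False d by (simp_all add: h_def)
      have "x - (1 + h) *\<^sub>R x = (- h) *\<^sub>R x" by (simp add: scaleR_left_distrib)
      then have "dist x ((1 + h) *\<^sub>R x) = h * norm x" using h(1) by (simp add: dist_norm)
      moreover have "norm ((1 + h) *\<^sub>R x) = norm x + h * norm x" using h(1) by (simp add: distrib_right)
      ultimately show ?thesis using h(2) d(1) by (intro that[of "(1 + h) *\<^sub>R x"]) linarith+
    qed
    have "y \<in> \<Omega>" using d(2) y(1) by auto
    then have "norm y \<le> outer_radius \<Omega>" unfolding outer_radius_def using bdd by (rule cSUP_upper)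
    then show ?thesis using y(2) by simp
  qed
  show "0 < outer_radius \<Omega>" using less[OF assms(3)] by simp
  show "\<Omega> \<subseteq> ball 0 (outer_radius \<Omega>)" using less by auto
qed

text \<open>For \<open>s = 0\<close> the inequality with remainder is Hardy's inequality; it also makes the denominator
  finite.  Under equality the terms of order zero in \<open>s\<close> cancel, and dividing by \<open>s\<close> and letting
  \<open>s\<close> tend to \<open>0\<close> leaves a weighted integral of \<open>\<bar>u\<bar> ^ N\<close> equal to zero.\<close>

lemma hardy_quotient_bound:
  fixes u :: "real^'n \<Rightarrow> real" and \<Omega> :: "(real^'n) set"
  assumes card: "CARD('n) \<ge> 2" and \<Omega>: "open \<Omega>" "bounded \<Omega>" "0 \<in> \<Omega>" and u: "u \<in> hardy_admissible \<Omega>"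
  shows "ennreal (((real CARD('n) - 1) / real CARD('n)) ^ CARD('n)) < hardy_quotient \<Omega> u"
proof -
  define R where "R = outer_radius \<Omega>"
  obtain n where n: "CARD('n) = Suc n" "n \<ge> 1" using card by (cases "CARD('n)") auto
  have R: "R > 0" "\<Omega> \<subseteq> ball 0 R" using outer_radius_pos[OF \<Omega>] by (auto simp: R_def)
  define c where "c = real n / real (Suc n)"
  have c: "c > 0" "c < 1" using n by (auto simp: c_def)
  let ?M = "lebesgue_on \<Omega>"
  have S: "\<Omega> \<in> sets lebesgue" using \<Omega>(1) by simp
  have u0: "u \<in> sobolev_0 (Suc n) \<Omega>" and un0: "\<not> (AE x in ?M. u x = 0)"
    using u by (auto simp: hardy_admissible_def n)
  have um: "u \<in> borel_measurable ?M" and gi: "integrable ?M (\<lambda>x. norm (weak_grad \<Omega> u x) ^ Suc n)"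
    using u0 by (auto simp: sobolev_0_def sobolev_def L_space_def)
  define A where "A = (\<integral>\<^sup>+x. ennreal (\<bar>u x\<bar> ^ Suc n * hardy_weight R x) \<partial>?M)"
  define T where "T x = hardy_weight R x * ((norm x)\<^sup>2 * ln (R / norm x))" for x :: "real^'n"
  define A' where "A' = (\<integral>\<^sup>+x. ennreal (\<bar>u x\<bar> ^ Suc n * T x) \<partial>?M)"
  define G where "G = (\<integral>\<^sup>+x. ennreal (norm (weak_grad \<Omega> u x) ^ Suc n) \<partial>?M)"
  define C where "C = c ^ Suc n"
  define \<alpha> where "\<alpha> = 2 * real n * c ^ (n - 1)"
  define \<beta> where "\<beta> = real n * real (Suc n) * R ^ 4"
  \<comment> \<open>The range of \<open>s\<close> in which \<open>c + s * R\<^sup>2\<close> stays below \<open>1\<close>.\<close>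
  define s1 where "s1 = (1 - c) / (2 * R\<^sup>2)"
  have s1: "s1 > 0" using c R by (simp add: s1_def)
  have pos: "C > 0" "\<alpha> > 0" "\<beta> > 0" using c n R by (auto simp: C_def \<alpha>_def \<beta>_def)
  have rem: "ennreal C * A + ennreal (\<alpha> * s) * A' \<le> G + ennreal (\<beta> * s\<^sup>2) * A" if s: "0 \<le> s" "s \<le> s1" for s
  proof -
    have "s * R\<^sup>2 \<le> s1 * R\<^sup>2" using s by (intro mult_right_mono) auto
    also have "\<dots> < 1 - c" using R c by (simp add: s1_def)
    finally have "hardy_radial n R s" using n R s by unfold_locales (auto simp: c_def)
    then interpret hardy_radial n R s .
    show ?thesis
      using hardy_with_remainder[OF n(1) \<Omega>(1) R(2) u0]
      unfolding A_def A'_def T_def G_def C_def \<alpha>_def \<beta>_def c_def crit_def .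
  qed
  have G: "G < \<infinity>" using gi by (simp add: G_def integrable_iff_bounded)
  have "A \<noteq> 0"
  proof
    assume "A = 0"
    then have "AE x in ?M. u x = 0"
      unfolding A_def using R(2)
      by (intro AE_zero_of_weighted_integral[OF S um borel_measurable_hardy_weight]) (auto intro!: hardy_weight_pos)
    with un0 show False by simp
  qed
  have low: "ennreal C * A \<le> G" using rem[of 0] s1 by simp
  then have "A < \<infinity>"
    using G pos by (cases "A = top") (auto simp: ennreal_mult_top less_top)
  have "ennreal C * A \<noteq> G"
  proof
    assume eq: "ennreal C * A = G"
    obtain a where a: "A = ennreal a" "a \<ge> 0" using \<open>A < \<infinity>\<close> by (cases A) auto
    have le: "ennreal (\<alpha> * s) * A' \<le> ennreal (\<beta> * s\<^sup>2 * a)" if s: "0 \<le> s" "s \<le> s1" for s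
      using rem[OF s] G a pos unfolding eq by (auto simp: ennreal_mult ennreal_add_left_cancel_le)
    have "A' = 0"
    proof -
      have "ennreal (\<alpha> * s1) * A' < \<infinity>" using le[of s1] s1 by (simp add: le_less_trans)
      then have "A' < \<infinity>" using pos s1 by (auto simp: ennreal_mult_less_top ennreal_eq_0_iff mult_le_0_iff)
      then obtain a' where a': "A' = ennreal a'" "a' \<ge> 0" by (cases A') auto
      have "\<alpha> * a' \<le> \<beta> * a * s" if s: "0 < s" "s \<le> s1" for s
      proof -
        have "ennreal ((\<alpha> * s) * a') \<le> ennreal (\<beta> * s\<^sup>2 * a)"
          using le[of s] s a' pos by (simp add: ennreal_mult)
        then have "(\<alpha> * s) * a' \<le> \<beta> * s\<^sup>2 * a" using a pos by (subst (asm) ennreal_le_iff) auto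
        then have "s * (\<alpha> * a') \<le> s * (\<beta> * a * s)" by (simp add: power2_eq_square mult_ac)
        then show ?thesis using s by simp
      qed
      then have ev: "\<forall>\<^sub>F s in at_right 0. \<alpha> * a' \<le> \<beta> * a * s"
        using s1 by (auto simp: eventually_at_right intro!: exI[of _ s1])
      have "((\<lambda>s. \<beta> * a * s) \<longlongrightarrow> \<beta> * a * 0) (at_right 0)" by (intro tendsto_intros)
      from tendsto_lowerbound[OF this ev] have "\<alpha> * a' \<le> 0" by simp
      then have "a' = 0" using pos a' by (auto simp: mult_le_0_iff)
      then show ?thesis using a' by simp
    qed
    have Tb: "T \<in> borel_measurable borel" unfolding T_def[abs_def] by measurable
    have "T x > 0" if "x \<in> \<Omega>" "x \<noteq> 0" for x
    proof -
      have "norm x < R" using R that by auto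
      then show ?thesis using that hardy_weight_pos[of x R] ln_ratio_pos[of x R] by (simp add: T_def)
    qed
    then have "AE x in ?M. u x = 0"
      using \<open>A' = 0\<close> unfolding A'_def
      by (intro AE_zero_of_weighted_integral[OF S um Tb]) auto
    with un0 show False by simp
  qed
  with low have "ennreal C * A < G" by simp
  moreover obtain a where a: "A = ennreal a" "a \<ge> 0" using \<open>A < \<infinity>\<close> by (cases A) auto
  moreover obtain g where g: "G = ennreal g" "g \<ge> 0" using G by (cases G) auto
  ultimately have "ennreal (C * a) < ennreal g" using pos by (simp add: ennreal_mult)
  then have "C * a < g" using pos a g by (subst (asm) ennreal_less_iff) auto
  moreover have "a > 0" using \<open>A \<noteq> 0\<close> a by (cases "a = 0") auto
  ultimately have "C < g / a" by (simp add: pos_less_divide_eq)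
  then have "ennreal C < G / A"
    using a g \<open>a > 0\<close> pos by (simp add: divide_ennreal ennreal_less_iff)
  moreover have "(real CARD('n) - 1) / real CARD('n) = c" by (simp add: c_def n)
  moreover have "hardy_quotient \<Omega> u = G / A"
    unfolding hardy_quotient_def G_def A_def R_def hardy_weight_def n by simp
  ultimately show ?thesis unfolding C_def n by simp
qed

section \<open>Calculus of smooth functions\<close>

text \<open>Like \<open>C_k\<close> but for functions of one variable and local to \<open>U\<close>, so that smooth profiles can be
  composed from functions with natural domains before they are extended by zero.\<close>

primrec diff_upto :: "nat \<Rightarrow> real set \<Rightarrow> (real \<Rightarrow> real) \<Rightarrow> bool" where
  "diff_upto 0 U f \<longleftrightarrow> continuous_on U f"
| "diff_upto (Suc n) U f \<longleftrightarrow> (\<exists>f'. (\<forall>x\<in>U. (f has_real_derivative f' x) (at x)) \<and> diff_upto n U f')"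

lemma diff_upto_SucI:
  "(\<And>x. x \<in> U \<Longrightarrow> (f has_real_derivative f' x) (at x)) \<Longrightarrow> diff_upto n U f' \<Longrightarrow> diff_upto (Suc n) U f"
  by auto

lemma diff_upto_Suc_imp: "diff_upto (Suc n) U f \<Longrightarrow> diff_upto n U f"
proof (induction n arbitrary: f)
  case 0
  then obtain f' where "\<forall>x\<in>U. (f has_real_derivative f' x) (at x)" by auto
  then have "\<forall>x\<in>U. isCont f x" using DERIV_isCont by blast
  then show ?case by (simp add: continuous_at_imp_continuous_on)
next
  case (Suc n)
  then obtain f' where "\<forall>x\<in>U. (f has_real_derivative f' x) (at x)" "diff_upto (Suc n) U f'"
    by (auto simp only: diff_upto.simps)
  then show ?case using Suc.IH[of f'] by (intro diff_upto_SucI[of U f f']) auto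
qed

lemma diff_upto_cong:
  assumes "open U" "\<And>x. x \<in> U \<Longrightarrow> f x = g x" "diff_upto n U f"
  shows "diff_upto n U g"
proof (cases n)
  case 0
  then show ?thesis using assms by (metis continuous_on_cong diff_upto.simps(1))
next
  case (Suc m)
  then obtain f' where f': "\<forall>x\<in>U. (f has_real_derivative f' x) (at x)" "diff_upto m U f'"
    using assms(3) by auto
  have "(g has_real_derivative f' x) (at x)" if "x \<in> U" for x
    by (rule has_field_derivative_transform_within_open[of f _ _ U]) (use assms f' that in auto)
  with f' Suc show ?thesis by auto
qed

lemma diff_upto_subset: "diff_upto n U f \<Longrightarrow> V \<subseteq> U \<Longrightarrow> diff_upto n V f"
  by (induction n arbitrary: f) (auto intro: continuous_on_subset)

lemma diff_upto_const: "diff_upto n U (\<lambda>_. c)"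
proof (induction n arbitrary: c)
  case (Suc n)
  show ?case by (rule diff_upto_SucI[OF DERIV_const Suc])
qed simp

lemma diff_upto_id: "diff_upto n U (\<lambda>x. x)"
proof (cases n)
  case (Suc m)
  show ?thesis unfolding Suc by (rule diff_upto_SucI[OF DERIV_ident diff_upto_const])
qed simp

lemma diff_upto_add: "diff_upto n U f \<Longrightarrow> diff_upto n U g \<Longrightarrow> diff_upto n U (\<lambda>x. f x + g x)"
proof (induction n arbitrary: f g)
  case (Suc n)
  then obtain f' g' where "\<forall>x\<in>U. (f has_real_derivative f' x) (at x)" "diff_upto n U f'"
    "\<forall>x\<in>U. (g has_real_derivative g' x) (at x)" "diff_upto n U g'" by auto
  then show ?case
    by (intro diff_upto_SucI[of U _ "\<lambda>x. f' x + g' x"] DERIV_add Suc.IH) simp_all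
qed (auto intro: continuous_on_add)

lemma diff_upto_mult: "diff_upto n U f \<Longrightarrow> diff_upto n U g \<Longrightarrow> diff_upto n U (\<lambda>x. f x * g x)"
proof (induction n arbitrary: f g)
  case (Suc n)
  then obtain f' g' where *: "\<forall>x\<in>U. (f has_real_derivative f' x) (at x)" "diff_upto n U f'"
    "\<forall>x\<in>U. (g has_real_derivative g' x) (at x)" "diff_upto n U g'" by auto
  have "diff_upto n U (\<lambda>x. f' x * g x + g' x * f x)"
    using * Suc.prems[THEN diff_upto_Suc_imp] by (intro diff_upto_add Suc.IH) auto
  with * show ?case
    by (intro diff_upto_SucI[of U _ "\<lambda>x. f' x * g x + g' x * f x"] DERIV_mult) simp_all
qed (auto intro: continuous_on_mult)

lemma diff_upto_compose:
  "diff_upto n V f \<Longrightarrow> diff_upto n U g \<Longrightarrow> g ` U \<subseteq> V \<Longrightarrow> diff_upto n U (\<lambda>x. f (g x))"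
proof (induction n arbitrary: f)
  case 0
  then show ?case using continuous_on_compose2[of V f U g] by simp
next
  case (Suc n)
  then obtain f' g' where *: "\<forall>x\<in>V. (f has_real_derivative f' x) (at x)" "diff_upto n V f'"
    "\<forall>x\<in>U. (g has_real_derivative g' x) (at x)" "diff_upto n U g'" by auto
  have "diff_upto n U (\<lambda>x. f' (g x) * g' x)"
    by (rule diff_upto_mult[OF Suc.IH[OF *(2) diff_upto_Suc_imp[OF Suc.prems(2)] Suc.prems(3)] *(4)])
  moreover have "((\<lambda>x. f (g x)) has_real_derivative f' (g x) * g' x) (at x)" if "x \<in> U" for x
    by (rule DERIV_chain2) (use * that Suc.prems(3) in auto)
  ultimately show ?case by (rule diff_upto_SucI[rotated])
qed

text \<open>Off \<open>K\<close> the function is locally constant, so its derivative also vanishes there and the induction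
  hypothesis applies to the derivative extended by zero.\<close>

lemma diff_upto_zero_extension:
  assumes U: "open U" and K: "closed K" "K \<subseteq> U"
  shows "diff_upto n U f \<Longrightarrow> (\<And>x. x \<notin> K \<Longrightarrow> f x = 0) \<Longrightarrow> diff_upto n UNIV f"
proof (induction n arbitrary: f)
  case 0
  have "continuous_on (- K) f"
    using 0(2) by (subst continuous_on_cong[where g = "\<lambda>_. 0"]) auto
  then have "continuous_on (U \<union> - K) f" using 0 U K by (intro continuous_on_open_Un) auto
  moreover have "U \<union> - K = UNIV" using K by auto
  ultimately show ?case by simp
next
  case (Suc n)
  then obtain f' where f': "\<forall>x\<in>U. (f has_real_derivative f' x) (at x)" "diff_upto n U f'" by auto
  define h where "h x = (if x \<in> K then f' x else 0)" for x
  have off: "(f has_real_derivative 0) (at x)" if "x \<notin> K" for x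
    by (rule has_field_derivative_transform_within_open[of "\<lambda>_. 0" _ _ "- K"]) (use that K Suc.prems(2) in auto)
  have h: "(f has_real_derivative h x) (at x)" for x
    using off f'(1) K by (cases "x \<in> K") (auto simp: h_def)
  have "f' x = h x" if "x \<in> U" for x
    using DERIV_unique h f'(1) that by blast
  then have "diff_upto n U h" using diff_upto_cong[OF U _ f'(2)] by blast
  then have "diff_upto n UNIV h" by (rule Suc.IH) (simp add: h_def)
  with h show ?case by auto
qed

lemma diff_upto_exp: "diff_upto n UNIV exp"
proof (induction n)
  case (Suc n)
  then show ?case by (rule diff_upto_SucI[OF DERIV_exp])
qed (simp add: continuous_on_exp continuous_on_id)

lemma diff_upto_inverse: "diff_upto n {0<..} (inverse :: real \<Rightarrow> real)"
proof (induction n)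
  case (Suc n)
  have "diff_upto n {0<..} (\<lambda>x::real. (-1) * (inverse x * inverse x))"
    by (intro diff_upto_mult diff_upto_const Suc)
  moreover have "(inverse has_real_derivative (-1) * (inverse x * inverse x)) (at x)" if "x \<in> {0<..}" for x :: real
    using that DERIV_inverse[of x UNIV] by (simp add: power2_eq_square)
  ultimately show ?case by (intro diff_upto_SucI)
qed (auto intro!: continuous_intros)

lemma diff_upto_ln: "diff_upto n {0<..} (ln :: real \<Rightarrow> real)"
proof (cases n)
  case (Suc m)
  have "(ln has_real_derivative inverse x) (at x)" if "x \<in> {0<..}" for x :: real
    using that DERIV_ln[of x] by simp
  then show ?thesis unfolding Suc using diff_upto_inverse by (rule diff_upto_SucI)
qed (auto intro!: continuous_intros)

text \<open>The functions \<open>x\<close> to the power \<open>-k\<close> times \<open>exp (- 1 / x)\<close> form a family whose linear span is closed under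
  differentiation; hence each is smooth on the whole line.\<close>

definition flat_exp :: "nat \<Rightarrow> real \<Rightarrow> real" where
  "flat_exp k x = (if x > 0 then (1 / x) ^ k * exp (- (1 / x)) else 0)"

lemma flat_exp_tendsto_0: "(flat_exp k \<longlongrightarrow> 0) (at 0)"
proof (rule filterlim_split_at)
  show "(flat_exp k \<longlongrightarrow> 0) (at_left 0)"
    by (rule Lim_transform_eventually[OF tendsto_const])
      (auto simp: eventually_at_filter flat_exp_def)
  have "((\<lambda>x::real. inverse x ^ k / exp (inverse x)) \<longlongrightarrow> 0) (at_right 0)"
    by (rule filterlim_compose[OF tendsto_power_div_exp_0 filterlim_inverse_at_top_right])
  moreover have "\<forall>\<^sub>F x in at_right 0. inverse x ^ k / exp (inverse x) = flat_exp k x"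
    by (auto simp: eventually_at_filter flat_exp_def exp_minus divide_simps)
  ultimately show "(flat_exp k \<longlongrightarrow> 0) (at_right 0)"
    by (rule Lim_transform_eventually)
qed

lemma DERIV_flat_exp:
  "(flat_exp k has_real_derivative flat_exp (k + 2) x + (- real k) * flat_exp (k + 1) x) (at x)"
proof -
  consider "x < 0" | "x = 0" | "x > 0" by linarith
  then show ?thesis
  proof cases
    case 1
    have "((\<lambda>_. 0) has_real_derivative flat_exp (k + 2) x + (- real k) * flat_exp (k + 1) x) (at x)"
      using 1 by (simp add: flat_exp_def)
    then show ?thesis
      by (rule has_field_derivative_transform_within_open[of _ _ _ "{..<0}"]) (use 1 in \<open>auto simp: flat_exp_def\<close>)
  next
    case 2
    have "\<forall>\<^sub>F h in at 0. flat_exp (k + 1) h = (flat_exp k (0 + h) - flat_exp k 0) / h"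
      by (auto simp: eventually_at_filter flat_exp_def)
    then have "((\<lambda>h. (flat_exp k (0 + h) - flat_exp k 0) / h) \<longlongrightarrow> 0) (at 0)"
      by (rule Lim_transform_eventually[OF flat_exp_tendsto_0])
    then show ?thesis using 2 by (simp add: DERIV_def flat_exp_def)
  next
    case 3
    have d: "((\<lambda>x. 1 / x) has_real_derivative - ((1 / x) * (1 / x))) (at x)"
      using 3 by (auto intro!: derivative_eq_intros simp: power2_eq_square)
    define y where "y = 1 / x"
    have "((\<lambda>x. (1 / x) ^ k * exp (- (1 / x))) has_real_derivative
        (real k * (- (y * y) * y ^ (k - Suc 0))) * exp (- y) + exp (- y) * (y * y) * y ^ k) (at x)"
      unfolding y_def
      by (rule DERIV_cong[OF DERIV_mult[OF DERIV_power[OF d, of k] DERIV_fun_exp[OF DERIV_minus[OF d]]]]) simp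
    moreover have "(real k * (- (y * y) * y ^ (k - Suc 0))) * exp (- y) + exp (- y) * (y * y) * y ^ k
       = flat_exp (k + 2) x + (- real k) * flat_exp (k + 1) x"
    proof -
      have "flat_exp j x = y ^ j * exp (- y)" for j using 3 by (simp add: flat_exp_def y_def)
      then show ?thesis by (cases k) (simp_all add: algebra_simps)
    qed
    ultimately have "((\<lambda>x. (1 / x) ^ k * exp (- (1 / x))) has_real_derivative flat_exp (k + 2) x + (- real k) * flat_exp (k + 1) x) (at x)"
      by simp
    then show ?thesis
      by (rule has_field_derivative_transform_within_open[of _ _ _ "{0<..}"]) (use 3 in \<open>auto simp: flat_exp_def\<close>)
  qed
qed

lemma diff_upto_flat_exp: "diff_upto n UNIV (flat_exp k)"
proof (induction n arbitrary: k)
  case 0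
  show ?case using DERIV_isCont[OF DERIV_flat_exp] by (simp add: continuous_at_imp_continuous_on)
next
  case (Suc n)
  have "diff_upto n UNIV (\<lambda>x. flat_exp (k + 2) x + (- real k) * flat_exp (k + 1) x)"
    by (intro diff_upto_add diff_upto_mult diff_upto_const Suc)
  then show ?case by (rule diff_upto_SucI[OF DERIV_flat_exp])
qed

lemma flat_exp_0: "flat_exp 0 x = (if x > 0 then exp (- (1 / x)) else 0)"
  by (simp add: flat_exp_def)

lemma C_k_Suc_I:
  fixes f :: "real^'n \<Rightarrow> real"
  assumes "\<And>x. (f has_derivative (\<lambda>h. g x \<bullet> h)) (at x)" "\<And>i. C_k k (\<lambda>x. g x $ i)"
  shows "C_k (Suc k) f"
proof -
  have "f differentiable_on UNIV"
    using assms(1) by (auto simp: differentiable_on_def differentiable_def)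
  moreover have "grad f = g" using grad_eqI[OF assms(1)] by blast
  ultimately show ?thesis using assms(2) by simp
qed

lemma C_k_Suc_E:
  fixes f :: "real^'n \<Rightarrow> real"
  assumes "C_k (Suc k) f"
  shows "(f has_derivative (\<lambda>h. grad f x \<bullet> h)) (at x)" "C_k k (\<lambda>x. grad f x $ i)"
  using assms by (auto simp: differentiable_on_def intro!: grad_has_derivative)

lemma C_k_Suc_imp: "C_k (Suc k) f \<Longrightarrow> C_k k f"
proof (induction k arbitrary: f)
  case 0
  then show ?case using differentiable_imp_continuous_on by auto
next
  case (Suc k)
  show ?case
    by (rule C_k_Suc_I[OF C_k_Suc_E(1)[OF Suc.prems]]) (rule Suc.IH[OF C_k_Suc_E(2)[OF Suc.prems]])
qed

lemma C_k_const: "C_k k (\<lambda>_. c)"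
proof (induction k arbitrary: c)
  case (Suc k)
  show ?case by (rule C_k_Suc_I[of _ "\<lambda>_. 0"]) (use Suc[of 0] in auto)
qed simp

lemma C_k_coord: "C_k k (\<lambda>x. x $ i)"
proof (cases k)
  case (Suc m)
  show ?thesis unfolding Suc
  proof (rule C_k_Suc_I[of _ "\<lambda>_. axis i 1"])
    show "((\<lambda>x. x $ i) has_derivative (\<bullet>) (axis i 1)) (at x)" for x
    proof -
      have "(\<bullet>) (axis i (1::real)) = (\<lambda>h. h $ i)" by (simp add: fun_eq_iff inner_axis')
      then show ?thesis
        using bounded_linear_imp_has_derivative[OF bounded_linear_vec_nth[of i]] by simp
    qed
  qed (rule C_k_const)
qed (auto intro!: continuous_intros)

lemma C_k_add: "C_k k f \<Longrightarrow> C_k k g \<Longrightarrow> C_k k (\<lambda>x. f x + g x)"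
proof (induction k arbitrary: f g)
  case (Suc k)
  note f = C_k_Suc_E[OF Suc.prems(1)] and g = C_k_Suc_E[OF Suc.prems(2)]
  show ?case
  proof (rule C_k_Suc_I)
    show "((\<lambda>x. f x + g x) has_derivative (\<lambda>h. (grad f x + grad g x) \<bullet> h)) (at x)" for x
      using has_derivative_add[OF f(1)[of x] g(1)[of x]] by (simp add: inner_add_left)
    show "C_k k (\<lambda>x. (grad f x + grad g x) $ i)" for i
      using Suc.IH[OF f(2)[of i] g(2)[of i]] by simp
  qed
qed (auto intro: continuous_on_add)

lemma C_k_mult: "C_k k f \<Longrightarrow> C_k k g \<Longrightarrow> C_k k (\<lambda>x. f x * g x)"
proof (induction k arbitrary: f g)
  case (Suc k)
  note f = C_k_Suc_E[OF Suc.prems(1)] and g = C_k_Suc_E[OF Suc.prems(2)]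
  show ?case
  proof (rule C_k_Suc_I)
    show "((\<lambda>x. f x * g x) has_derivative (\<lambda>h. (f x *\<^sub>R grad g x + g x *\<^sub>R grad f x) \<bullet> h)) (at x)" for x
      using has_derivative_mult[OF f(1)[of x] g(1)[of x]] by (simp add: inner_add_left mult.commute)
    show "C_k k (\<lambda>x. (f x *\<^sub>R grad g x + g x *\<^sub>R grad f x) $ i)" for i
      using C_k_add[OF Suc.IH[OF C_k_Suc_imp[OF Suc.prems(1)] g(2)[of i]] Suc.IH[OF C_k_Suc_imp[OF Suc.prems(2)] f(2)[of i]]]
      by simp
  qed
qed (auto intro: continuous_on_mult)

lemma C_k_sum: "(\<And>i. i \<in> I \<Longrightarrow> C_k k (f i)) \<Longrightarrow> C_k k (\<lambda>x. \<Sum>i\<in>I. f i x)"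
  by (induction I rule: infinite_finite_induct) (simp_all add: C_k_const C_k_add)

lemma C_k_prod: "(\<And>i. i \<in> I \<Longrightarrow> C_k k (f i)) \<Longrightarrow> C_k k (\<lambda>x. \<Prod>i\<in>I. f i x)"
  by (induction I rule: infinite_finite_induct) (simp_all add: C_k_const C_k_mult)

lemma C_k_compose: "diff_upto k UNIV h \<Longrightarrow> C_k k g \<Longrightarrow> C_k k (\<lambda>x. h (g x))"
proof (induction k arbitrary: h)
  case 0
  then show ?case using continuous_on_compose2[of UNIV h UNIV g] by simp
next
  case (Suc k)
  note g = C_k_Suc_E[OF Suc.prems(2)]
  obtain h' where h': "\<And>y. (h has_real_derivative h' y) (at y)" "diff_upto k UNIV h'"
    using Suc.prems(1) by auto
  show ?case
  proof (rule C_k_Suc_I)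
    show "((\<lambda>x. h (g x)) has_derivative (\<lambda>v. (h' (g x) *\<^sub>R grad g x) \<bullet> v)) (at x)" for x
      using DERIV_compose_FDERIV[where f = h and g = g, OF h'(1) g(1)[of x]] by (simp add: mult.commute)
    show "C_k k (\<lambda>x. (h' (g x) *\<^sub>R grad g x) $ i)" for i
      using C_k_mult[OF Suc.IH[OF h'(2) C_k_Suc_imp[OF Suc.prems(2)]] g(2)[of i]] by simp
  qed
qed

lemma test_functionI:
  fixes \<phi> :: "real^'n \<Rightarrow> real"
  assumes "\<And>k. C_k k \<phi>" "compact K" "K \<subseteq> \<Omega>" "\<And>x. x \<notin> K \<Longrightarrow> \<phi> x = 0"
  shows "\<phi> \<in> test_functions \<Omega>"
proof -
  have cl: "closure {x. \<phi> x \<noteq> 0} \<subseteq> K"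
    using assms(2,4) by (intro closure_minimal) (auto intro: compact_imp_closed)
  then have "compact (closure {x. \<phi> x \<noteq> 0})"
    using assms(2) compact_Int_closed[of K "closure {x. \<phi> x \<noteq> 0}"] by (simp add: Int_absorb1)
  with cl assms show ?thesis by (auto simp: test_functions_def)
qed

section \<open>Weak gradients of test functions\<close>

lemma sigma_finite_lebesgue: "sigma_finite_measure (lebesgue :: 'a::euclidean_space measure)"
proof (rule sigma_finite_measure.intro, intro exI conjI)
  let ?A = "range (\<lambda>i::nat. box (- (real i *\<^sub>R One)) (real i *\<^sub>R One) :: 'a set)"
  show "countable ?A" by simp
  show "?A \<subseteq> sets lebesgue" by auto
  show "\<Union> ?A = space lebesgue" using UN_box_eq_UNIV by simp
  show "\<forall>a\<in>?A. emeasure lebesgue a \<noteq> \<infinity>"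
    using emeasure_lborel_box_finite by (auto simp: less_top)
qed

text \<open>The open boxes form an intersection-stable generator of the Borel sets, so the integral vanishes over
  every Borel set, and up to a null set over every Lebesgue set.\<close>

lemma AE_zero_if_box_integrals_zero:
  fixes f :: "'a::euclidean_space \<Rightarrow> 'b::{banach, second_countable_topology}"
  assumes f: "integrable lebesgue f" and box: "\<And>a b. (LINT x:box a b|lebesgue. f x) = 0"
  shows "AE x in lebesgue. f x = 0"
proof (rule sigma_finite_measure.density_zero[OF sigma_finite_lebesgue f])
  have si: "set_integrable lebesgue A f" if "A \<in> sets lebesgue" for A
    unfolding set_integrable_def using that f by (rule integrable_mult_indicator)
  have all: "(LINT x:UNIV|lebesgue. f x) = 0"
  proof -
    let ?A = "\<lambda>i::nat. box (- (real i *\<^sub>R One)) (real i *\<^sub>R One) :: 'a set"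
    have "incseq ?A" by (auto simp: incseq_def mem_box intro: order_le_less_trans less_le_trans; fastforce)
    then have "(\<lambda>i. LINT x:?A i|lebesgue. f x) \<longlonglongrightarrow> (LINT x:(\<Union>i. ?A i)|lebesgue. f x)"
      by (intro set_integral_cont_up si) auto
    then show ?thesis unfolding box UN_box_eq_UNIV by (simp add: LIMSEQ_const_iff)
  qed
  have borel: "(LINT x:A|lebesgue. f x) = 0" if "A \<in> sets borel" for A
  proof -
    let ?E = "range (\<lambda>(a, b). box a b :: 'a set)"
    have sig: "sigma_sets UNIV ?E = sets borel" by (simp add: borel_eq_box)
    have "Int_stable ?E" by (auto simp: Int_stable_def box_Int_box)
    moreover have "?E \<subseteq> Pow UNIV" by simp
    moreover have "A \<in> sigma_sets UNIV ?E" using that sig by simp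
    ultimately show ?thesis
    proof (induction rule: sigma_sets_induct_disjoint)
      case (basic A)
      then show ?case using box by auto
    next
      case empty
      show ?case by (simp add: set_lebesgue_integral_def)
    next
      case (compl A)
      have A: "A \<in> sets lebesgue" using compl(1) unfolding sig by simp
      then have "(LINT x:A \<union> (UNIV - A)|lebesgue. f x) = (LINT x:A|lebesgue. f x) + (LINT x:UNIV - A|lebesgue. f x)"
        by (intro set_integral_Un si) (auto simp: Compl_in_sets_lebesgue Compl_eq_Diff_UNIV[symmetric])
      then show ?case using compl(2) all by simp
    next
      case (union A)
      have m: "A i \<in> sets lebesgue" for i using union(2) unfolding sig by auto
      have "(LINT x:(\<Union>i. A i)|lebesgue. f x) = (\<Sum>i. LINT x:A i|lebesgue. f x)"
      proof (rule lebesgue_integral_countable_add[OF m])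
        show "A i \<inter> A j = {}" if "i \<noteq> j" for i j using union(1) that by (auto simp: disjoint_family_on_def)
        show "set_integrable lebesgue (\<Union>i. A i) f" using m by (intro si) auto
      qed
      then show ?case using union(3) by simp
    qed
  qed
  show "(LINT x:A|lebesgue. f x) = 0" if A: "A \<in> sets lebesgue" for A
  proof -
    obtain S N N' where S: "A = S \<union> N" "N \<subseteq> N'" "N' \<in> null_sets lborel" "S \<in> sets lborel"
      by (rule sets_completionE[OF A])
    have N': "N' \<in> null_sets lebesgue" using S(3) by (rule null_sets_completionI)
    have "(LINT x:A|lebesgue. f x) = (LINT x:S|lebesgue. f x)"
      unfolding set_lebesgue_integral_def
    proof (rule integral_cong_AE)
      show "(\<lambda>x. indicat_real A x *\<^sub>R f x) \<in> borel_measurable lebesgue"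
        using si[OF A] unfolding set_integrable_def by (rule borel_measurable_integrable)
      have "S \<in> sets lebesgue" using S(4) by simp
      then show "(\<lambda>x. indicat_real S x *\<^sub>R f x) \<in> borel_measurable lebesgue"
        using si unfolding set_integrable_def by (intro borel_measurable_integrable) simp
      show "AE x in lebesgue. indicat_real A x *\<^sub>R f x = indicat_real S x *\<^sub>R f x"
        by (rule AE_I'[OF N']) (use S(1,2) in \<open>auto simp: indicator_def\<close>)
    qed
    then show ?thesis using borel S(4) by simp
  qed
qed

text \<open>Smooth functions with values in \<open>[0,1]\<close> that vanish off the open box and increase to its indicator.\<close>

definition box_bump :: "nat \<Rightarrow> real^'n \<Rightarrow> real^'n \<Rightarrow> real^'n \<Rightarrow> real" where
  "box_bump m a b x = (\<Prod>i\<in>UNIV. flat_exp 0 (real (Suc m) * (x $ i - a $ i)) * flat_exp 0 (real (Suc m) * (b $ i - x $ i)))"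

lemma flat_exp_bounds: "0 \<le> flat_exp 0 x" "flat_exp 0 x \<le> 1"
  by (auto simp: flat_exp_0)

lemma box_bump_bounds: "0 \<le> box_bump m a b x" "box_bump m a b x \<le> 1"
  unfolding box_bump_def
  by (auto intro!: prod_nonneg prod_le_1 mult_nonneg_nonneg mult_le_one flat_exp_bounds)

lemma box_bump_outside: "x \<notin> box a b \<Longrightarrow> box_bump m a b x = 0"
proof -
  assume "x \<notin> box a b"
  then obtain i where "x $ i - a $ i \<le> 0 \<or> b $ i - x $ i \<le> 0" by (auto simp: mem_box_cart not_less)
  moreover have "flat_exp 0 (real (Suc m) * t) = 0" if "t \<le> 0" for t
    using that by (simp add: flat_exp_0 zero_less_mult_iff)
  ultimately have "flat_exp 0 (real (Suc m) * (x $ i - a $ i)) * flat_exp 0 (real (Suc m) * (b $ i - x $ i)) = 0"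
    by (metis mult_eq_0_iff)
  then show ?thesis unfolding box_bump_def by (intro prod_zero bexI[of _ i]) auto
qed

lemma box_bump_tendsto: "(\<lambda>m. box_bump m a b x) \<longlonglongrightarrow> indicator (box a b) x"
proof (cases "x \<in> box a b")
  case True
  have f: "(\<lambda>m. flat_exp 0 (real (Suc m) * t)) \<longlonglongrightarrow> 1" if "t > 0" for t
  proof -
    have "(\<lambda>m. exp (- ((1 / t) * inverse (real (Suc m))))) \<longlonglongrightarrow> exp (- ((1 / t) * 0))"
      by (intro tendsto_intros LIMSEQ_inverse_real_of_nat)
    then have "(\<lambda>m. exp (- ((1 / t) * inverse (real (Suc m))))) \<longlonglongrightarrow> 1" by simp
    moreover have "exp (- ((1 / t) * inverse (real (Suc m)))) = flat_exp 0 (real (Suc m) * t)" for m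
      using that by (simp add: flat_exp_0 inverse_eq_divide mult.commute)
    ultimately show ?thesis by simp
  qed
  have "(\<lambda>m. box_bump m a b x) \<longlonglongrightarrow> (\<Prod>i\<in>(UNIV::'a set). 1 * 1)"
    unfolding box_bump_def using True by (intro tendsto_prod tendsto_mult f) (auto simp: mem_box_cart)
  then show ?thesis using True by simp
qed (simp add: box_bump_outside)

lemma box_bump_test_function:
  assumes "cbox a b \<subseteq> \<Omega>"
  shows "box_bump m a b \<in> test_functions \<Omega>"
proof (rule test_functionI[OF _ compact_cbox assms])
  have neg: "C_k k (\<lambda>x. c * (x $ i) + d)" for k c d and i :: 'a
    by (intro C_k_add C_k_mult C_k_const C_k_coord)
  have "C_k k (\<lambda>x. \<Prod>i\<in>UNIV. flat_exp 0 (real (Suc m) * (x $ i) + real (Suc m) * (- a $ i))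
      * flat_exp 0 ((- real (Suc m)) * (x $ i) + real (Suc m) * (b $ i)))" for k
    by (intro C_k_prod C_k_mult C_k_compose[OF diff_upto_flat_exp neg])
  moreover have "(\<lambda>x. \<Prod>i\<in>UNIV. flat_exp 0 (real (Suc m) * (x $ i) + real (Suc m) * (- a $ i))
      * flat_exp 0 ((- real (Suc m)) * (x $ i) + real (Suc m) * (b $ i))) = box_bump m a b"
    by (rule ext) (simp add: box_bump_def right_diff_distrib del: of_nat_Suc)
  ultimately show "C_k k (box_bump m a b)" for k by simp
  show "box_bump m a b x = 0" if "x \<notin> cbox a b" for x
    using that box_subset_cbox[of a b] by (intro box_bump_outside) auto
qed

lemma integral_lebesgue_on_support:
  fixes f :: "'a::euclidean_space \<Rightarrow> 'b::euclidean_space"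
  assumes "S \<in> sets lebesgue" "\<And>x. x \<notin> S \<Longrightarrow> f x = 0"
  shows "integral\<^sup>L (lebesgue_on S) f = integral\<^sup>L lebesgue f" "integrable (lebesgue_on S) f \<longleftrightarrow> integrable lebesgue f"
proof -
  have eq: "(\<lambda>x. if x \<in> S then f x else 0) = f" using assms(2) by auto
  show "integral\<^sup>L (lebesgue_on S) f = integral\<^sup>L lebesgue f"
    using Lebesgue_Measure.integral_restrict_UNIV[OF assms(1), of f] by (simp only: eq)
  show "integrable (lebesgue_on S) f \<longleftrightarrow> integrable lebesgue f"
    using Lebesgue_Measure.integrable_restrict_UNIV[OF assms(1), of f] by (simp only: eq)
qed

text \<open>Testing against the bumps of a box and passing to the limit shows that the difference of two weak
  gradients has integral zero over every box in \<open>\<Omega>\<close>.\<close>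

lemma weak_gradient_unique:
  fixes u :: "real^'n \<Rightarrow> real"
  assumes \<Omega>: "open \<Omega>" and g1: "has_weak_gradient \<Omega> u g1" and g2: "has_weak_gradient \<Omega> u g2"
  shows "AE x in lebesgue. x \<in> \<Omega> \<longrightarrow> g1 x = g2 x"
proof -
  have S: "\<Omega> \<in> sets lebesgue" using \<Omega> by simp
  have li: "set_integrable lebesgue K g1" "set_integrable lebesgue K g2" if "compact K" "K \<subseteq> \<Omega>" for K
    using g1 g2 that by (auto simp: has_weak_gradient_def locally_integrable_on_def)
  define D where "D x = g1 x - g2 x" for x
  have box: "(LINT x:box a b|lebesgue. D x) = 0" if ab: "cbox a b \<subseteq> \<Omega>" for a b
  proof -
    have i1: "integrable lebesgue (\<lambda>x. indicat_real (cbox a b) x *\<^sub>R g1 x)"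
      and i2: "integrable lebesgue (\<lambda>x. indicat_real (cbox a b) x *\<^sub>R g2 x)"
      using li[OF compact_cbox ab] by (auto simp: set_integrable_def)
    have zero: "(\<integral>x. box_bump m a b x *\<^sub>R D x \<partial>lebesgue) = 0"
      and int: "integrable lebesgue (\<lambda>x. box_bump m a b x *\<^sub>R D x)" for m
    proof -
      let ?p = "box_bump m a b"
      have t: "?p \<in> test_functions \<Omega>" by (rule box_bump_test_function[OF ab])
      have pm: "?p \<in> borel_measurable lebesgue"
        using test_functionD(2)[OF t] by (intro measurable_completion) (simp add: borel_measurable_continuous_onI)
      have ip: "integrable lebesgue (\<lambda>x. ?p x *\<^sub>R g x)"
        if g: "integrable lebesgue (\<lambda>x. indicat_real (cbox a b) x *\<^sub>R g x)" for g :: "real^'n \<Rightarrow> real^'n"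
      proof -
        have eq: "?p x *\<^sub>R g x = ?p x *\<^sub>R (indicat_real (cbox a b) x *\<^sub>R g x)" for x
          using box_bump_outside[of x a b m] box_subset_cbox[of a b] by (cases "x \<in> cbox a b") auto
        have "integrable lebesgue (\<lambda>x. ?p x *\<^sub>R (indicat_real (cbox a b) x *\<^sub>R g x))"
        proof (rule Bochner_Integration.integrable_bound[OF g])
          show "(\<lambda>x. ?p x *\<^sub>R (indicat_real (cbox a b) x *\<^sub>R g x)) \<in> borel_measurable lebesgue"
            using pm borel_measurable_integrable[OF g] by (rule borel_measurable_scaleR)
          show "AE x in lebesgue. norm (?p x *\<^sub>R (indicat_real (cbox a b) x *\<^sub>R g x)) \<le> norm (indicat_real (cbox a b) x *\<^sub>R g x)"
          proof (rule AE_I2)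
            fix x
            show "norm (?p x *\<^sub>R (indicat_real (cbox a b) x *\<^sub>R g x)) \<le> norm (indicat_real (cbox a b) x *\<^sub>R g x)"
              unfolding norm_scaleR[of "?p x"] using box_bump_bounds[of m a b x]
              by (intro mult_left_le_one_le) auto
          qed
        qed
        then show ?thesis by (simp only: eq[symmetric])
      qed
      have out: "?p x *\<^sub>R g x = 0" if "x \<notin> \<Omega>" for x and g :: "real^'n \<Rightarrow> real^'n"
        using that ab box_subset_cbox[of a b] box_bump_outside[of x a b m] by auto
      have "integral\<^sup>L (lebesgue_on \<Omega>) (\<lambda>x. u x *\<^sub>R grad ?p x) = - integral\<^sup>L (lebesgue_on \<Omega>) (\<lambda>x. ?p x *\<^sub>R g1 x)"
        using g1 t unfolding has_weak_gradient_def by blast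
      moreover have "integral\<^sup>L (lebesgue_on \<Omega>) (\<lambda>x. u x *\<^sub>R grad ?p x) = - integral\<^sup>L (lebesgue_on \<Omega>) (\<lambda>x. ?p x *\<^sub>R g2 x)"
        using g2 t unfolding has_weak_gradient_def by blast
      ultimately have e0: "integral\<^sup>L (lebesgue_on \<Omega>) (\<lambda>x. ?p x *\<^sub>R g1 x) = integral\<^sup>L (lebesgue_on \<Omega>) (\<lambda>x. ?p x *\<^sub>R g2 x)" by simp
      have e: "integral\<^sup>L lebesgue (\<lambda>x. ?p x *\<^sub>R g1 x) = integral\<^sup>L lebesgue (\<lambda>x. ?p x *\<^sub>R g2 x)"
      proof -
        have "integral\<^sup>L (lebesgue_on \<Omega>) (\<lambda>x. ?p x *\<^sub>R g x) = integral\<^sup>L lebesgue (\<lambda>x. ?p x *\<^sub>R g x)" for g :: "real^'n \<Rightarrow> real^'n"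
          by (rule integral_lebesgue_on_support(1)[OF S]) (rule out)
        then show ?thesis using e0 by simp
      qed
      have d: "(\<lambda>x. ?p x *\<^sub>R D x) = (\<lambda>x. ?p x *\<^sub>R g1 x - ?p x *\<^sub>R g2 x)" by (simp add: D_def scaleR_diff_right)
      show "integrable lebesgue (\<lambda>x. ?p x *\<^sub>R D x)"
        unfolding d by (intro Bochner_Integration.integrable_diff ip i1 i2)
      show "(\<integral>x. ?p x *\<^sub>R D x \<partial>lebesgue) = 0"
        unfolding d using e by (subst Bochner_Integration.integral_diff) (auto intro: ip i1 i2)
    qed
    have iD: "integrable lebesgue (\<lambda>x. indicat_real (cbox a b) x *\<^sub>R D x)"
      using Bochner_Integration.integrable_diff[OF i1 i2] by (simp add: D_def scaleR_diff_right)
    have "(\<lambda>m. \<integral>x. box_bump m a b x *\<^sub>R D x \<partial>lebesgue) \<longlonglongrightarrow> (\<integral>x. indicator (box a b) x *\<^sub>R D x \<partial>lebesgue)"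
    proof (rule integral_dominated_convergence[where w = "\<lambda>x. norm (indicat_real (cbox a b) x *\<^sub>R D x)"])
      have eq: "indicator (box a b) x *\<^sub>R D x = indicator (box a b) x *\<^sub>R (indicat_real (cbox a b) x *\<^sub>R D x)" for x
        using box_subset_cbox[of a b] by (auto simp: indicator_def)
      show "(\<lambda>x. indicator (box a b) x *\<^sub>R D x) \<in> borel_measurable lebesgue"
        unfolding eq by (intro borel_measurable_scaleR borel_measurable_integrable[OF iD] borel_measurable_indicator) simp
      show "(\<lambda>x. box_bump m a b x *\<^sub>R D x) \<in> borel_measurable lebesgue" for m
        using int by (rule borel_measurable_integrable)
      show "integrable lebesgue (\<lambda>x. norm (indicat_real (cbox a b) x *\<^sub>R D x))"
        using iD by (rule integrable_norm)
      show "AE x in lebesgue. (\<lambda>m. box_bump m a b x *\<^sub>R D x) \<longlonglongrightarrow> indicator (box a b) x *\<^sub>R D x"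
        by (intro AE_I2 tendsto_scaleR tendsto_const box_bump_tendsto)
      show "AE x in lebesgue. norm (box_bump m a b x *\<^sub>R D x) \<le> norm (indicat_real (cbox a b) x *\<^sub>R D x)" for m
      proof (rule AE_I2)
        fix x
        show "norm (box_bump m a b x *\<^sub>R D x) \<le> norm (indicat_real (cbox a b) x *\<^sub>R D x)"
          using box_bump_bounds[of m a b x] box_bump_outside[OF contra_subsetD[OF box_subset_cbox], of x a b m]
          by (cases "x \<in> cbox a b") (auto simp: mult_left_le_one_le)
      qed
    qed
    then show ?thesis unfolding zero by (simp add: LIMSEQ_const_iff set_lebesgue_integral_def)
  qed
  have cb: "AE x in lebesgue. x \<in> cbox a b \<longrightarrow> g1 x = g2 x" if ab: "cbox a b \<subseteq> \<Omega>" for a b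
  proof -
    have "AE x in lebesgue. indicat_real (box a b) x *\<^sub>R D x = 0"
    proof (rule AE_zero_if_box_integrals_zero)
      have "set_integrable lebesgue (cbox a b) D"
        unfolding D_def[abs_def] using li[OF compact_cbox ab] by (rule set_integral_diff(1))
      then have "set_integrable lebesgue (box a b) D"
        by (rule set_integrable_subset) (auto simp: box_subset_cbox)
      then show "integrable lebesgue (\<lambda>x. indicat_real (box a b) x *\<^sub>R D x)" by (simp add: set_integrable_def)
      fix a' b' :: "real^'n"
      obtain c d where cd: "box a' b' \<inter> box a b = box c d" by (auto simp: box_Int_box)
      have "(LINT x:box a' b'|lebesgue. indicat_real (box a b) x *\<^sub>R D x) = (LINT x:box c d|lebesgue. D x)"
        unfolding set_lebesgue_integral_def cd[symmetric] by (intro Bochner_Integration.integral_cong) (auto simp: indicator_def)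
      also have "\<dots> = 0"
      proof (cases "box c d = {}")
        case False
        have "box c d \<subseteq> box a b" using cd by auto
        then have "cbox c d \<subseteq> cbox a b" using False closure_mono[of "box c d" "box a b"] box_subset_cbox[of a b]
          by (metis closure_box box_eq_empty(1) subset_empty closure_empty order_trans)
        then show ?thesis using ab box by (meson order_trans)
      qed (simp add: set_lebesgue_integral_def)
      finally show "(LINT x:box a' b'|lebesgue. indicat_real (box a b) x *\<^sub>R D x) = 0" .
    qed
    moreover have "AE x in lebesgue. x \<notin> cbox a b - box a b"
      by (rule AE_not_in) (rule null_sets_completionI[OF null_sets_cbox_Diff_box])
    ultimately show ?thesis
      by eventually_elim (auto simp: D_def indicator_def split: if_splits)
  qed
  obtain \<D> where \<D>: "countable \<D>" "\<D> \<subseteq> Pow \<Omega>" "\<And>X. X \<in> \<D> \<Longrightarrow> \<exists>a b. X = cbox a b" "\<Union>\<D> = \<Omega>"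
    using open_countable_Union_open_cbox[OF \<Omega>] by metis
  have "AE x in lebesgue. \<forall>X\<in>\<D>. x \<in> X \<longrightarrow> g1 x = g2 x"
    using \<D>(2,3) cb by (subst AE_ball_countable[OF \<D>(1)]) blast
  then show ?thesis by eventually_elim (use \<D>(4) in auto)
qed

lemma lebesgue_integrable_continuous_compact_support:
  fixes f :: "'a::euclidean_space \<Rightarrow> 'b::euclidean_space"
  assumes "continuous_on UNIV f" "compact K" "\<And>x. x \<notin> K \<Longrightarrow> f x = 0"
  shows "integrable lborel f" "integrable lebesgue f" "integral\<^sup>L lebesgue f = integral\<^sup>L lborel f"
proof -
  have m: "f \<in> borel_measurable lborel" using assms(1) by (simp add: borel_measurable_continuous_onI)
  have "integrable lborel (\<lambda>x. indicator K x *\<^sub>R f x)"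
    using assms by (intro borel_integrable_compact) (auto intro: continuous_on_subset)
  also have "(\<lambda>x. indicator K x *\<^sub>R f x) = f" using assms(3) by (auto simp: indicator_def fun_eq_iff)
  finally show i: "integrable lborel f" .
  then show "integrable lebesgue f" using m by (simp add: integrable_completion)
  show "integral\<^sup>L lebesgue f = integral\<^sup>L lborel f" using m by (rule integral_completion)
qed

text \<open>Integrate the directional derivatives of the product of the two test functions.\<close>

lemma test_function_has_weak_gradient:
  assumes \<Omega>: "open \<Omega>" and \<phi>: "\<phi> \<in> test_functions \<Omega>"
  shows "has_weak_gradient \<Omega> \<phi> (grad \<phi>)"
proof -
  have S: "\<Omega> \<in> sets lebesgue" using \<Omega> by simp
  note p = test_functionD[OF \<phi>]
  have loc: "locally_integrable_on \<Omega> f" if f: "continuous_on UNIV f" for f :: "real^'a \<Rightarrow> 'b::euclidean_space"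
    unfolding locally_integrable_on_def set_integrable_def
  proof (intro allI impI)
    fix K :: "(real^'a) set" assume K: "compact K"
    have "integrable lborel (\<lambda>x. indicat_real K x *\<^sub>R f x)"
      using K f by (intro borel_integrable_compact) (auto intro: continuous_on_subset)
    then show "integrable lebesgue (\<lambda>x. indicat_real K x *\<^sub>R f x)"
      by (subst integrable_completion) (auto dest: borel_measurable_integrable)
  qed
  have "integral\<^sup>L (lebesgue_on \<Omega>) (\<lambda>x. \<phi> x *\<^sub>R grad \<psi> x) = - integral\<^sup>L (lebesgue_on \<Omega>) (\<lambda>x. \<psi> x *\<^sub>R grad \<phi> x)"
    if \<psi>: "\<psi> \<in> test_functions \<Omega>" for \<psi>
  proof -
    note q = test_functionD[OF \<psi>]
    let ?K = "closure {x. \<phi> x \<noteq> 0}"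
    have c: "continuous_on UNIV (\<lambda>x. \<phi> x *\<^sub>R grad \<psi> x)" "continuous_on UNIV (\<lambda>x. \<psi> x *\<^sub>R grad \<phi> x)"
      by (intro continuous_intros p q)+
    have z: "\<phi> x *\<^sub>R grad \<psi> x = 0" "\<psi> x *\<^sub>R grad \<phi> x = 0" if "x \<notin> ?K" for x
      using p(6,7)[OF that] by simp_all
    note i1 = lebesgue_integrable_continuous_compact_support[OF c(1) p(4) z(1)]
      and i2 = lebesgue_integrable_continuous_compact_support[OF c(2) p(4) z(2)]
    have o: "\<phi> x *\<^sub>R grad \<psi> x = 0" "\<psi> x *\<^sub>R grad \<phi> x = 0" if "x \<notin> \<Omega>" for x
      using p(5) that z[of x] by blast+
    have "integral\<^sup>L lborel (\<lambda>x. \<phi> x *\<^sub>R grad \<psi> x) \<bullet> e + integral\<^sup>L lborel (\<lambda>x. \<psi> x *\<^sub>R grad \<phi> x) \<bullet> e = 0" for e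
    proof -
      have "has_bochner_integral lborel (\<lambda>x. \<phi> x * (grad \<psi> x \<bullet> e) + (grad \<phi> x \<bullet> e) * \<psi> x) 0"
      proof (rule integral_directional_derivative_zero[where e = e, OF has_derivative_mult[OF p(1) q(1)] _ p(4)])
        show "continuous_on UNIV (\<lambda>x. \<phi> x * (grad \<psi> x \<bullet> e) + (grad \<phi> x \<bullet> e) * \<psi> x)"
          by (intro continuous_intros p q)
        show "\<phi> x * \<psi> x = 0" if "x \<notin> ?K" for x using p(6)[OF that] by simp
      qed
      moreover have "has_bochner_integral lborel (\<lambda>x. (\<phi> x *\<^sub>R grad \<psi> x) \<bullet> e + (\<psi> x *\<^sub>R grad \<phi> x) \<bullet> e)
          (integral\<^sup>L lborel (\<lambda>x. \<phi> x *\<^sub>R grad \<psi> x) \<bullet> e + integral\<^sup>L lborel (\<lambda>x. \<psi> x *\<^sub>R grad \<phi> x) \<bullet> e)"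
        by (intro has_bochner_integral_add has_bochner_integral_inner_left has_bochner_integral_integrable i1(1) i2(1))
      ultimately show ?thesis
        by (simp add: mult.commute has_bochner_integral_iff)
    qed
    then have "(integral\<^sup>L lborel (\<lambda>x. \<phi> x *\<^sub>R grad \<psi> x) + integral\<^sup>L lborel (\<lambda>x. \<psi> x *\<^sub>R grad \<phi> x)) \<bullet> e = 0" for e
      by (simp only: inner_add_left)
    then have "integral\<^sup>L lborel (\<lambda>x. \<phi> x *\<^sub>R grad \<psi> x) + integral\<^sup>L lborel (\<lambda>x. \<psi> x *\<^sub>R grad \<phi> x) = 0"
      using inner_eq_zero_iff by blast
    moreover have "integral\<^sup>L (lebesgue_on \<Omega>) (\<lambda>x. \<phi> x *\<^sub>R grad \<psi> x) = integral\<^sup>L lborel (\<lambda>x. \<phi> x *\<^sub>R grad \<psi> x)"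
      using integral_lebesgue_on_support(1)[OF S, of "\<lambda>x. \<phi> x *\<^sub>R grad \<psi> x", OF o(1)] i1(3) by simp
    moreover have "integral\<^sup>L (lebesgue_on \<Omega>) (\<lambda>x. \<psi> x *\<^sub>R grad \<phi> x) = integral\<^sup>L lborel (\<lambda>x. \<psi> x *\<^sub>R grad \<phi> x)"
      using integral_lebesgue_on_support(1)[OF S, of "\<lambda>x. \<psi> x *\<^sub>R grad \<phi> x", OF o(2)] i2(3) by simp
    ultimately show ?thesis by (simp add: eq_neg_iff_add_eq_0)
  qed
  then show ?thesis
    unfolding has_weak_gradient_def using loc[OF p(2)] loc[OF p(3)] by blast
qed

lemma test_function_weak_grad:
  assumes \<Omega>: "open \<Omega>" and \<phi>: "\<phi> \<in> test_functions \<Omega>"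
  shows "AE x in lebesgue_on \<Omega>. weak_grad \<Omega> \<phi> x = grad \<phi> x"
proof -
  note g = test_function_has_weak_gradient[OF \<Omega> \<phi>]
  have "has_weak_gradient \<Omega> \<phi> (weak_grad \<Omega> \<phi>)"
    unfolding weak_grad_def by (rule someI[of _ "grad \<phi>"]) (rule g)
  from weak_gradient_unique[OF \<Omega> this g] show ?thesis
    using \<Omega> by (subst AE_restrict_space_iff) auto
qed

lemma test_function_sobolev_0:
  fixes \<phi> :: "real^'n \<Rightarrow> real"
  assumes \<Omega>: "open \<Omega>" and \<phi>: "\<phi> \<in> test_functions \<Omega>" and p0: "p > 0"
  shows "\<phi> \<in> sobolev_0 p \<Omega>"
proof -
  have S: "\<Omega> \<in> sets lebesgue" using \<Omega> by simp
  note p = test_functionD[OF \<phi>]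
  let ?M = "lebesgue_on \<Omega>"
  have out: "\<phi> x = 0" "grad \<phi> x = 0" if "x \<notin> \<Omega>" for x using p(5,6,7) that by blast+
  have m: "\<phi> \<in> borel_measurable ?M" "grad \<phi> \<in> borel_measurable ?M"
    by (rule borel_measurable_lebesgue_on borel_measurable_continuous_onI p(2,3))+
  have int: "integrable ?M (\<lambda>x. norm (f x) ^ p)"
    if c: "continuous_on UNIV f" and z: "\<And>x. x \<notin> closure {x. \<phi> x \<noteq> 0} \<Longrightarrow> f x = 0" for f :: "real^'n \<Rightarrow> 'b::euclidean_space"
  proof -
    have "integrable lebesgue (\<lambda>x. norm (f x) ^ p)"
    proof (rule lebesgue_integrable_continuous_compact_support(2)[OF _ p(4)])
      show "continuous_on UNIV (\<lambda>x. norm (f x) ^ p)" by (intro continuous_intros c)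
      show "norm (f x) ^ p = 0" if "x \<notin> closure {x. \<phi> x \<noteq> 0}" for x using z[OF that] p0 by simp
    qed
    moreover have "norm (f x) ^ p = 0" if "x \<notin> \<Omega>" for x
      using z[of x] p(5) that p0 by auto
    ultimately show ?thesis using integral_lebesgue_on_support(2)[OF S, of "\<lambda>x. norm (f x) ^ p"] by blast
  qed
  note wg = test_function_weak_grad[OF \<Omega> \<phi>]
  have wm: "weak_grad \<Omega> \<phi> \<in> borel_measurable ?M"
  proof -
    have "(\<lambda>x. if x \<in> \<Omega> then grad \<phi> x else 0) \<in> borel_measurable lebesgue"
      using m(2) S by (rule borel_measurable_if_I)
    moreover have "AE x in lebesgue. (if x \<in> \<Omega> then grad \<phi> x else 0) = (if x \<in> \<Omega> then weak_grad \<Omega> \<phi> x else 0)"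
      using wg S by (subst (asm) AE_restrict_space_iff) auto
    ultimately have "(\<lambda>x. if x \<in> \<Omega> then weak_grad \<Omega> \<phi> x else 0) \<in> borel_measurable lebesgue"
      by (rule borel_measurable_AE)
    then show ?thesis by (rule borel_measurable_if_D)
  qed
  have wi: "integrable ?M (\<lambda>x. norm (weak_grad \<Omega> \<phi> x) ^ p)"
  proof (rule integrable_cong_AE_imp[OF int[OF p(3) p(7)]])
    show "(\<lambda>x. norm (weak_grad \<Omega> \<phi> x) ^ p) \<in> borel_measurable ?M" using wm by measurable
    show "AE x in ?M. norm (grad \<phi> x) ^ p = norm (weak_grad \<Omega> \<phi> x) ^ p"
      using wg by eventually_elim simp
  qed
  have "\<phi> \<in> sobolev p \<Omega>"
    unfolding sobolev_def L_space_def
    using m wm wi int[OF p(2) p(6)] test_function_has_weak_gradient[OF \<Omega> \<phi>] by auto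
  moreover have "(\<integral>\<^sup>+x. ennreal (norm (grad \<phi> x - weak_grad \<Omega> \<phi> x) ^ p) \<partial>?M) = (\<integral>\<^sup>+x. 0 \<partial>?M)"
    by (rule nn_integral_cong_AE) (use wg in eventually_elim, use p0 in simp)
  ultimately show ?thesis
    unfolding sobolev_0_def using \<phi> p0
    by (auto simp: zero_power intro!: exI[of _ "\<lambda>_. \<phi>"])
qed

text \<open>The chosen \<open>weak_grad\<close> agrees almost everywhere with the classical gradient, so a test function
  competes with its classical energy.\<close>

lemma hardy_const_le_test_function:
  fixes \<phi> :: "real^'n \<Rightarrow> real"
  assumes \<Omega>: "open \<Omega>" and \<phi>: "\<phi> \<in> test_functions \<Omega>" and nz: "\<phi> z \<noteq> 0"
  shows "hardy_const \<Omega> \<le> (\<integral>\<^sup>+x. ennreal (norm (grad \<phi> x) ^ CARD('n)) \<partial>lborel)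
     / (\<integral>\<^sup>+x. ennreal (\<bar>\<phi> x\<bar> ^ CARD('n) * hardy_weight (outer_radius \<Omega>) x) \<partial>lborel)"
proof -
  have S: "\<Omega> \<in> sets lebesgue" using \<Omega> by simp
  note p = test_functionD[OF \<phi>]
  have out: "\<phi> x = 0" "grad \<phi> x = 0" if "x \<notin> \<Omega>" for x using p(5,6,7) that by blast+
  have "\<not> (AE x in lebesgue_on \<Omega>. \<phi> x = 0)"
  proof
    assume "AE x in lebesgue_on \<Omega>. \<phi> x = 0"
    then have "AE x in lebesgue. x \<in> \<Omega> \<longrightarrow> \<phi> x = 0" using S by (subst (asm) AE_restrict_space_iff) auto
    then have "AE x in lebesgue. x \<in> {x. \<phi> x = 0}" by eventually_elim (use out in auto)
    moreover have "closed {x. \<phi> x = 0}" using p(2) by (intro closed_Collect_eq) (auto intro: continuous_intros)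
    ultimately have "z \<in> {x. \<phi> x = 0}" by (intro mem_closed_if_AE_lebesgue)
    with nz show False by simp
  qed
  then have "\<phi> \<in> hardy_admissible \<Omega>"
    using test_function_sobolev_0[OF \<Omega> \<phi>, of "CARD('n)"] by (simp add: hardy_admissible_def)
  then have "hardy_const \<Omega> \<le> hardy_quotient \<Omega> \<phi>" unfolding hardy_const_def by (rule INF_lower)
  also have "(\<integral>\<^sup>+x. ennreal (norm (weak_grad \<Omega> \<phi> x) ^ CARD('n)) \<partial>lebesgue_on \<Omega>) = (\<integral>\<^sup>+x. ennreal (norm (grad \<phi> x) ^ CARD('n)) \<partial>lebesgue_on \<Omega>)"
    by (rule nn_integral_cong_AE) (use test_function_weak_grad[OF \<Omega> \<phi>] in eventually_elim, simp)
  then have "hardy_quotient \<Omega> \<phi> = (\<integral>\<^sup>+x. ennreal (norm (grad \<phi> x) ^ CARD('n)) \<partial>lebesgue_on \<Omega>)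
     / (\<integral>\<^sup>+x. ennreal (\<bar>\<phi> x\<bar> ^ CARD('n) * hardy_weight (outer_radius \<Omega>) x) \<partial>lebesgue_on \<Omega>)"
    unfolding hardy_quotient_def hardy_weight_def by simp
  also have "(\<integral>\<^sup>+x. ennreal (norm (grad \<phi> x) ^ CARD('n)) \<partial>lebesgue_on \<Omega>) = (\<integral>\<^sup>+x. ennreal (norm (grad \<phi> x) ^ CARD('n)) \<partial>lborel)"
    by (rule nn_integral_lebesgue_on_support[OF S]) (simp add: out)
  also have "(\<integral>\<^sup>+x. ennreal (\<bar>\<phi> x\<bar> ^ CARD('n) * hardy_weight (outer_radius \<Omega>) x) \<partial>lebesgue_on \<Omega>)
     = (\<integral>\<^sup>+x. ennreal (\<bar>\<phi> x\<bar> ^ CARD('n) * hardy_weight (outer_radius \<Omega>) x) \<partial>lborel)"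
    by (rule nn_integral_lebesgue_on_support[OF S]) (simp add: out zero_power)
  finally show ?thesis .
qed

section \<open>Near-extremals in the double logarithm of the radius\<close>

text \<open>The substitution \<open>y = \<delta> * ln (log_radius R \<rho>)\<close>, which makes the critical problem translation
  invariant, with the value \<open>0\<close> outside the domain of the double logarithm.\<close>

definition loglog_profile :: "real \<Rightarrow> real \<Rightarrow> (real \<Rightarrow> real) \<Rightarrow> real \<Rightarrow> real" where
  "loglog_profile R \<delta> k \<rho> = (if 0 < \<rho> \<and> \<rho> < R\<^sup>2 then k (\<delta> * ln (log_radius R \<rho>)) else 0)"

text \<open>The squared radii at which \<open>\<delta> * ln (log_radius R \<rho>)\<close> takes the values \<open>2\<close> and \<open>1\<close>; the outer one tends
  to \<open>0\<close> with \<open>\<delta>\<close>.\<close>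

definition annulus_inner :: "real \<Rightarrow> real \<Rightarrow> real" where
  "annulus_inner R \<delta> = R\<^sup>2 * exp (- 2 * exp (2 / \<delta>))"

definition annulus_outer :: "real \<Rightarrow> real \<Rightarrow> real" where
  "annulus_outer R \<delta> = R\<^sup>2 * exp (- 2 * exp (1 / \<delta>))"

lemma annulus_bounds:
  assumes "0 < R" "0 < \<delta>"
  shows "0 < annulus_inner R \<delta>" "annulus_outer R \<delta> < R\<^sup>2"
  using assms by (auto simp: annulus_inner_def annulus_outer_def)

lemma mem_annulus:
  assumes R: "0 < R" and d: "0 < \<delta>" and \<rho>: "0 < \<rho>" "\<rho> < R\<^sup>2" and S: "\<delta> * ln (log_radius R \<rho>) \<in> {1..2}"
  shows "\<rho> \<in> {annulus_inner R \<delta>..annulus_outer R \<delta>}"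
proof -
  have t: "0 < log_radius R \<rho>" using log_radius_pos \<rho> by auto
  have \<rho>eq: "\<rho> = R\<^sup>2 * exp (- 2 * log_radius R \<rho>)"
    using R \<rho> by (simp add: log_radius_def exp_minus)
  have "1 / \<delta> \<le> ln (log_radius R \<rho>)" "ln (log_radius R \<rho>) \<le> 2 / \<delta>"
    using S d by (auto simp: field_simps)
  then have "exp (1 / \<delta>) \<le> exp (ln (log_radius R \<rho>))" "exp (ln (log_radius R \<rho>)) \<le> exp (2 / \<delta>)"
    by (simp_all only: exp_le_cancel_iff)
  then have "exp (1 / \<delta>) \<le> log_radius R \<rho>" "log_radius R \<rho> \<le> exp (2 / \<delta>)"
    using t by simp_all
  then have "exp (- 2 * log_radius R \<rho>) \<le> exp (- 2 * exp (1 / \<delta>))" "exp (- 2 * exp (2 / \<delta>)) \<le> exp (- 2 * log_radius R \<rho>)"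
    by simp_all
  then have "R\<^sup>2 * exp (- 2 * log_radius R \<rho>) \<le> annulus_outer R \<delta>" "annulus_inner R \<delta> \<le> R\<^sup>2 * exp (- 2 * log_radius R \<rho>)"
    unfolding annulus_inner_def annulus_outer_def by (auto intro!: mult_left_mono)
  then show ?thesis using \<rho>eq by simp
qed

lemma loglog_profile_outside:
  assumes "0 < R" "0 < \<delta>" "\<And>y. y \<notin> {1..2} \<Longrightarrow> k y = 0" "\<rho> \<notin> {annulus_inner R \<delta>..annulus_outer R \<delta>}"
  shows "loglog_profile R \<delta> k \<rho> = 0"
  using assms mem_annulus[of R \<delta> \<rho>] unfolding loglog_profile_def by metis

lemma compact_annulus:
  "compact {x::'a::euclidean_space. x \<bullet> x \<in> {a..b}}"
proof -
  have "closed {x::'a. x \<bullet> x \<in> {a..b}}"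
    unfolding atLeastAtMost_iff by (intro closed_Collect_conj closed_Collect_le continuous_intros)
  moreover have "bounded {x::'a. x \<bullet> x \<in> {a..b}}"
    unfolding bounded_iff by (intro exI[of _ "sqrt b"]) (auto simp: norm_eq_sqrt_inner)
  ultimately show ?thesis by (simp add: compact_eq_bounded_closed)
qed

lemma continuous_loglog_profile:
  assumes R: "0 < R" and d: "0 < \<delta>" and k: "continuous_on UNIV k" "\<And>y. y \<notin> {1..2} \<Longrightarrow> k y = 0"
    and g: "continuous_on {0<..<R\<^sup>2} g"
  shows "continuous_on UNIV (\<lambda>\<rho>. loglog_profile R \<delta> k \<rho> * g \<rho>)"
proof -
  let ?A = "{annulus_inner R \<delta>..annulus_outer R \<delta>}"
  have "continuous_on {0<..<R\<^sup>2} (\<lambda>\<rho>. k (\<delta> * ln (log_radius R \<rho>)) * g \<rho>)"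
  proof -
    note l = continuous_log_radius[OF R]
    have "continuous_on {0<..<R\<^sup>2} (\<lambda>\<rho>. \<delta> * ln (log_radius R \<rho>))"
      using log_radius_pos by (intro continuous_intros l) (metis greaterThanLessThan_iff less_irrefl)
    then show ?thesis
      by (intro continuous_on_mult[OF _ g] continuous_on_compose2[OF k(1)]) auto
  qed
  then have 1: "continuous_on {0<..<R\<^sup>2} (\<lambda>\<rho>. loglog_profile R \<delta> k \<rho> * g \<rho>)"
    by (rule continuous_on_cong[THEN iffD1, rotated 2]) (auto simp: loglog_profile_def)
  have "continuous_on (- ?A) (\<lambda>\<rho>::real. 0::real)" by (rule continuous_on_const)
  then have 2: "continuous_on (- ?A) (\<lambda>\<rho>. loglog_profile R \<delta> k \<rho> * g \<rho>)"
    by (rule continuous_on_cong[THEN iffD1, rotated 2]) (use loglog_profile_outside[OF R d k(2)] in auto)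
  have "{0<..<R\<^sup>2} \<union> - ?A = UNIV"
    using annulus_bounds[OF R d] by auto
  moreover have "continuous_on ({0<..<R\<^sup>2} \<union> - ?A) (\<lambda>\<rho>. loglog_profile R \<delta> k \<rho> * g \<rho>)"
    by (rule continuous_on_open_Un[OF _ _ 1 2]) auto
  ultimately show ?thesis by simp
qed

lemma DERIV_loglog_profile:
  assumes R: "0 < R" and d: "0 < \<delta>" and k: "\<And>y. (k has_real_derivative k' y) (at y)" "\<And>y. y \<notin> {1..2} \<Longrightarrow> k y = 0"
  shows "(loglog_profile R \<delta> k has_real_derivative loglog_profile R \<delta> k' \<rho> * (- (\<delta> / (2 * \<rho> * log_radius R \<rho>)))) (at \<rho>)"
proof (cases "0 < \<rho> \<and> \<rho> < R\<^sup>2")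
  case True
  then have t: "0 < log_radius R \<rho>" using log_radius_pos by auto
  have l: "((\<lambda>\<rho>. ln (log_radius R \<rho>)) has_real_derivative (1 / log_radius R \<rho>) * - (1 / (2 * \<rho>))) (at \<rho>)"
    by (rule DERIV_chain2[OF DERIV_ln_divide DERIV_log_radius]) (use t R True in auto)
  have "((\<lambda>\<rho>. k (\<delta> * ln (log_radius R \<rho>))) has_real_derivative
      k' (\<delta> * ln (log_radius R \<rho>)) * (\<delta> * ((1 / log_radius R \<rho>) * - (1 / (2 * \<rho>))))) (at \<rho>)"
    by (rule DERIV_chain2[OF k(1) DERIV_cmult[OF l]])
  moreover have "k' (\<delta> * ln (log_radius R \<rho>)) * (\<delta> * ((1 / log_radius R \<rho>) * - (1 / (2 * \<rho>))))
      = loglog_profile R \<delta> k' \<rho> * (- (\<delta> / (2 * \<rho> * log_radius R \<rho>)))"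
    using True by (simp add: loglog_profile_def)
  ultimately have "((\<lambda>\<rho>. k (\<delta> * ln (log_radius R \<rho>))) has_real_derivative
      loglog_profile R \<delta> k' \<rho> * (- (\<delta> / (2 * \<rho> * log_radius R \<rho>)))) (at \<rho>)" by simp
  then show ?thesis
    by (rule has_field_derivative_transform_within_open[of _ _ _ "{0<..<R\<^sup>2}"])
      (use True in \<open>auto simp: loglog_profile_def\<close>)
next
  case False
  let ?A = "{annulus_inner R \<delta>..annulus_outer R \<delta>}"
  have "\<rho> \<notin> ?A" using False annulus_bounds[OF R d] by auto
  have "((\<lambda>_. 0) has_real_derivative 0) (at \<rho>)" by (rule DERIV_const)
  then have "(loglog_profile R \<delta> k has_real_derivative 0) (at \<rho>)"
    by (rule has_field_derivative_transform_within_open[of _ _ _ "- ?A"])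
      (use \<open>\<rho> \<notin> ?A\<close> loglog_profile_outside[OF R d k(2)] in auto)
  moreover have "loglog_profile R \<delta> k' \<rho> = 0" using False unfolding loglog_profile_def by (rule if_not_P)
  ultimately show ?thesis by simp
qed

text \<open>In polar coordinates \<open>dx / (norm x ^ N * t)\<close> is a constant multiple of \<open>d (ln t)\<close> on each ray: under this
  weight the variable \<open>ln (log_radius R \<rho>)\<close> is distributed like Lebesgue measure.\<close>

definition shell_density :: "real \<Rightarrow> nat \<Rightarrow> real \<Rightarrow> real" where
  "shell_density R N \<rho> = 1 / (sqrt \<rho> ^ N * log_radius R \<rho>)"

lemma continuous_shell_density:
  assumes "0 < R"
  shows "continuous_on {0<..<R\<^sup>2} (shell_density R N)"
proof -
  note l = continuous_log_radius[OF assms]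
  have "\<forall>\<rho>\<in>{0<..<R\<^sup>2}. sqrt \<rho> ^ N * log_radius R \<rho> \<noteq> 0"
    using log_radius_pos[of _ R] by (metis greaterThanLessThan_iff less_irrefl mult_eq_0_iff power_not_zero real_sqrt_eq_zero_cancel_iff)
  then show ?thesis unfolding shell_density_def[abs_def] by (intro continuous_intros l) auto
qed

lemma integrable_shell:
  assumes R: "0 < R" and d: "0 < \<delta>" and q: "continuous_on UNIV q" "\<And>y. y \<notin> {1..2} \<Longrightarrow> q y = 0"
  shows "integrable lborel (\<lambda>x::'a::euclidean_space. loglog_profile R \<delta> q (x \<bullet> x) * shell_density R N (x \<bullet> x))"
proof (rule lebesgue_integrable_continuous_compact_support(1)[OF _ compact_annulus])
  show "continuous_on UNIV (\<lambda>x::'a. loglog_profile R \<delta> q (x \<bullet> x) * shell_density R N (x \<bullet> x))"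
    by (rule continuous_on_compose2[OF continuous_loglog_profile[OF R d q continuous_shell_density[OF R]]])
      (auto intro: continuous_intros)
  show "loglog_profile R \<delta> q (x \<bullet> x) * shell_density R N (x \<bullet> x) = 0"
    if "x \<notin> {x. x \<bullet> x \<in> {annulus_inner R \<delta>..annulus_outer R \<delta>}}" for x :: 'a
    using loglog_profile_outside[OF R d q(2)] that by simp
qed

text \<open>If \<open>q\<close> has integral zero then its primitive \<open>k\<close> again vanishes off \<open>{1..2}\<close>.  The field
  \<open>x / norm x ^ N\<close> is divergence free off the origin, so testing it against \<open>k (\<delta> * ln t)\<close> leaves only
  the radial derivative of the latter, which is \<open>- \<delta> * q (\<delta> * ln t)\<close> divided by \<open>norm x * t\<close>.\<close>

lemma shell_integral_zero:
  assumes R: "0 < R" and d: "0 < \<delta>" and q: "continuous_on UNIV q" "\<And>y. y \<notin> {1..2} \<Longrightarrow> q y = 0"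
    and q0: "integral {1..2} q = 0"
  shows "(integral\<^sup>L lborel (\<lambda>x::'a::euclidean_space. loglog_profile R \<delta> q (x \<bullet> x) * shell_density R DIM('a) (x \<bullet> x))) = 0"
proof -
  let ?N = "DIM('a)"
  obtain P where P: "\<And>y. (P has_real_derivative q y) (at y)"
  proof -
    have "\<exists>P. \<forall>x::real. - \<infinity> < ereal x \<longrightarrow> ereal x < \<infinity> \<longrightarrow> (P has_vector_derivative q x) (at x)"
      using q(1) by (intro einterval_antiderivative) (auto simp: continuous_on_eq_continuous_at)
    then show ?thesis using that by (auto simp: has_real_derivative_iff_has_vector_derivative)
  qed
  define k where "k y = P y - P 1" for y
  have k: "(k has_real_derivative q y) (at y)" for y
    unfolding k_def[abs_def] using P by (auto intro!: derivative_eq_intros)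
  have P21: "P 2 = P 1"
  proof -
    have "(q has_integral (P 2 - P 1)) {1..2}"
      using P by (intro fundamental_theorem_of_calculus)
        (auto simp: has_real_derivative_iff_has_vector_derivative intro: has_vector_derivative_at_within)
    then show ?thesis using q0 by (simp add: has_integral_iff)
  qed
  have k0: "k y = 0" if "y \<notin> {1..2}" for y
  proof (cases "y < 1")
    case True
    obtain z where "y < z" "z < 1" "k 1 - k y = (1 - y) * q z" using MVT2[OF True k] by auto
    then show ?thesis using q(2)[of z] by (simp add: k_def)
  next
    case False
    then have "2 < y" using that by simp
    obtain z where "2 < z" "z < y" "k y - k 2 = (y - 2) * q z" using MVT2[OF \<open>2 < y\<close> k] by auto
    then show ?thesis using q(2)[of z] P21 by (simp add: k_def)
  qed
  define K where "K = loglog_profile R \<delta> k"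
  define K' where "K' \<rho> = loglog_profile R \<delta> q \<rho> * (- (\<delta> / (2 * \<rho> * log_radius R \<rho>)))" for \<rho>
  have DK: "(K has_real_derivative K' \<rho>) (at \<rho>)" for \<rho>
    unfolding K_def K'_def by (rule DERIV_loglog_profile[OF R d k k0])
  have cK': "continuous_on UNIV K'"
    unfolding K'_def[abs_def]
  proof (rule continuous_loglog_profile[OF R d q])
    note l = continuous_log_radius[OF R]
    have "\<forall>\<rho>\<in>{0<..<R\<^sup>2}. 2 * \<rho> * log_radius R \<rho> \<noteq> 0"
      using log_radius_pos[of _ R] by (metis greaterThanLessThan_iff less_irrefl mult_eq_0_iff zero_neq_numeral)
    then show "continuous_on {0<..<R\<^sup>2} (\<lambda>\<rho>. - (\<delta> / (2 * \<rho> * log_radius R \<rho>)))"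
      by (intro continuous_intros l) auto
  qed
  let ?A = "{x::'a. x \<bullet> x \<in> {annulus_inner R \<delta>..annulus_outer R \<delta>}}"
  define \<theta> where "\<theta> \<rho> = 1 / sqrt \<rho> ^ ?N" for \<rho>
  define \<theta>' where "\<theta>' \<rho> = - (real ?N / (2 * \<rho>)) * \<theta> \<rho>" for \<rho>
  have "has_bochner_integral lborel (\<lambda>x::'a. K (x \<bullet> x) * (real ?N * \<theta> (x \<bullet> x) + 2 * (x \<bullet> x) * \<theta>' (x \<bullet> x))
            + \<theta> (x \<bullet> x) * (((2 * K' (x \<bullet> x)) *\<^sub>R x) \<bullet> x)) 0"
  proof (rule integral_radial_divergence[where I = "{0<..}", OF _ _ compact_annulus])
    show "((\<lambda>x::'a. K (x \<bullet> x)) has_derivative (\<bullet>) ((2 * K' (x \<bullet> x)) *\<^sub>R x)) (at x)" for x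
    proof -
      have s: "((\<lambda>x::'a. x \<bullet> x) has_derivative (\<lambda>h. 2 * (x \<bullet> h))) (at x)"
        by (auto intro!: derivative_eq_intros simp: inner_commute)
      have "(\<bullet>) ((2 * K' (x \<bullet> x)) *\<^sub>R x) = (\<lambda>h. 2 * (x \<bullet> h) * K' (x \<bullet> x))" by (auto simp: fun_eq_iff)
      then show ?thesis
        using DERIV_compose_FDERIV[where f = K and g = "\<lambda>x::'a. x \<bullet> x", OF DK s] by (simp only:)
    qed
    show "continuous_on UNIV (\<lambda>x::'a. (2 * K' (x \<bullet> x)) *\<^sub>R x)"
      by (intro continuous_intros continuous_on_compose2[OF cK']) auto
    show "K (x \<bullet> x) = 0" if "x \<notin> ?A" for x :: 'a
      using loglog_profile_outside[OF R d k0] that unfolding K_def by simp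
    show "open {0::real<..}" by simp
    show "x \<bullet> x \<in> {0<..}" if "x \<in> ?A" for x :: 'a
      using that annulus_bounds(1)[OF R d] by auto
    show "(\<theta> has_real_derivative \<theta>' \<rho>) (at \<rho>)" if "\<rho> \<in> {0<..}" for \<rho>
    proof -
      have r: "\<rho> > 0" using that by simp
      have nz: "sqrt \<rho> ^ ?N \<noteq> 0" using r by simp
      obtain m where m: "?N = Suc m" using DIM_positive[where 'a = 'a] gr0_conv_Suc by blast
      have "((\<lambda>\<rho>. 1 / sqrt \<rho> ^ ?N) has_real_derivative
          (0 * sqrt \<rho> ^ ?N - 1 * (of_nat ?N * (sqrt \<rho> / (2 * \<rho>) * sqrt \<rho> ^ (?N - Suc 0)))) / (sqrt \<rho> ^ ?N * sqrt \<rho> ^ ?N)) (at \<rho>)"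
        by (rule DERIV_divide[OF DERIV_const DERIV_power[OF DERIV_sqrt_self[OF r]] nz])
      moreover have "of_nat ?N * (sqrt \<rho> / (2 * \<rho>) * sqrt \<rho> ^ (?N - Suc 0)) = (real ?N / (2 * \<rho>)) * sqrt \<rho> ^ ?N"
        unfolding m by simp
      ultimately have "((\<lambda>\<rho>. 1 / sqrt \<rho> ^ ?N) has_real_derivative
          (0 * sqrt \<rho> ^ ?N - 1 * ((real ?N / (2 * \<rho>)) * sqrt \<rho> ^ ?N)) / (sqrt \<rho> ^ ?N * sqrt \<rho> ^ ?N)) (at \<rho>)"
        by (simp only:)
      then show ?thesis unfolding \<theta>_def[abs_def]
        by (rule DERIV_cong) (use nz in \<open>simp add: \<theta>'_def \<theta>_def\<close>)
    qed
    show "continuous_on {0<..} \<theta>'"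
      unfolding \<theta>'_def[abs_def] \<theta>_def[abs_def] by (intro continuous_intros) auto
  qed
  moreover have "K (x \<bullet> x) * (real ?N * \<theta> (x \<bullet> x) + 2 * (x \<bullet> x) * \<theta>' (x \<bullet> x)) + \<theta> (x \<bullet> x) * (((2 * K' (x \<bullet> x)) *\<^sub>R x) \<bullet> x)
      = (- \<delta>) * (loglog_profile R \<delta> q (x \<bullet> x) * shell_density R ?N (x \<bullet> x))" for x :: 'a
  proof (cases "x = 0")
    case True
    then show ?thesis by (simp add: K_def loglog_profile_def)
  next
    case False
    define \<rho> where "\<rho> = x \<bullet> x"
    have r: "\<rho> > 0" using False by (simp add: \<rho>_def)
    then have "real ?N * \<theta> \<rho> + 2 * \<rho> * \<theta>' \<rho> = 0" by (simp add: \<theta>'_def)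
    moreover have "\<theta> \<rho> * (2 * K' \<rho> * \<rho>) = (- \<delta>) * (loglog_profile R \<delta> q \<rho> * shell_density R ?N \<rho>)"
      using r by (simp add: K'_def \<theta>_def shell_density_def)
    ultimately show ?thesis unfolding inner_scaleR_left \<rho>_def[symmetric] by simp
  qed
  ultimately have "has_bochner_integral lborel (\<lambda>x::'a. (- \<delta>) * (loglog_profile R \<delta> q (x \<bullet> x) * shell_density R ?N (x \<bullet> x))) 0"
    by simp
  then have "(integral\<^sup>L lborel (\<lambda>x::'a. (- \<delta>) * (loglog_profile R \<delta> q (x \<bullet> x) * shell_density R ?N (x \<bullet> x)))) = 0"
    by (rule has_bochner_integral_integral_eq)
  then show ?thesis using d by simp
qed

text \<open>Apply the preceding lemma to the combination of \<open>p\<close> and \<open>q\<close> whose integral over \<open>{1..2}\<close> vanishes.  This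
  stands in for integration in polar coordinates.\<close>

lemma shell_integral_proportional:
  assumes R: "0 < R" and d: "0 < \<delta>"
    and p: "continuous_on UNIV p" "\<And>y. y \<notin> {1..2} \<Longrightarrow> p y = 0"
    and q: "continuous_on UNIV q" "\<And>y. y \<notin> {1..2} \<Longrightarrow> q y = 0"
  shows "integral {1..2} q * (integral\<^sup>L lborel (\<lambda>x::'a::euclidean_space. loglog_profile R \<delta> p (x \<bullet> x) * shell_density R DIM('a) (x \<bullet> x)))
    = integral {1..2} p * (integral\<^sup>L lborel (\<lambda>x::'a. loglog_profile R \<delta> q (x \<bullet> x) * shell_density R DIM('a) (x \<bullet> x)))"
proof -
  let ?r = "\<lambda>y. integral {1..2} q * p y - integral {1..2} p * q y"
  have ip: "p integrable_on {1..2}" and iq: "q integrable_on {1..2}"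
    using p(1) q(1) by (auto intro!: integrable_continuous_interval intro: continuous_on_subset)
  have "integral {1..2} ?r = integral {1..2} q * integral {1..2} p - integral {1..2} p * integral {1..2} q"
    using ip iq by (subst Henstock_Kurzweil_Integration.integral_diff) (auto intro: integrable_on_mult_right)
  then have "integral {1..2} ?r = 0" by simp
  then have "(integral\<^sup>L lborel (\<lambda>x::'a. loglog_profile R \<delta> ?r (x \<bullet> x) * shell_density R DIM('a) (x \<bullet> x))) = 0"
  proof (intro shell_integral_zero[OF R d])
    show "continuous_on UNIV ?r" by (intro continuous_intros p q)
    show "?r y = 0" if "y \<notin> {1..2}" for y using p(2)[OF that] q(2)[OF that] by simp
  qed
  moreover have "loglog_profile R \<delta> ?r \<rho> * m = integral {1..2} q * (loglog_profile R \<delta> p \<rho> * m) - integral {1..2} p * (loglog_profile R \<delta> q \<rho> * m)" for \<rho> m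
    by (simp add: loglog_profile_def algebra_simps)
  ultimately show ?thesis
    using integrable_shell[OF R d p, of "DIM('a)", where 'a = 'a] integrable_shell[OF R d q, of "DIM('a)", where 'a = 'a] by simp
qed

definition unit_bump :: "real \<Rightarrow> real" where
  "unit_bump y = flat_exp 0 (y - 1) * flat_exp 0 (2 - y)"

lemma unit_bump_outside: "y \<notin> {1..2} \<Longrightarrow> unit_bump y = 0"
  by (auto simp: unit_bump_def flat_exp_0)

lemma unit_bump_pos: "1 < y \<Longrightarrow> y < 2 \<Longrightarrow> 0 < unit_bump y"
  by (simp add: unit_bump_def flat_exp_0)

lemma diff_upto_unit_bump: "diff_upto n UNIV unit_bump"
proof -
  have "diff_upto n UNIV (\<lambda>y. flat_exp 0 (y + (-1)) * flat_exp 0 (2 + (-1) * y))"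
    by (intro diff_upto_mult diff_upto_compose[OF diff_upto_flat_exp] diff_upto_add diff_upto_const diff_upto_id) auto
  moreover have "(\<lambda>y. flat_exp 0 (y + (-1)) * flat_exp 0 (2 + (-1) * y)) = unit_bump"
    by (simp add: unit_bump_def fun_eq_iff)
  ultimately show ?thesis by simp
qed

lemma diff_upto_loglog_profile:
  assumes R: "0 < R" and d: "0 < \<delta>" and k: "diff_upto n UNIV k" "\<And>y. y \<notin> {1..2} \<Longrightarrow> k y = 0"
  shows "diff_upto n UNIV (loglog_profile R \<delta> k)"
proof (rule diff_upto_zero_extension[where U = "{0<..<R\<^sup>2}"])
  show "closed {annulus_inner R \<delta>..annulus_outer R \<delta>}" by simp
  show "{annulus_inner R \<delta>..annulus_outer R \<delta>} \<subseteq> {0<..<R\<^sup>2}"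
    using annulus_bounds[OF R d] by auto
  have ln0: "diff_upto n {0<..<R\<^sup>2} ln"
    by (rule diff_upto_subset[OF diff_upto_ln]) auto
  have "diff_upto n {0<..<R\<^sup>2} (\<lambda>\<rho>. (1 / 2) * (ln (R\<^sup>2) + (-1) * ln \<rho>))"
    by (intro diff_upto_mult diff_upto_add diff_upto_const ln0)
  then have l: "diff_upto n {0<..<R\<^sup>2} (log_radius R)"
    by (rule diff_upto_cong[rotated 2]) (use R in \<open>auto simp: log_radius_def ln_div\<close>)
  have "diff_upto n {0<..<R\<^sup>2} (\<lambda>\<rho>. \<delta> * ln (log_radius R \<rho>))"
    by (intro diff_upto_mult diff_upto_const diff_upto_compose[OF diff_upto_ln l]) (auto intro: log_radius_pos)
  then have "diff_upto n {0<..<R\<^sup>2} (\<lambda>\<rho>. k (\<delta> * ln (log_radius R \<rho>)))"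
    by (rule diff_upto_compose[OF k(1)]) simp
  then show "diff_upto n {0<..<R\<^sup>2} (loglog_profile R \<delta> k)"
    by (rule diff_upto_cong[rotated 2]) (auto simp: loglog_profile_def)
  show "loglog_profile R \<delta> k \<rho> = 0" if "\<rho> \<notin> {annulus_inner R \<delta>..annulus_outer R \<delta>}" for \<rho>
    by (rule loglog_profile_outside[OF R d k(2) that])
qed simp

lemma C_k_inner_self: "C_k k (\<lambda>x. x \<bullet> x)"
proof -
  have "C_k k (\<lambda>x. \<Sum>i\<in>UNIV. x $ i * x $ i)" by (intro C_k_sum C_k_mult C_k_coord)
  then show ?thesis by (simp add: inner_vec_def)
qed

text \<open>The test function is \<open>exp (c * S) * \<eta> (\<delta> * S)\<close> with \<open>S = ln t\<close>.  Since \<open>exp (c * N * S) = t ^ (N - 1)\<close>, both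
  the \<open>N\<close>-th power of its gradient and its weighted \<open>N\<close>-th power are functions of \<open>\<delta> * S\<close> times the
  shell density.\<close>

lemma hardy_const_le_profile:
  fixes \<Omega> :: "(real^'n) set"
  assumes card: "CARD('n) = Suc n" "n \<ge> 1" and \<Omega>: "open \<Omega>" "bounded \<Omega>" "0 \<in> \<Omega>"
    and d: "0 < \<delta>" and r: "cball 0 r \<subseteq> \<Omega>" "annulus_outer (outer_radius \<Omega>) \<delta> \<le> r\<^sup>2" "0 < r"
    and \<eta>': "\<And>y. (unit_bump has_real_derivative \<eta>' y) (at y)" "continuous_on UNIV \<eta>'"
  defines "c \<equiv> real n / real (Suc n)"
  shows "hardy_const \<Omega> \<le> ennreal (integral {1..2} (\<lambda>y. \<bar>c * unit_bump y + \<delta> * \<eta>' y\<bar> ^ Suc n)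
     / integral {1..2} (\<lambda>y. \<bar>unit_bump y\<bar> ^ Suc n))"
proof -
  define R where "R = outer_radius \<Omega>"
  have R: "0 < R" using outer_radius_pos[OF \<Omega>] by (simp add: R_def)
  let ?N = "Suc n"
  have cn: "c * real ?N = real n" by (simp add: c_def)
  \<comment> \<open>In the variable \<open>y = \<delta> * S\<close> the factor \<open>exp (c * S)\<close> is \<open>exp (c / \<delta> * y)\<close>.\<close>
  define k where "k y = exp (c / \<delta> * y) * unit_bump y" for y
  define k' where "k' y = exp (c / \<delta> * y) * (c / \<delta> * unit_bump y + \<eta>' y)" for y
  define p where "p y = \<bar>c * unit_bump y + \<delta> * \<eta>' y\<bar> ^ ?N" for y
  define q where "q y = \<bar>unit_bump y\<bar> ^ ?N" for y
  have cb: "continuous_on UNIV unit_bump" using diff_upto_unit_bump[of 0] by simp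
  have \<eta>0: "\<eta>' y = 0" if "y \<notin> {1..2}" for y
  proof -
    have "((\<lambda>_. 0) has_real_derivative \<eta>' y) (at y)"
      by (rule has_field_derivative_transform_within_open[OF \<eta>'(1), of "- {1..2}"])
        (use that unit_bump_outside in auto)
    then show ?thesis using DERIV_unique DERIV_const by blast
  qed
  have k0: "k y = 0" "k' y = 0" "p y = 0" "q y = 0" if "y \<notin> {1..2}" for y
    using \<eta>0[OF that] unit_bump_outside[OF that] by (simp_all add: k_def k'_def p_def q_def)
  have cp: "continuous_on UNIV p" unfolding p_def[abs_def] by (intro continuous_intros cb \<eta>'(2))
  have cq: "continuous_on UNIV q" unfolding q_def[abs_def] by (intro continuous_intros cb)
  have Dk: "(k has_real_derivative k' y) (at y)" for y
  proof -
    have "((\<lambda>y. exp (c / \<delta> * y)) has_real_derivative exp (c / \<delta> * y) * (c / \<delta>)) (at y)"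
      using DERIV_fun_exp[OF DERIV_cmult_Id[of "c / \<delta>"]] .
    from DERIV_mult[OF this \<eta>'(1)] show ?thesis
      unfolding k_def[abs_def] k'_def by (simp add: algebra_simps)
  qed
  have sk: "diff_upto j UNIV k" for j
    unfolding k_def[abs_def]
    by (intro diff_upto_mult diff_upto_compose[OF diff_upto_exp] diff_upto_const diff_upto_id diff_upto_unit_bump) simp
  define \<phi> where "\<phi> x = loglog_profile R \<delta> k (x \<bullet> x)" for x :: "real^'n"
  have test: "\<phi> \<in> test_functions \<Omega>"
  proof (rule test_functionI[OF _ compact_annulus])
    show "C_k j \<phi>" for j
      unfolding \<phi>_def[abs_def] by (rule C_k_compose[OF diff_upto_loglog_profile[OF R d sk k0(1)] C_k_inner_self])
    show "{x. x \<bullet> x \<in> {annulus_inner R \<delta>..annulus_outer R \<delta>}} \<subseteq> \<Omega>"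
    proof
      fix x :: "real^'n" assume "x \<in> {x. x \<bullet> x \<in> {annulus_inner R \<delta>..annulus_outer R \<delta>}}"
      then have "(norm x)\<^sup>2 \<le> r\<^sup>2" using r(2) by (simp add: power2_norm_eq_inner R_def)
      then have "norm x \<le> r" using r(3) by (simp add: power2_le_iff_abs_le)
      then show "x \<in> \<Omega>" using r(1) by auto
    qed
    show "\<phi> x = 0" if "x \<notin> {x. x \<bullet> x \<in> {annulus_inner R \<delta>..annulus_outer R \<delta>}}" for x
      using loglog_profile_outside[OF R d k0(1)] that unfolding \<phi>_def by simp
  qed
  \<comment> \<open>The squared radius at which the bump is evaluated at the centre of \<open>{1..2}\<close>.\<close>
  define \<rho>0 where "\<rho>0 = R\<^sup>2 * exp (- 2 * exp ((3 / 2) / \<delta>))"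
  have \<rho>0: "0 < \<rho>0" "\<rho>0 < R\<^sup>2" "log_radius R \<rho>0 = exp ((3 / 2) / \<delta>)"
  proof -
    show "0 < \<rho>0" "\<rho>0 < R\<^sup>2" using R by (simp_all add: \<rho>0_def)
    have "R\<^sup>2 / \<rho>0 = 1 / exp (- (2 * exp ((3 / 2) / \<delta>)))" using R by (simp add: \<rho>0_def)
    also have "\<dots> = exp (2 * exp ((3 / 2) / \<delta>))" by (simp only: exp_minus inverse_eq_divide divide_divide_eq_right mult_1 div_by_1)
    finally have "R\<^sup>2 / \<rho>0 = exp (2 * exp ((3 / 2) / \<delta>))" .
    then show "log_radius R \<rho>0 = exp ((3 / 2) / \<delta>)" unfolding log_radius_def by simp
  qed
  define z :: "real^'n" where "z = sqrt \<rho>0 *\<^sub>R axis undefined 1"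
  have zz: "z \<bullet> z = \<rho>0" using \<rho>0 by (simp add: z_def inner_axis_axis)
  have "\<phi> z = k (3 / 2)" unfolding \<phi>_def zz using \<rho>0 d by (simp add: loglog_profile_def)
  then have nz: "\<phi> z \<noteq> 0" using unit_bump_pos[of "3 / 2"] by (simp add: k_def)
  have grad\<phi>: "grad \<phi> x = (2 * (loglog_profile R \<delta> k' (x \<bullet> x) * (- (\<delta> / (2 * (x \<bullet> x) * log_radius R (x \<bullet> x)))))) *\<^sub>R x" for x
  proof (rule grad_eqI)
    let ?D = "loglog_profile R \<delta> k' (x \<bullet> x) * (- (\<delta> / (2 * (x \<bullet> x) * log_radius R (x \<bullet> x))))"
    have s: "((\<lambda>x::real^'n. x \<bullet> x) has_derivative (\<lambda>h. 2 * (x \<bullet> h))) (at x)"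
      by (auto intro!: derivative_eq_intros simp: inner_commute)
    have "(\<lambda>h. ((2 * ?D) *\<^sub>R x) \<bullet> h) = (\<lambda>h. 2 * (x \<bullet> h) * ?D)" by (auto simp: fun_eq_iff)
    moreover have DK: "(loglog_profile R \<delta> k has_real_derivative ?D) (at (x \<bullet> x))"
      by (rule DERIV_loglog_profile[OF R d Dk k0(1)])
    ultimately show "(\<phi> has_derivative (\<lambda>h. ((2 * ?D) *\<^sub>R x) \<bullet> h)) (at x)"
      using DERIV_compose_FDERIV[where f = "loglog_profile R \<delta> k" and g = "\<lambda>x::real^'n. x \<bullet> x", OF DK s]
      unfolding \<phi>_def[abs_def] by (simp only:)
  qed
  define J where "J f = integral\<^sup>L lborel (\<lambda>x::real^'n. loglog_profile R \<delta> f (x \<bullet> x) * shell_density R ?N (x \<bullet> x))" for f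
  have dim: "DIM(real^'n) = ?N" using card by simp
  have ratio: "integral {1..2} q * J p = integral {1..2} p * J q"
    using shell_integral_proportional[OF R d cp k0(3) cq k0(4), where 'a = "real^'n"] unfolding dim J_def .
  have pw: "\<bar>\<phi> x\<bar> ^ ?N * hardy_weight R x = loglog_profile R \<delta> q (x \<bullet> x) * shell_density R ?N (x \<bullet> x)
      \<and> norm (grad \<phi> x) ^ ?N = loglog_profile R \<delta> p (x \<bullet> x) * shell_density R ?N (x \<bullet> x)" for x
  proof (cases "0 < x \<bullet> x \<and> x \<bullet> x < R\<^sup>2")
    case False
    then have "loglog_profile R \<delta> f (x \<bullet> x) = 0" for f unfolding loglog_profile_def by (rule if_not_P)
    then show ?thesis by (simp add: \<phi>_def grad\<phi>)
  next
    case True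
    define t where "t = log_radius R (x \<bullet> x)"
    have t: "0 < t" using log_radius_pos True by (simp add: t_def)
    have x0: "x \<noteq> 0" using True by auto
    have lt: "ln (R / norm x) = t" unfolding t_def using log_radius_norm[OF R x0] by simp
    define y where "y = \<delta> * ln t"
    have e: "exp (c / \<delta> * y) ^ ?N = t ^ n"
    proof -
      have "exp (c / \<delta> * y) ^ ?N = exp (real ?N * (c / \<delta> * y))" by (rule exp_of_nat_mult[symmetric])
      also have "real ?N * (c / \<delta> * y) = (c * real ?N) * ln t" using d by (simp add: y_def)
      also have "\<dots> = real n * ln t" unfolding cn ..
      also have "exp (real n * ln t) = t ^ n" using t by (simp add: exp_of_nat_mult)
      finally show ?thesis .
    qed
    have L: "loglog_profile R \<delta> f (x \<bullet> x) = f y" for f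
      using True by (simp add: loglog_profile_def y_def t_def)
    have sd: "shell_density R ?N (x \<bullet> x) = t ^ n / (norm x ^ ?N * t ^ ?N)"
      using t by (simp add: shell_density_def t_def[symmetric] norm_eq_sqrt_inner)
    have hw: "hardy_weight R x = 1 / (norm x ^ ?N * t ^ ?N)"
      unfolding hardy_weight_def lt card ..
    have "\<bar>\<phi> x\<bar> ^ ?N = t ^ n * q y"
      unfolding \<phi>_def L k_def abs_mult power_mult_distrib q_def abs_exp_cancel e ..
    then have 1: "\<bar>\<phi> x\<bar> ^ ?N * hardy_weight R x = loglog_profile R \<delta> q (x \<bullet> x) * shell_density R ?N (x \<bullet> x)"
      unfolding L sd hw by simp
    have g: "norm (grad \<phi> x) = exp (c / \<delta> * y) * \<bar>c * unit_bump y + \<delta> * \<eta>' y\<bar> / (norm x * t)"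
    proof -
      have xx: "x \<bullet> x = norm x * norm x" by (simp add: power2_norm_eq_inner[symmetric] power2_eq_square)
      have "norm (grad \<phi> x) = \<bar>2 * (k' y * (- (\<delta> / (2 * (x \<bullet> x) * t))))\<bar> * norm x"
        unfolding grad\<phi> L t_def[symmetric] by simp
      also have "\<dots> = \<bar>\<delta> * k' y\<bar> / (norm x * t)"
        unfolding xx using t x0 by (simp add: abs_mult field_simps)
      also have "\<delta> * k' y = exp (c / \<delta> * y) * (c * unit_bump y + \<delta> * \<eta>' y)"
        using d by (simp add: k'_def field_simps)
      finally show ?thesis by (simp add: abs_mult)
    qed
    have "norm (grad \<phi> x) ^ ?N = t ^ n * p y / (norm x ^ ?N * t ^ ?N)"
      unfolding g power_divide power_mult_distrib e p_def ..
    then have 2: "norm (grad \<phi> x) ^ ?N = loglog_profile R \<delta> p (x \<bullet> x) * shell_density R ?N (x \<bullet> x)"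
      unfolding L sd by simp
    from 1 2 show ?thesis by blast
  qed
  have nonneg: "0 \<le> loglog_profile R \<delta> f \<rho> * shell_density R ?N \<rho>" if "\<And>y. 0 \<le> f y" for f \<rho>
  proof (cases "0 < \<rho> \<and> \<rho> < R\<^sup>2")
    case True
    then have "0 < log_radius R \<rho>" using log_radius_pos by blast
    then show ?thesis using that True by (simp add: loglog_profile_def shell_density_def)
  next
    case False
    then have "loglog_profile R \<delta> f \<rho> = 0" unfolding loglog_profile_def by (rule if_not_P)
    then show ?thesis by simp
  qed
  have p0: "0 \<le> p y" "0 \<le> q y" for y by (simp_all add: p_def q_def)
  have G: "(\<integral>\<^sup>+x. ennreal (norm (grad \<phi> x) ^ CARD('n)) \<partial>lborel) = ennreal (J p)"
    unfolding card pw[THEN conjunct2] J_def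
    by (rule nn_integral_eq_integral[OF integrable_shell[OF R d cp k0(3)]]) (auto intro: nonneg p0)
  have A: "(\<integral>\<^sup>+x. ennreal (\<bar>\<phi> x\<bar> ^ CARD('n) * hardy_weight R x) \<partial>lborel) = ennreal (J q)"
    unfolding card pw[THEN conjunct1] J_def
    by (rule nn_integral_eq_integral[OF integrable_shell[OF R d cq k0(4)]]) (auto intro: nonneg p0)
  have J0: "0 \<le> J p" "0 \<le> J q"
    unfolding J_def by (intro integral_nonneg_AE AE_I2 nonneg p0)+
  have iq: "0 < integral {1..2} q"
  proof -
    have c12: "continuous_on (cbox 1 2) q" using cq by (rule continuous_on_subset) simp
    have "0 \<le> integral {1..2} q"
      using p0(2) c12 by (intro integral_nonneg) (auto intro: integrable_continuous_interval)
    moreover have "integral {1..2} q \<noteq> 0"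
    proof
      assume "integral {1..2} q = 0"
      then have "(q has_integral 0) (cbox 1 2)"
        using integrable_continuous[OF c12] by (simp add: has_integral_iff)
      then have "q (3 / 2) = 0"
        by (rule has_integral_0_cbox_imp_0[OF c12, rotated]) (auto simp: p0)
      then show False using unit_bump_pos[of "3 / 2"] by (simp add: q_def)
    qed
    ultimately show ?thesis by simp
  qed
  have ip: "0 \<le> integral {1..2} p"
    using p0(1) cp by (intro integral_nonneg) (auto intro: integrable_continuous_interval continuous_on_subset)
  have "hardy_const \<Omega> \<le> ennreal (J p) / ennreal (J q)"
    using hardy_const_le_test_function[OF \<Omega>(1) test nz] unfolding R_def[symmetric] G A .
  also have "\<dots> \<le> ennreal (integral {1..2} p / integral {1..2} q)"
  proof -
    have Jp: "J p = integral {1..2} p / integral {1..2} q * J q" using ratio iq by (simp add: field_simps)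
    show ?thesis
    proof (cases "J q = 0")
      \<comment> \<open>Then both integrals vanish, and \<open>0 / 0 = 0\<close> in \<open>ennreal\<close>.\<close>
      case True
      then show ?thesis using Jp by simp
    next
      case False
      then show ?thesis using Jp J0 by (simp add: divide_ennreal)
    qed
  qed
  finally show ?thesis unfolding p_def q_def .
qed

lemma hardy_const_upper:
  fixes \<Omega> :: "(real^'n) set"
  assumes card: "CARD('n) = Suc n" "n \<ge> 1" and \<Omega>: "open \<Omega>" "bounded \<Omega>" "0 \<in> \<Omega>"
  shows "hardy_const \<Omega> \<le> ennreal ((real n / real (Suc n)) ^ Suc n)"
proof -
  define c where "c = real n / real (Suc n)"
  define R where "R = outer_radius \<Omega>"
  have R: "0 < R" using outer_radius_pos[OF \<Omega>] by (simp add: R_def)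
  obtain \<eta>' where "\<forall>y\<in>UNIV. (unit_bump has_real_derivative \<eta>' y) (at y)" "diff_upto 0 UNIV \<eta>'"
    using diff_upto_unit_bump[of "Suc 0"] by auto
  then have \<eta>': "\<And>y. (unit_bump has_real_derivative \<eta>' y) (at y)" "continuous_on UNIV \<eta>'" by auto
  obtain r where r: "0 < r" "cball 0 r \<subseteq> \<Omega>" using \<Omega> unfolding open_contains_cball by blast
  \<comment> \<open>For \<open>\<delta> < 1 / (L + 1)\<close> the annulus lies in \<open>cball 0 r\<close>.\<close>
  define L where "L = \<bar>ln (R\<^sup>2 / r\<^sup>2)\<bar>"
  define P where "P \<delta> = integral {1..2} (\<lambda>y. \<bar>c * unit_bump y + \<delta> * \<eta>' y\<bar> ^ Suc n)" for \<delta>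
  define Q where "Q = integral {1..2} (\<lambda>y. \<bar>unit_bump y\<bar> ^ Suc n)"
  have le: "hardy_const \<Omega> \<le> ennreal (P \<delta> / Q)" if \<delta>: "0 < \<delta>" "\<delta> < 1 / (L + 1)" for \<delta>
    unfolding P_def Q_def c_def
  proof (rule hardy_const_le_profile[OF card \<Omega> \<delta>(1) r(2) _ r(1) \<eta>'])
    have L0: "0 < L + 1" by (simp add: L_def)
    have "ln (R\<^sup>2 / r\<^sup>2) \<le> L + 1" by (simp add: L_def)
    also have "L + 1 \<le> 1 / \<delta>" using \<delta> L0 by (simp add: field_simps)
    also have "1 / \<delta> \<le> exp (1 / \<delta>)" using exp_ge_add_one_self[of "1 / \<delta>"] by linarith
    also have "\<dots> \<le> 2 * exp (1 / \<delta>)" by simp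
    finally have "- (2 * exp (1 / \<delta>)) \<le> - ln (R\<^sup>2 / r\<^sup>2)" by simp
    then have "exp (- (2 * exp (1 / \<delta>))) \<le> exp (- ln (R\<^sup>2 / r\<^sup>2))" by (simp only: exp_le_cancel_iff)
    also have "\<dots> = r\<^sup>2 / R\<^sup>2" using R r by (simp add: exp_minus)
    finally show "annulus_outer (outer_radius \<Omega>) \<delta> \<le> r\<^sup>2"
      using R by (simp add: annulus_outer_def R_def[symmetric] field_simps)
  qed
  have cb: "continuous_on UNIV unit_bump" using diff_upto_unit_bump[of 0] by simp
  \<comment> \<open>The bound at \<open>\<delta> = 0\<close> would be the constant itself, but the profile exists only for positive \<open>\<delta>\<close>.\<close>
  have "continuous_on UNIV P"
  proof -
    have "continuous_on (UNIV \<times> cbox 1 2) (\<lambda>(\<delta>, y). \<bar>c * unit_bump y + \<delta> * \<eta>' y\<bar> ^ Suc n)"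
      unfolding split_beta
      by (intro continuous_intros continuous_on_compose2[OF cb] continuous_on_compose2[OF \<eta>'(2)]) auto
    from integral_continuous_on_param[OF this] show ?thesis unfolding P_def[abs_def] by simp
  qed
  then have "isCont P 0" by (simp add: continuous_on_eq_continuous_at)
  then have "(P \<longlongrightarrow> P 0) (at_right 0)" by (simp add: isCont_def filterlim_at_split)
  then have "((\<lambda>\<delta>. ennreal (P \<delta> / Q)) \<longlongrightarrow> ennreal (P 0 / Q)) (at_right 0)"
    by (intro tendsto_ennrealI) (simp add: divide_inverse tendsto_mult_right)
  moreover have "\<forall>\<^sub>F \<delta> in at_right 0. hardy_const \<Omega> \<le> ennreal (P \<delta> / Q)"
  proof -
    have "0 < 1 / (L + 1)" by (simp add: L_def)
    from eventually_at_right_real[OF this] show ?thesis by (rule eventually_mono) (auto intro: le)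
  qed
  ultimately have "hardy_const \<Omega> \<le> ennreal (P 0 / Q)"
    by (rule tendsto_lowerbound) simp
  moreover have "P 0 = c ^ Suc n * Q"
  proof -
    have "0 \<le> c" by (simp add: c_def)
    then have "P 0 = integral {1..2} (\<lambda>y. c ^ Suc n * \<bar>unit_bump y\<bar> ^ Suc n)"
      unfolding P_def by (simp add: abs_mult power_mult_distrib del: power_Suc)
    then show ?thesis unfolding Q_def by (simp only: Henstock_Kurzweil_Integration.integral_mult_right)
  qed
  moreover have "c ^ Suc n * Q / Q \<le> c ^ Suc n" by (cases "Q = 0") (simp_all add: c_def)
  ultimately show ?thesis unfolding c_def by (metis ennreal_leI order_trans)
qed

theorem theorem1:
  fixes \<Omega> :: "(real^'n) set" and R :: real
  assumes "CARD('n) \<ge> 2"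
    and "open \<Omega>" and "connected \<Omega>" and "bounded \<Omega>" and "0 \<in> \<Omega>"
    and "R = (SUP x\<in>\<Omega>. norm x)"
  shows "hardy_const \<Omega> = hardy_const (ball (0 :: real^'n) R) \<and>
         hardy_const (ball (0 :: real^'n) R) =
           ennreal (((real CARD('n) - 1) / real CARD('n)) ^ CARD('n)) \<and>
         \<not> hardy_attained \<Omega>"
proof -
  let ?C = "ennreal (((real CARD('n) - 1) / real CARD('n)) ^ CARD('n))"
  obtain n where n: "CARD('n) = Suc n" "n \<ge> 1" using assms(1) by (cases "CARD('n)") auto
  have const: "hardy_const U = ?C" if U: "open U" "bounded U" "0 \<in> U" for U :: "(real^'n) set"
  proof (rule antisym)
    show "hardy_const U \<le> ?C" using hardy_const_upper[OF n U] unfolding n(1) by simp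
    show "?C \<le> hardy_const U"
      unfolding hardy_const_def using hardy_quotient_bound[OF assms(1) U] by (intro INF_greatest) (rule less_imp_le)
  qed
  have "0 < R" using outer_radius_pos(1)[of \<Omega>] assms by (simp add: outer_radius_def)
  then have "hardy_const (ball (0 :: real^'n) R) = ?C" by (intro const) auto
  moreover have "hardy_const \<Omega> = ?C" using assms by (intro const) auto
  moreover have "\<not> hardy_attained \<Omega>"
    unfolding hardy_attained_def \<open>hardy_const \<Omega> = ?C\<close>
    using hardy_quotient_bound[OF assms(1,2,4,5)] by (metis less_irrefl)
  ultimately show ?thesis by simp
qed

end
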